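(* (1) For every $\alpha>2$ and $k>2$ there are constants $c(\alpha,k),C(\alpha,k)>0$ depending only on $\alpha,k$ such that for all $n$, \[\exp\big(c(\alpha,k)\sqrt{\log n}\big)\le E_k(\alpha,n)\le F_k(\alpha,n)\le \exp\big(C(\alpha,k)\sqrt{\log n}\big).\] (2) For every $1<\alpha<2$ and $k>2$ there are constants $c(\alpha,k),C(\alpha,k)>0$ depending only on $\alpha,k$ such that for all $n$, \[c(\alpha,k)\frac{\log n}{\log\log n}\le E_k(\alpha,n)\le F_k(\alpha,n)\le C(\alpha,k)\frac{\log n}{\log\log n}.\] Moreover, the lower and upper bounds stated above for $E_k(\alpha,n)$ (in both regimes of $\alpha$) also hold for $k\in(1,2)$.
   Context: For metric spaces $M,X$ and an injective map $f:M\to X$, the distortion is $\mathrm{dist}(f)=\sup_{x\ne y}\frac{d_X(f(x),f(y))}{d_M(x,y)}\cdot\sup_{x\ne y}\frac{d_M(x,y)}{d_X(f(x),f(y))}$. $M$ $\alpha$-embeds in $X$ if some $f$ has $\mathrm{dist}(f)\le\alpha$; $M$ and $X$ are $\alpha$-equivalent if this holds for a bijection $f$. An equilateral space is a metric space in which all pairwise distances are equal. For a finite metric space $S$, $c_{\mathrm{eq}}(S)$ is the least distortion of an embedding of $S$ into an equilateral space. For $k\ge 1$, a $k$-HST is a metric space whose points are the leaves of a finite rooted tree $T$, each vertex $u$ carrying a label $\Delta(u)\ge0$ with $\Delta(u)=0$ iff $u$ is a leaf and $\Delta(u)\le\Delta(v)/k$ whenever $u$ is a child of $v$; the distance between leaves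 $x,y$ is $\Delta(\mathrm{lca}(x,y))$. It is binary if every vertex of $T$ has at most two children. $E_k(\alpha,n)$ is the largest integer $m$ such that every $n$-point metric space has an $m$-point subspace that $\alpha$-embeds into some space which is a binary $k$-HST or an equilateral space. For $k>2$, $F_k(\alpha,n)$ is the largest $m$ such that every $n$-point metric space has an $m$-point subspace which is $\alpha$-equivalent to an equilateral space or to a metric space $Z$ with $c_{\mathrm{eq}}(S)\ge k$ for all $S\subset Z$, $|S|\ge3$. *)

theory Defs
  imports "HOL-Analysis.Analysis"
begin

(* Suprema are taken in ennreal, so that they always exist: they may be infinite, and the
   supremum over the empty set of pairs (a space with at most one point) is 0.  Hence a map
   defined on at most one point has distortion 0, which is below every bound. *)

definition distortion ::
  "'a set \<Rightarrow> ('a \<Rightarrow> 'a \<Rightarrow> real) \<Rightarrow> ('b \<Rightarrow> 'b \<Rightarrow> real) \<Rightarrow> ('a \<Rightarrow> 'b) \<Rightarrow> ennreal" where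
  "distortion M d\<^sub>M d\<^sub>X f =
     (SUP (x, y) \<in> {(x, y). x \<in> M \<and> y \<in> M \<and> x \<noteq> y}. ennreal (d\<^sub>X (f x) (f y) / d\<^sub>M x y)) *
     (SUP (x, y) \<in> {(x, y). x \<in> M \<and> y \<in> M \<and> x \<noteq> y}. ennreal (d\<^sub>M x y / d\<^sub>X (f x) (f y)))"

definition embeds ::
  "real \<Rightarrow> 'a set \<Rightarrow> ('a \<Rightarrow> 'a \<Rightarrow> real) \<Rightarrow> 'b set \<Rightarrow> ('b \<Rightarrow> 'b \<Rightarrow> real) \<Rightarrow> bool" where
  "embeds \<alpha> M d\<^sub>M X d\<^sub>X \<longleftrightarrow>
     (\<exists>f. f ` M \<subseteq> X \<and> inj_on f M \<and> distortion M d\<^sub>M d\<^sub>X f \<le> ennreal \<alpha>)"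

definition equivalent_spaces ::
  "real \<Rightarrow> 'a set \<Rightarrow> ('a \<Rightarrow> 'a \<Rightarrow> real) \<Rightarrow> 'b set \<Rightarrow> ('b \<Rightarrow> 'b \<Rightarrow> real) \<Rightarrow> bool" where
  "equivalent_spaces \<alpha> M d\<^sub>M X d\<^sub>X \<longleftrightarrow>
     (\<exists>f. bij_betw f M X \<and> distortion M d\<^sub>M d\<^sub>X f \<le> ennreal \<alpha>)"

definition equilateral :: "'a set \<Rightarrow> ('a \<Rightarrow> 'a \<Rightarrow> real) \<Rightarrow> bool" where
  "equilateral X d \<longleftrightarrow>
     Metric_space X d \<and> (\<exists>c. \<forall>x\<in>X. \<forall>y\<in>X. x \<noteq> y \<longrightarrow> d x y = c)"

(* The target may be taken of the same type as S: distortion depends only on the image of S,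
   which has the cardinality of S, and subspaces of equilateral spaces are equilateral. *)

definition c_eq :: "'a set \<Rightarrow> ('a \<Rightarrow> 'a \<Rightarrow> real) \<Rightarrow> ennreal" where
  "c_eq S d = Inf {distortion S d e f | (X :: 'a set) e f.
     equilateral X e \<and> f ` S \<subseteq> X \<and> inj_on f S}"

(* A rooted tree is given by its vertex set V, the set E of (parent, child) pairs, and its root. *)

definition finite_rooted_tree :: "'a set \<Rightarrow> ('a \<times> 'a) set \<Rightarrow> 'a \<Rightarrow> bool" where
  "finite_rooted_tree V E r \<longleftrightarrow>
     finite V \<and> r \<in> V \<and> E \<subseteq> V \<times> V \<and>
     (\<forall>u. (u, r) \<notin> E) \<and>
     (\<forall>v\<in>V - {r}. \<exists>!u. (u, v) \<in> E) \<and>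
     (\<forall>v\<in>V. (r, v) \<in> E\<^sup>*)"

definition leaves :: "'a set \<Rightarrow> ('a \<times> 'a) set \<Rightarrow> 'a set" where
  "leaves V E = {v \<in> V. \<forall>u. (v, u) \<notin> E}"

definition lca :: "('a \<times> 'a) set \<Rightarrow> 'a \<Rightarrow> 'a \<Rightarrow> 'a" where
  "lca E x y = (THE u. (u, x) \<in> E\<^sup>* \<and> (u, y) \<in> E\<^sup>* \<and>
     (\<forall>w. (w, x) \<in> E\<^sup>* \<and> (w, y) \<in> E\<^sup>* \<longrightarrow> (w, u) \<in> E\<^sup>*))"

definition HST_tree ::
  "real \<Rightarrow> 'a set \<Rightarrow> ('a \<times> 'a) set \<Rightarrow> 'a \<Rightarrow> ('a \<Rightarrow> real) \<Rightarrow> 'a set \<Rightarrow> ('a \<Rightarrow> 'a \<Rightarrow> real) \<Rightarrow> bool" where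
  "HST_tree k V E r \<Delta> X d \<longleftrightarrow>
     finite_rooted_tree V E r \<and>
     (\<forall>u\<in>V. 0 \<le> \<Delta> u \<and> (\<Delta> u = 0 \<longleftrightarrow> u \<in> leaves V E)) \<and>
     (\<forall>(v, u)\<in>E. \<Delta> u \<le> \<Delta> v / k) \<and>
     Metric_space X d \<and> X = leaves V E \<and>
     (\<forall>x\<in>X. \<forall>y\<in>X. d x y = \<Delta> (lca E x y))"

(* Points are vertices, so the inner vertices are drawn from the type of the points.  This
   is only used at type nat, which always has enough elements outside X. *)

definition binary_HST :: "real \<Rightarrow> 'a set \<Rightarrow> ('a \<Rightarrow> 'a \<Rightarrow> real) \<Rightarrow> bool" where
  "binary_HST k X d \<longleftrightarrow>
     (\<exists>V E r \<Delta>. HST_tree k V E r \<Delta> X d \<and> (\<forall>v\<in>V. card (E `` {v}) \<le> 2))"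

(* Every finite metric space is isometric to one on a set of natural numbers, so in the
   definitions of E_k and F_k all spaces are carried by sets of natural numbers.  The same
   holds for the targets: binary HSTs and the spaces Z (being in bijection with a finite
   space) are finite, and of an equilateral target only the finite image matters. *)

lemma finite_metric_space_on_nat:
  fixes M :: "'a set"
  assumes "Metric_space M d" and "finite M"
  shows "\<exists>(N :: nat set) e f. Metric_space N e \<and> bij_betw f M N \<and>
    (\<forall>x\<in>M. \<forall>y\<in>M. e (f x) (f y) = d x y)"
proof -
  interpret Metric_space M d by fact
  obtain f :: "'a \<Rightarrow> nat" where f: "inj_on f M"
    using assms(2) finite_imp_inj_to_nat_seg by blast
  define g where "g = inv_into M f"
  have gf: "g (f x) = x" if "x \<in> M" for x
    using f that by (simp add: g_def)
  have gM: "g i \<in> M" if "i \<in> f ` M" for i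
    using that by (auto simp: gf)
  have "Metric_space (f ` M) (\<lambda>i j. d (g i) (g j))"
  proof
    fix i j l assume i: "i \<in> f ` M" and j: "j \<in> f ` M"
    show "d (g i) (g j) = 0 \<longleftrightarrow> i = j"
      using i j gM[OF i] gM[OF j] zero[of "g i" "g j"] by (auto simp: gf)
    assume "l \<in> f ` M"
    then show "d (g i) (g l) \<le> d (g i) (g j) + d (g j) (g l)"
      using i j gM by (intro triangle) auto
  qed (simp_all add: commute)
  moreover have "bij_betw f M (f ` M)"
    by (rule inj_on_imp_bij_betw) (rule f)
  moreover have "\<forall>x\<in>M. \<forall>y\<in>M. d (g (f x)) (g (f y)) = d x y"
    by (simp add: gf)
  ultimately show ?thesis
    by (intro exI[of _ "f ` M"] exI[of _ "\<lambda>i j. d (g i) (g j)"] exI[of _ f]) simp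
qed

definition E_num :: "real \<Rightarrow> real \<Rightarrow> nat \<Rightarrow> nat" where
  "E_num k \<alpha> n = (GREATEST m. \<forall>(M :: nat set) d.
     Metric_space M d \<and> finite M \<and> card M = n \<longrightarrow>
     (\<exists>N\<subseteq>M. card N = m \<and>
        (\<exists>(X :: nat set) e. (binary_HST k X e \<or> equilateral X e) \<and> embeds \<alpha> N d X e)))"

definition F_num :: "real \<Rightarrow> real \<Rightarrow> nat \<Rightarrow> nat" where
  "F_num k \<alpha> n = (GREATEST m. \<forall>(M :: nat set) d.
     Metric_space M d \<and> finite M \<and> card M = n \<longrightarrow>
     (\<exists>N\<subseteq>M. card N = m \<and>
        (\<exists>(Z :: nat set) e. Metric_space Z e \<and>
           (equilateral Z e \<or> (\<forall>S\<subseteq>Z. finite S \<and> 3 \<le> card S \<longrightarrow> ennreal k \<le> c_eq S e)) \<and>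
           equivalent_spaces \<alpha> N d Z e)))"

end

(* The idea for the lower bounds: let t be the desired size of a nearly equilateral subspace and
   suppose that there is none.  Then the nets of a ball at a fixed relative scale have a bounded number
   l of points: for \<alpha> > 2, an s-separated subset of a ball of radius \<alpha> s / 2 is nearly equilateral, so
   that the space is doubling and l is a power of t; for \<alpha> < 2, colouring distances by their logarithm
   and Ramsey's theorem give l = exp(O(t)).  Bounded nets yield a subspace of n^(c / log l) points that
   is close to a binary HST: in the smallest ball with more than half of the points take a dense small
   cluster, take a dense cluster in every other shell around its centre, recurse into the clusters
   and join the results in a caterpillar.  Its distances are almost exact because the shells are
   geometrically separated.  The bounds follow with t = exp(sqrt(log n)) and t = log n / log log n.

   For the upper bounds take words of length h over an alphabet of D letters, the distance being
   K^(h - i - 1) * g, where i is the first place at which the words differ and g, with values in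
   {1, 2}, depends on the two letters there.  A nearly equilateral subset is spread over the letters
   of one place.  A subset equivalent to a space without nearly equilateral triples branches at each
   node into at most a constant number R of letters, by Ramsey's theorem for triangles, and hence has
   at most R^h points.  For \<alpha> > 2 take g = 1 and D = 2^h; for \<alpha> < 2 let g come from a graph without
   homogeneous sets of more than O(log D) vertices and h = O(log log n). *)
theory Submission
  imports Defs
begin

section \<open>Rooted trees\<close>

text \<open>The net bound l enters the size of the HST only through the exponent ln 2 / ln (4 * l).
  For \<alpha> > 2, ln l is proportional to ln t, so ln n / ln t is balanced against ln t; for
  \<alpha> < 2, ln l is proportional to t, so ln n / t is balanced against ln t. Words give the same
  equations from above: n = D^h, with R^h weighed against D itself or against O(log D). The obstacle
  in the lower bound is loss that accumulates over the scales. A join leaves the distances inside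
  its two parts alone and gives all cross pairs one label, so each pair pays the factor \<alpha>
  only once. The ball is taken at a critical radius because then a centre chosen inside it has
  constant fractions of the points both near and far: two contributions per round are what makes the
  exponent work. HSTs are handled as iterated joins; trees in the sense of the definition are built
  from them only at the end. Lower bounds are proved for \<open>E_num\<close> with 1 \<le> k and
  upper bounds for \<open>F_num\<close> with 1 < k. The link E \<le> F holds since any three leaves
  of a binary k-HST have two distances of ratio at least k.\<close>

lemma finite_rooted_tree_unique_parent:
  assumes "finite_rooted_tree V E r" "(u, w) \<in> E" "(u', w) \<in> E"
  shows "u = u'"
  using assms unfolding finite_rooted_tree_def by blast

text \<open>A vertex on a cycle has its unique parent on a cycle too, so a cycle can be carried up
  the path to the root, which has no parent.\<close>

lemma finite_rooted_tree_acyclic: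
  assumes T: "finite_rooted_tree V E r"
  shows "acyclic E"
proof (rule acyclicI, rule allI, rule notI)
  fix v assume v: "(v, v) \<in> E\<^sup>+"
  have pred: "(u, u) \<in> E\<^sup>+" if "(u, w) \<in> E" "(w, w) \<in> E\<^sup>+" for u w
  proof -
    from that(2) obtain u' where "(w, u') \<in> E\<^sup>*" "(u', w) \<in> E"
      by (meson tranclD2)
    with finite_rooted_tree_unique_parent[OF T that(1)] that(1) show ?thesis
      by (metis rtrancl_into_trancl2)
  qed
  have "v \<in> V"
    using v T unfolding finite_rooted_tree_def by (meson SigmaD2 subsetD tranclD2)
  then have "(r, v) \<in> E\<^sup>*"
    using T unfolding finite_rooted_tree_def by blast
  then have "(r, r) \<in> E\<^sup>+"
    by (rule converse_rtrancl_induct[where P="\<lambda>w. (w, w) \<in> E\<^sup>+"]) (use v pred in auto)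
  then show False
    using T unfolding finite_rooted_tree_def by (meson tranclD2)
qed

text \<open>The predicate under the \<open>THE\<close> of \<open>lca\<close>. It can be exhibited
  and moved between trees without any uniqueness argument; \<open>lca_eqI\<close> then turns it into
  a value of \<open>lca\<close>.\<close>

definition is_lca :: "('a \<times> 'a) set \<Rightarrow> 'a \<Rightarrow> 'a \<Rightarrow> 'a \<Rightarrow> bool" where
  "is_lca E x y u \<longleftrightarrow> (u, x) \<in> E\<^sup>* \<and> (u, y) \<in> E\<^sup>* \<and>
     (\<forall>w. (w, x) \<in> E\<^sup>* \<and> (w, y) \<in> E\<^sup>* \<longrightarrow> (w, u) \<in> E\<^sup>*)"

lemma lca_eqI:
  assumes "acyclic E" "is_lca E x y u"
  shows "lca E x y = u"
  unfolding lca_def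
proof (rule the_equality)
  show "(u, x) \<in> E\<^sup>* \<and> (u, y) \<in> E\<^sup>* \<and>
     (\<forall>w. (w, x) \<in> E\<^sup>* \<and> (w, y) \<in> E\<^sup>* \<longrightarrow> (w, u) \<in> E\<^sup>*)"
    using assms(2) unfolding is_lca_def .
next
  fix v
  assume "(v, x) \<in> E\<^sup>* \<and> (v, y) \<in> E\<^sup>* \<and>
     (\<forall>w. (w, x) \<in> E\<^sup>* \<and> (w, y) \<in> E\<^sup>* \<longrightarrow> (w, v) \<in> E\<^sup>*)"
  then have "(v, u) \<in> E\<^sup>*" "(u, v) \<in> E\<^sup>*"
    using assms(2) unfolding is_lca_def by blast+
  then show "v = u"
    using acyclic_impl_antisym_rtrancl[OF assms(1)] by (meson antisymD)
qed

lemma rtrancl_rooted_tree_vertex: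
  assumes "finite_rooted_tree V E r" "(u, v) \<in> E\<^sup>*" "v \<in> V"
  shows "u \<in> V"
  using assms(2,3,1) unfolding finite_rooted_tree_def
  by (induction rule: converse_rtrancl_induct) auto

lemma ancestors_chain:
  assumes T: "finite_rooted_tree V E r" and "(u, x) \<in> E\<^sup>*" "(v, x) \<in> E\<^sup>*"
  shows "(u, v) \<in> E\<^sup>* \<or> (v, u) \<in> E\<^sup>*"
  using assms(2,3)
proof (induction rule: rtrancl_induct)
  case base
  then show ?case by blast
next
  case (step y z)
  from step.prems show ?case
  proof (cases rule: rtranclE)
    case base
    then show ?thesis
      using step.hyps by (meson rtrancl.rtrancl_into_rtrancl)
  next
    case (step w)
    then show ?thesis
      using \<open>(y, z) \<in> E\<close> step.IH finite_rooted_tree_unique_parent[OF T] by metis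
  qed
qed

text \<open>Take a common ancestor with no common ancestor strictly below it. All ancestors of x are
  comparable, so every other common ancestor lies above it.\<close>

lemma ex_is_lca:
  assumes T: "finite_rooted_tree V E r" and "x \<in> V" "y \<in> V"
  shows "\<exists>u. is_lca E x y u"
proof -
  have "finite E"
    using T unfolding finite_rooted_tree_def by (meson finite_SigmaI finite_subset)
  then have "wf (E\<inverse>)"
    by (rule finite_acyclic_wf_converse) (rule finite_rooted_tree_acyclic[OF T])
  then have wf: "wf ((E\<inverse>)\<^sup>+)"
    by (rule wf_trancl)
  let ?Q = "{u. (u, x) \<in> E\<^sup>* \<and> (u, y) \<in> E\<^sup>*}"
  have "r \<in> ?Q"
    using assms unfolding finite_rooted_tree_def by blast
  then obtain u where u: "u \<in> ?Q" and min: "\<And>w. (w, u) \<in> (E\<inverse>)\<^sup>+ \<Longrightarrow> w \<notin> ?Q"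
    by (rule wfE_min[OF wf]) blast
  have "(w, u) \<in> E\<^sup>*" if "w \<in> ?Q" for w
  proof -
    have "(u, w) \<notin> E\<^sup>+"
      using min[of w] that by (auto simp: trancl_converse)
    moreover have "(w, u) \<in> E\<^sup>* \<or> (u, w) \<in> E\<^sup>*"
      using ancestors_chain[OF T] u that by blast
    ultimately show ?thesis
      by (metis rtranclD rtrancl.rtrancl_refl)
  qed
  with u show ?thesis
    unfolding is_lca_def by blast
qed

section \<open>Binary HSTs as iterated joins\<close>

text \<open>The last argument is the label of the root, which a further join has to compare with its
  own label. Every inner vertex has exactly two children, both carrying points.\<close>

inductive hst :: "real \<Rightarrow> nat set \<Rightarrow> (nat \<Rightarrow> nat \<Rightarrow> real) \<Rightarrow> real \<Rightarrow> bool" for k where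
  leaf: "hst k {x} (\<lambda>_ _. 0) 0"
| node: "hst k A a s \<Longrightarrow> hst k B b t \<Longrightarrow> A \<inter> B = {} \<Longrightarrow> D > 0 \<Longrightarrow> s \<le> D / k \<Longrightarrow> t \<le> D / k \<Longrightarrow>
    hst k (A \<union> B)
      (\<lambda>x y. if x \<in> A \<and> y \<in> A then a x y else if x \<in> B \<and> y \<in> B then b x y else D) D"

lemma hst_nonempty: "hst k X e D \<Longrightarrow> X \<noteq> {}"
  by (induction rule: hst.induct) auto

lemma hst_diameter_attained: "hst k X e D \<Longrightarrow> \<exists>x\<in>X. \<exists>y\<in>X. e x y = D"
proof (induction rule: hst.induct)
  case (node A a s B b t D)
  obtain x y where "x \<in> A" "y \<in> B"
    using hst_nonempty node.hyps(1,2) by blast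
  then show ?case
    using node.hyps(3) by (intro bexI[of _ x] bexI[of _ y]) auto
qed auto

text \<open>A triangle that meets both parts of a join has two sides equal to D and a third at most
  D / k \<le> D.\<close>

lemma hst_bounds:
  assumes "hst k X e D" "1 \<le> k"
  shows "finite X \<and> (\<forall>x\<in>X. \<forall>y\<in>X. e x y \<le> D) \<and> Metric_space X e"
  using assms
proof (induction rule: hst.induct)
  case (leaf x)
  then show ?case
    by (auto simp: Metric_space_def)
next
  case (node A a s B b t D)
  then interpret A: Metric_space A a by blast
  interpret B: Metric_space B b using node by blast
  have "D / k \<le> D"
    using node by (simp add: divide_le_eq)
  then have a: "a x y \<le> D" if "x \<in> A" "y \<in> A" for x y
    using node that by force
  have b: "b x y \<le> D" if "x \<in> B" "y \<in> B" for x y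
    using node \<open>D / k \<le> D\<close> that by force
  have disj: "x \<in> A \<Longrightarrow> x \<notin> B" for x
    using node by blast
  have "Metric_space (A \<union> B)
     (\<lambda>x y. if x \<in> A \<and> y \<in> A then a x y else if x \<in> B \<and> y \<in> B then b x y else D)"
  proof (unfold_locales, goal_cases)
    case (1 x y)
    then show ?case using \<open>D > 0\<close> by auto
  next
    case (2 x y)
    then show ?case using A.commute B.commute by auto
  next
    case (3 x y)
    then show ?case using \<open>D > 0\<close> disj by auto
  next
    case (4 x y z)
    then show ?case
      using \<open>D > 0\<close> disj a[of x z] b[of x z] A.triangle[of x y z] B.triangle[of x y z]
      by (auto split: if_splits)
  qed
  then show ?case
    using node a b by auto
qed

text \<open>The hypothesis \<open>into\<close> speaks only of edges that end in V'. Hence it can be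
  applied to either subtree below a common root r, whatever the other subtree looks like.\<close>

lemma rtrancl_into_subtree:
  assumes T: "finite_rooted_tree V' E' r'" and v: "v \<in> V'"
    and into: "\<forall>u. \<forall>w\<in>V'. (u, w) \<in> E \<longleftrightarrow> (u, w) \<in> E' \<or> (u = r \<and> w = r')"
    and root: "\<forall>u. (u, r) \<notin> E"
  shows "(u, v) \<in> E\<^sup>* \<longleftrightarrow> u = r \<or> (u, v) \<in> E'\<^sup>*"
proof
  assume "(u, v) \<in> E\<^sup>*"
  then have "u = r \<or> (u \<in> V' \<and> (u, v) \<in> E'\<^sup>*)"
  proof (induction rule: converse_rtrancl_induct)
    case base
    then show ?case using v by simp
  next
    case (step u w)
    then show ?case
      using root into T unfolding finite_rooted_tree_def
      by (auto intro: converse_rtrancl_into_rtrancl)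
  qed
  then show "u = r \<or> (u, v) \<in> E'\<^sup>*" by blast
next
  have "E' \<subseteq> E"
    using T into unfolding finite_rooted_tree_def by auto
  then have sub: "E'\<^sup>* \<subseteq> E\<^sup>*"
    by (rule rtrancl_mono)
  have "(r, r') \<in> E" "(r', v) \<in> E'\<^sup>*"
    using T into v unfolding finite_rooted_tree_def by auto
  with sub have "(r, v) \<in> E\<^sup>*"
    by (meson converse_rtrancl_into_rtrancl subsetD)
  with sub show "u = r \<or> (u, v) \<in> E'\<^sup>* \<Longrightarrow> (u, v) \<in> E\<^sup>*" by blast
qed

lemma is_lca_in_subtree:
  assumes T: "finite_rooted_tree V' E' r'" and xy: "x \<in> V'" "y \<in> V'"
    and into: "\<forall>u. \<forall>w\<in>V'. (u, w) \<in> E \<longleftrightarrow> (u, w) \<in> E' \<or> (u = r \<and> w = r')"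
    and root: "\<forall>u. (u, r) \<notin> E" and lca: "is_lca E' x y u"
  shows "is_lca E x y u \<and> u \<in> V'"
proof -
  have u: "u \<in> V'"
    using lca xy rtrancl_rooted_tree_vertex[OF T] unfolding is_lca_def by blast
  note R = rtrancl_into_subtree[OF T _ into root]
  show ?thesis
    using lca R[OF xy(1)] R[OF xy(2)] R[OF u] u unfolding is_lca_def by auto
qed

text \<open>The forbidden set F makes it possible to choose the inner vertices of the two subtrees of a
  join disjoint.\<close>

lemma hst_tree:
  assumes "hst k X e D" "1 \<le> k" "finite F"
  shows "\<exists>V E r \<Delta>. finite_rooted_tree V E r \<and> V \<inter> F \<subseteq> X \<and> leaves V E = X \<and>
    (\<forall>u\<in>V. 0 \<le> \<Delta> u \<and> (\<Delta> u = 0 \<longleftrightarrow> u \<in> X)) \<and> (\<forall>(v, u)\<in>E. \<Delta> u \<le> \<Delta> v / k) \<and>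
    (\<forall>v\<in>V. card (E `` {v}) \<le> 2) \<and> \<Delta> r = D \<and>
    (\<forall>x\<in>X. \<forall>y\<in>X. \<exists>u. is_lca E x y u \<and> \<Delta> u = e x y)"
  using assms
proof (induction arbitrary: F rule: hst.induct)
  case (leaf x)
  show ?case
    by (rule exI[of _ "{x}"], rule exI[of _ "{}"], rule exI[of _ x], rule exI[of _ "\<lambda>_. 0"])
      (auto simp: finite_rooted_tree_def leaves_def is_lca_def)
next
  case (node A a s B b t D)
  have fin: "finite A" "finite B"
    using hst_bounds node.hyps(1,2) node.prems(1) by blast+
  obtain V1 E1 r1 \<Delta>1 where 1: "finite_rooted_tree V1 E1 r1" "V1 \<inter> (F \<union> B) \<subseteq> A" "leaves V1 E1 = A"
    "\<forall>u\<in>V1. 0 \<le> \<Delta>1 u \<and> (\<Delta>1 u = 0 \<longleftrightarrow> u \<in> A)" "\<forall>(v, u)\<in>E1. \<Delta>1 u \<le> \<Delta>1 v / k"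
    "\<forall>v\<in>V1. card (E1 `` {v}) \<le> 2" "\<Delta>1 r1 = s"
    "\<forall>x\<in>A. \<forall>y\<in>A. \<exists>u. is_lca E1 x y u \<and> \<Delta>1 u = a x y"
    using node.IH(1)[OF node.prems(1) finite_UnI[OF node.prems(2) fin(2)]]
    by (elim exE conjE) (rule that; assumption)
  have fV1: "finite V1"
    using 1(1) unfolding finite_rooted_tree_def by blast
  obtain V2 E2 r2 \<Delta>2 where 2: "finite_rooted_tree V2 E2 r2" "V2 \<inter> (F \<union> V1) \<subseteq> B" "leaves V2 E2 = B"
    "\<forall>u\<in>V2. 0 \<le> \<Delta>2 u \<and> (\<Delta>2 u = 0 \<longleftrightarrow> u \<in> B)" "\<forall>(v, u)\<in>E2. \<Delta>2 u \<le> \<Delta>2 v / k"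
    "\<forall>v\<in>V2. card (E2 `` {v}) \<le> 2" "\<Delta>2 r2 = t"
    "\<forall>x\<in>B. \<forall>y\<in>B. \<exists>u. is_lca E2 x y u \<and> \<Delta>2 u = b x y"
    using node.IH(2)[OF node.prems(1) finite_UnI[OF node.prems(2) fV1]]
    by (elim exE conjE) (rule that; assumption)
  have fV2: "finite V2"
    using 2(1) unfolding finite_rooted_tree_def by blast
  \<comment> \<open>The second tree was chosen with all of V1 forbidden, so a common vertex lies in
    B; the first was chosen with B forbidden, so that vertex would also lie in A.\<close>
  have disj: "V1 \<inter> V2 = {}"
    using 1(2) 2(2) node.hyps(3) by blast
  have AV: "A \<subseteq> V1" "B \<subseteq> V2"
    using 1(3) 2(3) unfolding leaves_def by auto
  obtain r where r: "r \<notin> V1 \<union> V2 \<union> F"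
    using ex_new_if_finite[of "V1 \<union> V2 \<union> F"] fV1 fV2 node.prems infinite_UNIV_nat by blast
  define V where "V = insert r (V1 \<union> V2)"
  define E where "E = E1 \<union> E2 \<union> {(r, r1), (r, r2)}"
  define \<Delta> where "\<Delta> u = (if u = r then D else if u \<in> V1 then \<Delta>1 u else \<Delta>2 u)" for u
  have sub: "E1 \<subseteq> V1 \<times> V1" "E2 \<subseteq> V2 \<times> V2" "r1 \<in> V1" "r2 \<in> V2" "\<And>u. (u, r1) \<notin> E1" "\<And>u. (u, r2) \<notin> E2"
    using 1(1) 2(1) unfolding finite_rooted_tree_def by auto
  have into1: "\<forall>u. \<forall>w\<in>V1. (u, w) \<in> E \<longleftrightarrow> (u, w) \<in> E1 \<or> (u = r \<and> w = r1)"
    using disj sub unfolding E_def by auto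
  have into2: "\<forall>u. \<forall>w\<in>V2. (u, w) \<in> E \<longleftrightarrow> (u, w) \<in> E2 \<or> (u = r \<and> w = r2)"
    using disj sub unfolding E_def by auto
  have root: "\<forall>u. (u, r) \<notin> E"
    using r sub unfolding E_def by auto
  note R1 = rtrancl_into_subtree[OF 1(1) _ into1 root]
  note R2 = rtrancl_into_subtree[OF 2(1) _ into2 root]
  have T: "finite_rooted_tree V E r"
    unfolding finite_rooted_tree_def
  proof (intro conjI ballI allI)
    show "finite V" "r \<in> V" "E \<subseteq> V \<times> V"
      using fV1 fV2 sub unfolding V_def E_def by auto
    show "(u, r) \<notin> E" for u using root by blast
    show "(r, v) \<in> E\<^sup>*" if "v \<in> V" for v
      using that R1 R2 unfolding V_def by blast
  next
    fix v assume "v \<in> V - {r}"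
    then consider "v \<in> V1" | "v \<in> V2" unfolding V_def by blast
    then show "\<exists>!u. (u, v) \<in> E"
    proof cases
      case 1
      then show ?thesis
        using into1 1 \<open>finite_rooted_tree V1 E1 r1\<close> sub unfolding finite_rooted_tree_def
        by (cases "v = r1") auto
    next
      case 2
      then show ?thesis
        using into2 2 \<open>finite_rooted_tree V2 E2 r2\<close> sub unfolding finite_rooted_tree_def
        by (cases "v = r2") auto
    qed
  qed
  have im: "E `` {r} = {r1, r2}" "v \<in> V1 \<Longrightarrow> E `` {v} = E1 `` {v}" "v \<in> V2 \<Longrightarrow> E `` {v} = E2 `` {v}" for v
    using disj sub r unfolding E_def by auto
  have "leaves V E = {v \<in> V. E `` {v} = {}}"
    unfolding leaves_def by auto
  also have "\<dots> = {v \<in> V1. E1 `` {v} = {}} \<union> {v \<in> V2. E2 `` {v} = {}}"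
    using im unfolding V_def by blast
  also have "\<dots> = A \<union> B"
    using 1(3) 2(3) unfolding leaves_def by auto
  finally have leaves: "leaves V E = A \<union> B" .
  have \<Delta>s: "u \<in> V1 \<Longrightarrow> \<Delta> u = \<Delta>1 u" "u \<in> V2 \<Longrightarrow> \<Delta> u = \<Delta>2 u" for u
    using r disj unfolding \<Delta>_def by auto
  show ?case
  proof (intro exI conjI)
    show "finite_rooted_tree V E r" by fact
    show "V \<inter> F \<subseteq> A \<union> B"
      using 1(2) 2(2) r unfolding V_def by blast
    show "leaves V E = A \<union> B" by fact
    show "\<forall>u\<in>V. 0 \<le> \<Delta> u \<and> (\<Delta> u = 0 \<longleftrightarrow> u \<in> A \<union> B)"
      using 1(4) 2(4) \<Delta>s \<open>D > 0\<close> r disj AV unfolding V_def by (auto simp: \<Delta>_def)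
    show "\<forall>(v, u)\<in>E. \<Delta> u \<le> \<Delta> v / k"
    proof (clarify)
      fix v u assume "(v, u) \<in> E"
      then consider "(v, u) \<in> E1" | "(v, u) \<in> E2" | "v = r" "u = r1" | "v = r" "u = r2"
        unfolding E_def by auto
      then show "\<Delta> u \<le> \<Delta> v / k"
      proof cases
        case 1
        then have "v \<in> V1" "u \<in> V1" "\<Delta>1 u \<le> \<Delta>1 v / k"
          using sub \<open>\<forall>(v, u)\<in>E1. \<Delta>1 u \<le> \<Delta>1 v / k\<close> by auto
        then show ?thesis using \<Delta>s by simp
      next
        case 2
        then have "v \<in> V2" "u \<in> V2" "\<Delta>2 u \<le> \<Delta>2 v / k"
          using sub \<open>\<forall>(v, u)\<in>E2. \<Delta>2 u \<le> \<Delta>2 v / k\<close> by auto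
        then show ?thesis using \<Delta>s by simp
      next
        case 3
        then show ?thesis using sub \<Delta>s 1(7) node.hyps by (simp add: \<Delta>_def)
      next
        case 4
        then have "\<Delta> u = t" "\<Delta> v = D" using sub \<Delta>s 2(7) by (auto simp: \<Delta>_def)
        then show ?thesis using node.hyps by simp
      qed
    qed
    show "\<forall>v\<in>V. card (E `` {v}) \<le> 2"
      using 1(6) 2(6) im unfolding V_def by (auto simp: card_insert_if)
    show "\<Delta> r = D" by (simp add: \<Delta>_def)
    \<comment> \<open>Leaves of different subtrees have only the new root as a common ancestor,
      which is where the label D of the join is read off.\<close>
    have cross: "is_lca E x y r \<and> is_lca E y x r" if "x \<in> V1" "y \<in> V2" for x y
    proof -
      have "(w, x) \<notin> E1\<^sup>* \<or> (w, y) \<notin> E2\<^sup>*" for w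
        using that disj rtrancl_rooted_tree_vertex[OF 1(1)] rtrancl_rooted_tree_vertex[OF 2(1)] by blast
      then have "w = r" if "(w, x) \<in> E\<^sup>*" "(w, y) \<in> E\<^sup>*" for w
        using R1[OF \<open>x \<in> V1\<close>] R2[OF \<open>y \<in> V2\<close>] that by blast
      moreover have "(r, x) \<in> E\<^sup>*" "(r, y) \<in> E\<^sup>*"
        using R1[OF that(1)] R2[OF that(2)] by auto
      ultimately show ?thesis
        unfolding is_lca_def by blast
    qed
    show "\<forall>x\<in>A \<union> B. \<forall>y\<in>A \<union> B. \<exists>u. is_lca E x y u \<and>
      \<Delta> u = (if x \<in> A \<and> y \<in> A then a x y else if x \<in> B \<and> y \<in> B then b x y else D)"
    proof (intro ballI)
      fix x y assume "x \<in> A \<union> B" "y \<in> A \<union> B"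
      then consider "x \<in> A" "y \<in> A" | "x \<in> B" "y \<in> B" | "x \<in> A" "y \<in> B" | "x \<in> B" "y \<in> A" by blast
      then show "\<exists>u. is_lca E x y u \<and>
        \<Delta> u = (if x \<in> A \<and> y \<in> A then a x y else if x \<in> B \<and> y \<in> B then b x y else D)"
      proof cases
        case 1
        then obtain u where "is_lca E1 x y u" "\<Delta>1 u = a x y"
          using \<open>\<forall>x\<in>A. \<forall>y\<in>A. \<exists>u. is_lca E1 x y u \<and> \<Delta>1 u = a x y\<close> by blast
        moreover have "x \<in> V1" "y \<in> V1"
          using 1 AV by auto
        ultimately have "is_lca E x y u" "\<Delta> u = a x y"
          using is_lca_in_subtree[OF \<open>finite_rooted_tree V1 E1 r1\<close> _ _ into1 root, of x y u] \<Delta>s by auto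
        then show ?thesis
          using 1 by auto
      next
        case 2
        then obtain u where "is_lca E2 x y u" "\<Delta>2 u = b x y"
          using \<open>\<forall>x\<in>B. \<forall>y\<in>B. \<exists>u. is_lca E2 x y u \<and> \<Delta>2 u = b x y\<close> by blast
        moreover have "x \<in> V2" "y \<in> V2"
          using 2 AV by auto
        ultimately have "is_lca E x y u" "\<Delta> u = b x y"
          using is_lca_in_subtree[OF \<open>finite_rooted_tree V2 E2 r2\<close> _ _ into2 root, of x y u] \<Delta>s by auto
        then show ?thesis
          using 2 node.hyps(3) by auto
      next
        case 3
        then have "\<not> (x \<in> A \<and> y \<in> A)" "\<not> (x \<in> B \<and> y \<in> B)" using node.hyps(3) by auto
        then show ?thesis using cross[of x y] 3 AV by (auto simp: \<Delta>_def)
      next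
        case 4
        then have "\<not> (x \<in> A \<and> y \<in> A)" "\<not> (x \<in> B \<and> y \<in> B)" using node.hyps(3) by auto
        then show ?thesis using cross[of y x] 4 AV by (auto simp: \<Delta>_def)
      qed
    qed
  qed
qed

lemma hst_binary_HST:
  assumes "hst k X e D" "1 \<le> k"
  shows "binary_HST k X e"
proof -
  obtain V E r \<Delta> where T: "finite_rooted_tree V E r" and L: "leaves V E = X"
    "\<forall>u\<in>V. 0 \<le> \<Delta> u \<and> (\<Delta> u = 0 \<longleftrightarrow> u \<in> X)" "\<forall>(v, u)\<in>E. \<Delta> u \<le> \<Delta> v / k"
    "\<forall>v\<in>V. card (E `` {v}) \<le> 2" and lca: "\<forall>x\<in>X. \<forall>y\<in>X. \<exists>u. is_lca E x y u \<and> \<Delta> u = e x y"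
    using hst_tree[OF assms finite.emptyI] by (elim exE conjE) (rule that; assumption)
  have "e x y = \<Delta> (lca E x y)" if "x \<in> X" "y \<in> X" for x y
    using lca that lca_eqI[OF finite_rooted_tree_acyclic[OF T]] by metis
  then have "HST_tree k V E r \<Delta> X e"
    unfolding HST_tree_def using T L hst_bounds[OF assms] by simp
  then show ?thesis
    unfolding binary_HST_def using L(4) by blast
qed

section \<open>Distortion\<close>

text \<open>One term is taken from each of the two suprema, possibly for different pairs, and
  denominators are cleared. Later arguments use only this form and stay in the reals.\<close>

lemma distortion_cross:
  assumes "Metric_space M d" "Metric_space X e" "f ` M \<subseteq> X" "inj_on f M"
    and dist: "distortion M d e f \<le> ennreal \<alpha>" and "0 \<le> \<alpha>"
    and xy: "x \<in> M" "y \<in> M" "x \<noteq> y" and zw: "z \<in> M" "w \<in> M" "z \<noteq> w"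
  shows "e (f x) (f y) * d z w \<le> \<alpha> * d x y * e (f z) (f w)"
proof -
  interpret M: Metric_space M d by fact
  interpret X: Metric_space X e by fact
  have d: "d x y > 0" "d z w > 0"
    using xy zw by (simp_all add: M.mdist_pos_eq)
  have e: "e (f x) (f y) > 0" "e (f z) (f w) > 0"
    using xy zw assms(3,4) by (auto simp: X.mdist_pos_eq image_subset_iff inj_on_def)
  have "ennreal (e (f x) (f y) / d x y) * ennreal (d z w / e (f z) (f w)) \<le> distortion M d e f"
    unfolding distortion_def
  proof (intro mult_mono zero_le)
    show "ennreal (e (f x) (f y) / d x y) \<le>
      (SUP (x, y) \<in> {(x, y). x \<in> M \<and> y \<in> M \<and> x \<noteq> y}. ennreal (e (f x) (f y) / d x y))"
      using xy by (intro SUP_upper2[of "(x, y)"]) auto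
    show "ennreal (d z w / e (f z) (f w)) \<le>
      (SUP (x, y) \<in> {(x, y). x \<in> M \<and> y \<in> M \<and> x \<noteq> y}. ennreal (d x y / e (f x) (f y)))"
      using zw by (intro SUP_upper2[of "(z, w)"]) auto
  qed
  also note dist
  finally have "ennreal (e (f x) (f y) / d x y * (d z w / e (f z) (f w))) \<le> ennreal \<alpha>"
    using d e by (subst ennreal_mult) auto
  then have "e (f x) (f y) / d x y * (d z w / e (f z) (f w)) \<le> \<alpha>"
    using \<open>0 \<le> \<alpha>\<close> by (simp add: ennreal_le_iff)
  then show ?thesis
    using d e by (simp add: field_simps)
qed

lemma distortion_le:
  assumes "\<And>x y. x \<in> M \<Longrightarrow> y \<in> M \<Longrightarrow> x \<noteq> y \<Longrightarrow> e (f x) (f y) / d x y \<le> s"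
    and "\<And>x y. x \<in> M \<Longrightarrow> y \<in> M \<Longrightarrow> x \<noteq> y \<Longrightarrow> d x y / e (f x) (f y) \<le> t"
    and "0 \<le> s" "0 \<le> t"
  shows "distortion M d e f \<le> ennreal (s * t)"
proof -
  have "distortion M d e f \<le> ennreal s * ennreal t"
    unfolding distortion_def
  proof (intro mult_mono zero_le SUP_least)
    fix p assume "p \<in> {(x, y). x \<in> M \<and> y \<in> M \<and> x \<noteq> y}"
    then obtain x y where p: "p = (x, y)" "x \<in> M" "y \<in> M" "x \<noteq> y" by blast
    show "(case p of (x, y) \<Rightarrow> ennreal (e (f x) (f y) / d x y)) \<le> ennreal s"
      using assms(1)[OF p(2-4)] p(1) by (simp add: ennreal_leI)
    show "(case p of (x, y) \<Rightarrow> ennreal (d x y / e (f x) (f y))) \<le> ennreal t"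
      using assms(2)[OF p(2-4)] p(1) by (simp add: ennreal_leI)
  qed
  then show ?thesis
    using assms(3,4) by (simp add: ennreal_mult)
qed

lemma distortion_mono: "N \<subseteq> M \<Longrightarrow> distortion N d e f \<le> distortion M d e f"
  unfolding distortion_def by (intro mult_mono zero_le SUP_subset_mono) auto

lemma distortion_empty [simp]: "distortion {} d e f = 0"
  by (simp add: distortion_def bot_ennreal)

lemma embeds_subset: "embeds \<alpha> M d X e \<Longrightarrow> N \<subseteq> M \<Longrightarrow> embeds \<alpha> N d X e"
  unfolding embeds_def by (meson distortion_mono image_mono inj_on_subset order_trans)

text \<open>The identity map works: the first supremum is at most \<alpha> and the second at most 1.
  Approximating metrics are normalised from above for this reason.\<close>

lemma embeds_if_dominated:
  assumes "Metric_space M d" "M \<subseteq> X" "0 \<le> \<alpha>"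
    and le: "\<And>x y. x \<in> M \<Longrightarrow> y \<in> M \<Longrightarrow> x \<noteq> y \<Longrightarrow> d x y \<le> e x y \<and> e x y \<le> \<alpha> * d x y"
  shows "embeds \<alpha> M d X e"
  unfolding embeds_def
proof (intro exI conjI)
  interpret Metric_space M d by fact
  have "distortion M d e id \<le> ennreal (\<alpha> * 1)"
  proof (rule distortion_le[OF _ _ assms(3) zero_le_one])
    fix x y assume xy: "x \<in> M" "y \<in> M" "x \<noteq> y"
    then have "d x y > 0" by (simp add: mdist_pos_eq)
    with le[OF xy] show "e (id x) (id y) / d x y \<le> \<alpha>" "d x y / e (id x) (id y) \<le> 1"
      by (simp_all add: divide_le_eq)
  qed
  then show "distortion M d e id \<le> ennreal \<alpha>" by simp
qed (use assms(2) in simp_all)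

lemma discrete_Metric_space: "0 < c \<Longrightarrow> Metric_space M (\<lambda>x y. if x = y then 0 else c)"
  by (auto simp: Metric_space_def)

lemma c_eq_le:
  assumes "Metric_space S d" "0 < a" "0 \<le> b"
    and ab: "\<And>x y. x \<in> S \<Longrightarrow> y \<in> S \<Longrightarrow> x \<noteq> y \<Longrightarrow> a \<le> d x y \<and> d x y \<le> b"
  shows "c_eq S d \<le> ennreal (b / a)"
proof -
  let ?e = "\<lambda>x y. if x = y then 0 else (1 :: real)"
  have "distortion S d ?e id \<le> ennreal (1 / a * b)"
  proof (rule distortion_le)
    fix x y assume "x \<in> S" "y \<in> S" "x \<noteq> y"
    then show "?e (id x) (id y) / d x y \<le> 1 / a" "d x y / ?e (id x) (id y) \<le> b"
      using ab[of x y] \<open>0 < a\<close> by (auto intro: divide_left_mono)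
  qed (use assms in auto)
  moreover have "equilateral S ?e"
    unfolding equilateral_def using discrete_Metric_space[of 1 S] by auto
  ultimately show ?thesis
    unfolding c_eq_def by (intro Inf_lower2[of "distortion S d ?e id"]) force+
qed

text \<open>In an equilateral target both pairs get the same distance c > 0, which cancels in
  \<open>distortion_cross\<close> and leaves the ratio of the two original distances.\<close>

lemma c_eq_ge:
  assumes S: "Metric_space S d" and "0 \<le> k"
    and xy: "x \<in> S" "y \<in> S" "x \<noteq> y" and zw: "z \<in> S" "w \<in> S" "z \<noteq> w"
    and le: "k * d x y \<le> d z w"
  shows "ennreal k \<le> c_eq S d"
  unfolding c_eq_def
proof (rule Inf_greatest, clarify)
  fix X :: "'a set" and e f
  assume eq: "equilateral X e" and f: "f ` S \<subseteq> X" "inj_on f S"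
  interpret Metric_space S d by fact
  interpret X: Metric_space X e using eq by (simp add: equilateral_def)
  obtain c where c: "\<forall>x\<in>X. \<forall>y\<in>X. x \<noteq> y \<longrightarrow> e x y = c"
    using eq by (auto simp: equilateral_def)
  have d: "0 < d x y" "0 < d z w" using xy zw by (simp_all add: mdist_pos_eq)
  have fx: "f x \<in> X" "f y \<in> X" "f x \<noteq> f y" "f z \<in> X" "f w \<in> X" "f z \<noteq> f w"
    using f xy zw by (auto simp: inj_on_def image_subset_iff)
  then have ec: "e (f x) (f y) = c" "e (f z) (f w) = c" "c > 0"
    using c X.mdist_pos_eq by metis+
  show "ennreal k \<le> distortion S d e f"
  proof (cases "distortion S d e f = top")
    case False
    then obtain a where a: "distortion S d e f = ennreal a" "0 \<le> a"
      by (cases "distortion S d e f") auto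
    have "e (f x) (f y) * d z w \<le> a * d x y * e (f z) (f w)"
      by (rule distortion_cross[OF S X.Metric_space_axioms f _ _ xy zw]) (use a in auto)
    then have "d z w \<le> a * d x y"
      using ec by (simp add: mult.commute)
    with le have "k * d x y \<le> a * d x y" by simp
    then have "k \<le> a" using d by simp
    then show ?thesis using a by (simp add: ennreal_leI)
  qed simp
qed

section \<open>Triples in binary HSTs\<close>

lemma HST_label_descend:
  assumes "HST_tree k V E r \<Delta> X e" "1 \<le> k" "(u, v) \<in> E\<^sup>+"
  shows "\<Delta> v \<le> \<Delta> u / k"
  using assms(3)
proof (induction rule: trancl_induct)
  case (base v)
  then show ?case using assms(1) unfolding HST_tree_def by auto
next
  case (step v w)
  have "v \<in> V"
    using step assms(1) unfolding HST_tree_def finite_rooted_tree_def by auto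
  then have "0 \<le> \<Delta> v"
    using assms(1) unfolding HST_tree_def by blast
  then have "\<Delta> v / k \<le> \<Delta> v"
    using assms(2) by (simp add: divide_le_eq mult_le_cancel_left1)
  moreover have "\<Delta> w \<le> \<Delta> v / k"
    using step assms(1) unfolding HST_tree_def by auto
  ultimately show ?case using step by linarith
qed

text \<open>If two of the three pairwise lcas differ, they lie on one root path, so their labels
  differ by a factor of at least k. If all three coincide, that vertex has a separate child above
  each of the three leaves, against binarity.\<close>

lemma binary_HST_triple:
  assumes "binary_HST k X e" "1 \<le> k" and xyz: "x \<in> X" "y \<in> X" "z \<in> X" "x \<noteq> y" "y \<noteq> z" "x \<noteq> z"
  shows "\<exists>a\<in>{x,y,z}. \<exists>b\<in>{x,y,z}. \<exists>c\<in>{x,y,z}. \<exists>d\<in>{x,y,z}. a \<noteq> b \<and> c \<noteq> d \<and> k * e a b \<le> e c d"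
proof -
  obtain V E r \<Delta> where H: "HST_tree k V E r \<Delta> X e" and bin: "\<forall>v\<in>V. card (E `` {v}) \<le> 2"
    using assms(1) unfolding binary_HST_def by blast
  then have T: "finite_rooted_tree V E r" and X: "X = leaves V E"
    and e: "\<And>x y. x \<in> X \<Longrightarrow> y \<in> X \<Longrightarrow> e x y = \<Delta> (lca E x y)"
    unfolding HST_tree_def by blast+
  have acy: "acyclic E" by (rule finite_rooted_tree_acyclic[OF T])
  have XV: "X \<subseteq> V" unfolding X leaves_def by blast
  have lca: "is_lca E a b (lca E a b)" if "a \<in> X" "b \<in> X" for a b
    using ex_is_lca[OF T, of a b] XV that lca_eqI[OF acy] by (metis subsetD)
  have sep: "k * e a c \<le> e a b \<or> k * e a b \<le> e a c"
    if "a \<in> X" "b \<in> X" "c \<in> X" "lca E a b \<noteq> lca E a c" for a b c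
  proof -
    have "(lca E a b, lca E a c) \<in> E\<^sup>* \<or> (lca E a c, lca E a b) \<in> E\<^sup>*"
      using lca[of a b] lca[of a c] that ancestors_chain[OF T, of _ a] unfolding is_lca_def by blast
    then have "(lca E a b, lca E a c) \<in> E\<^sup>+ \<or> (lca E a c, lca E a b) \<in> E\<^sup>+"
      using that(4) by (metis rtranclD)
    then show ?thesis
      using HST_label_descend[OF H assms(2)] e that assms(2) by (auto simp: field_simps)
  qed
  have sym: "lca E a b = lca E b a" for a b
    unfolding lca_def by (intro arg_cong[where f=The] ext) blast
  have pick: ?thesis if "a \<in> {x,y,z}" "b \<in> {x,y,z}" "c \<in> {x,y,z}" "d \<in> {x,y,z}"
      "a \<noteq> b" "c \<noteq> d" "k * e a b \<le> e c d" for a b c d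
    using that by blast
  show ?thesis
  proof (cases "lca E x y = lca E x z \<and> lca E x y = lca E y z")
    case False
    then consider "lca E x y \<noteq> lca E x z" | "lca E y x \<noteq> lca E y z"
      using sym by metis
    then show ?thesis
    proof cases
      case 1
      then have "k * e x z \<le> e x y \<or> k * e x y \<le> e x z" by (rule sep[OF xyz(1-3)])
      then show ?thesis using pick[of x z x y] pick[of x y x z] xyz by auto
    next
      case 2
      then have "k * e y z \<le> e y x \<or> k * e y x \<le> e y z" by (rule sep[OF xyz(2,1,3)])
      then show ?thesis using pick[of y z y x] pick[of y x y z] xyz by auto
    qed
  next
    case True
    define u where "u = lca E x y"
    have u: "is_lca E x y u" "is_lca E x z u" "is_lca E y z u"
      using lca xyz True unfolding u_def by metis+
    have child: "\<exists>c. (u, c) \<in> E \<and> (c, a) \<in> E\<^sup>*" if "a \<in> X" "b \<in> X" "a \<noteq> b" "(u, a) \<in> E\<^sup>*" "(u, b) \<in> E\<^sup>*" for a b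
    proof -
      have "u \<noteq> a"
        using that X unfolding leaves_def by (auto elim: converse_rtranclE)
      then show ?thesis using that(4) by (auto elim: converse_rtranclE)
    qed
    obtain cx where cx: "(u, cx) \<in> E" "(cx, x) \<in> E\<^sup>*"
      using child[of x y] xyz u unfolding is_lca_def by blast
    obtain cy where cy: "(u, cy) \<in> E" "(cy, y) \<in> E\<^sup>*"
      using child[of y x] xyz u unfolding is_lca_def by blast
    obtain cz where cz: "(u, cz) \<in> E" "(cz, z) \<in> E\<^sup>*"
      using child[of z x] xyz u unfolding is_lca_def by blast
    have no: "\<not> ((u, c) \<in> E \<and> (c, u) \<in> E\<^sup>*)" for c
      using acy unfolding acyclic_def by (meson rtrancl_into_trancl2)
    have "cx \<noteq> cy" "cx \<noteq> cz" "cy \<noteq> cz"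
      using u cx cy cz no unfolding is_lca_def by blast+
    then have "card {cx, cy, cz} = 3" by simp
    moreover have "finite (E `` {u})"
      using T unfolding finite_rooted_tree_def
      by (meson Image_singleton finite_Image finite_SigmaI finite_subset)
    then have "card {cx, cy, cz} \<le> card (E `` {u})"
      using cx cy cz by (intro card_mono) auto
    moreover have "u \<in> V"
      using cx T unfolding finite_rooted_tree_def by blast
    ultimately show ?thesis using bin by fastforce
  qed
qed

text \<open>This makes binary k-HSTs, and all their subspaces, admissible as the space Z in the
  definition of \<open>F_num\<close>.\<close>

lemma binary_HST_c_eq:
  assumes "binary_HST k X e" "1 \<le> k" "S \<subseteq> X" "3 \<le> card S"
  shows "ennreal k \<le> c_eq S e"
proof -
  obtain S' where "S' \<subseteq> S" "card S' = 3"
    using obtain_subset_with_card_n[OF assms(4)] by metis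
  then obtain x y z where xyz: "{x, y, z} \<subseteq> S" "x \<noteq> y" "y \<noteq> z" "x \<noteq> z"
    by (auto simp: card_3_iff)
  then obtain a b c d where "a \<in> S" "b \<in> S" "c \<in> S" "d \<in> S" "a \<noteq> b" "c \<noteq> d" "k * e a b \<le> e c d"
    using binary_HST_triple[OF assms(1,2), of x y z] assms(3) by blast
  moreover have "Metric_space S e"
    using assms(1,3) unfolding binary_HST_def HST_tree_def by (meson Metric_space.subspace)
  ultimately show ?thesis
    using c_eq_ge[of S e k a b c d] assms(2) by simp
qed

section \<open>The Ramsey numbers\<close>

definition E_ok :: "real \<Rightarrow> real \<Rightarrow> (nat \<Rightarrow> nat \<Rightarrow> real) \<Rightarrow> nat set \<Rightarrow> bool" where
  "E_ok k \<alpha> d N \<longleftrightarrow>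
     (\<exists>(X :: nat set) e. (binary_HST k X e \<or> equilateral X e) \<and> embeds \<alpha> N d X e)"

definition F_ok :: "real \<Rightarrow> real \<Rightarrow> (nat \<Rightarrow> nat \<Rightarrow> real) \<Rightarrow> nat set \<Rightarrow> bool" where
  "F_ok k \<alpha> d N \<longleftrightarrow>
     (\<exists>(Z :: nat set) e. Metric_space Z e \<and>
        (equilateral Z e \<or> (\<forall>S\<subseteq>Z. finite S \<and> 3 \<le> card S \<longrightarrow> ennreal k \<le> c_eq S e)) \<and>
        equivalent_spaces \<alpha> N d Z e)"

text \<open>The common shape of \<open>E_num\<close> and \<open>F_num\<close>, so that existence of
  the maximum and comparison of two such numbers are settled once for all P.\<close>

definition ramsey_num :: "((nat \<Rightarrow> nat \<Rightarrow> real) \<Rightarrow> nat set \<Rightarrow> bool) \<Rightarrow> nat \<Rightarrow> nat" where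
  "ramsey_num P n = (GREATEST m. \<forall>(M :: nat set) d.
     Metric_space M d \<and> finite M \<and> card M = n \<longrightarrow> (\<exists>N\<subseteq>M. card N = m \<and> P d N))"

lemma E_num_eq: "E_num k \<alpha> n = ramsey_num (E_ok k \<alpha>) n"
  unfolding E_num_def ramsey_num_def E_ok_def ..

lemma F_num_eq: "F_num k \<alpha> n = ramsey_num (F_ok k \<alpha>) n"
  unfolding F_num_def ramsey_num_def F_ok_def ..

text \<open>Some space with n points has to be exhibited, since otherwise the universal statement
  would not limit m. The bound is what makes \<open>GREATEST\<close> meaningful.\<close>

lemma ramsey_bound:
  assumes "\<forall>(M :: nat set) d. Metric_space M d \<and> finite M \<and> card M = n \<longrightarrow> (\<exists>N\<subseteq>M. card N = m \<and> P d N)"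
  shows "m \<le> n"
proof -
  have "Metric_space {..<n} (\<lambda>x y. if x = y then 0 else 1)"
    by (rule discrete_Metric_space) simp
  then have "\<exists>N\<subseteq>{..<n}. card N = m \<and> P (\<lambda>x y. if x = y then 0 else 1) N"
    by (intro assms[rule_format]) simp
  then obtain N where "N \<subseteq> {..<n}" "card N = m" by blast
  then show ?thesis
    using card_mono[of "{..<n}" N] by simp
qed

text \<open>\<open>GREATEST\<close> ranges over exact cardinalities, so a subspace that is large
  enough is trimmed to the rounded-up b; this is where P must pass to subsets.\<close>

lemma ramsey_num_ge:
  assumes "\<And>(M :: nat set) d. Metric_space M d \<Longrightarrow> finite M \<Longrightarrow> card M = n \<Longrightarrow>
      \<exists>N\<subseteq>M. b \<le> real (card N) \<and> P d N"
    and sub: "\<And>d N N'. P d N \<Longrightarrow> N' \<subseteq> N \<Longrightarrow> P d N'"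
  shows "b \<le> real (ramsey_num P n)"
proof -
  define m where "m = nat \<lceil>b\<rceil>"
  have "\<forall>(M :: nat set) d. Metric_space M d \<and> finite M \<and> card M = n \<longrightarrow> (\<exists>N\<subseteq>M. card N = m \<and> P d N)"
  proof (intro allI impI)
    fix M :: "nat set" and d assume "Metric_space M d \<and> finite M \<and> card M = n"
    then obtain N where N: "N \<subseteq> M" "b \<le> real (card N)" "P d N"
      using assms(1) by blast
    then have "m \<le> card N"
      unfolding m_def by (simp add: ceiling_le_iff nat_le_iff)
    then obtain N' where "N' \<subseteq> N" "card N' = m"
      using obtain_subset_with_card_n by metis
    then show "\<exists>N\<subseteq>M. card N = m \<and> P d N"
      using N sub by blast
  qed
  then have "m \<le> ramsey_num P n"
    unfolding ramsey_num_def by (rule Greatest_le_nat) (erule ramsey_bound[where P=P])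
  then show ?thesis
    unfolding m_def by linarith
qed

text \<open>The maximum is attained because m = 0 is always admissible, by P of the empty set, and
  all admissible m are at most n.\<close>

lemma ramsey_num_witness:
  assumes "\<And>d. P d {}" "Metric_space M d" "finite M" "card M = n"
  shows "\<exists>N\<subseteq>M. card N = ramsey_num P n \<and> P d N"
proof -
  have "\<forall>(M :: nat set) d. Metric_space M d \<and> finite M \<and> card M = n \<longrightarrow>
      (\<exists>N\<subseteq>M. card N = ramsey_num P n \<and> P d N)"
    unfolding ramsey_num_def
  proof (rule GreatestI_nat[where k=0 and b=n])
    show "\<forall>(M :: nat set) d. Metric_space M d \<and> finite M \<and> card M = n \<longrightarrow> (\<exists>N\<subseteq>M. card N = 0 \<and> P d N)"
      using assms(1) by (metis card.empty empty_subsetI)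
  qed (erule ramsey_bound[where P=P])
  then show ?thesis using assms by blast
qed

lemma ramsey_num_le:
  assumes "\<And>d. P d {}"
  shows "ramsey_num P n \<le> n"
proof -
  have "Metric_space {..<n} (\<lambda>x y. if x = y then 0 else 1)"
    by (rule discrete_Metric_space) simp
  from ramsey_num_witness[where P=P and n=n, OF assms this]
  obtain N where "N \<subseteq> {..<n}" "card N = ramsey_num P n" by auto
  then show ?thesis
    using card_mono[of "{..<n}" N] by simp
qed

lemma ramsey_num_mono:
  assumes "\<And>d. P d {}" and PQ: "\<And>d N. Metric_space N d \<Longrightarrow> finite N \<Longrightarrow> P d N \<Longrightarrow> Q d N"
  shows "ramsey_num P n \<le> ramsey_num Q n"
proof -
  have "\<forall>(M :: nat set) d. Metric_space M d \<and> finite M \<and> card M = n \<longrightarrow>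
      (\<exists>N\<subseteq>M. card N = ramsey_num P n \<and> Q d N)"
  proof (intro allI impI)
    fix M :: "nat set" and d assume M: "Metric_space M d \<and> finite M \<and> card M = n"
    then obtain N where "N \<subseteq> M" "card N = ramsey_num P n" "P d N"
      using ramsey_num_witness[where P=P and M=M and d=d and n=n] assms(1) by blast
    moreover have "Metric_space N d" "finite N"
      using M \<open>N \<subseteq> M\<close> Metric_space.subspace finite_subset by metis+
    ultimately show "\<exists>N\<subseteq>M. card N = ramsey_num P n \<and> Q d N"
      using PQ[of N d] by metis
  qed
  then show ?thesis
    unfolding ramsey_num_def[of Q] by (rule Greatest_le_nat) (erule ramsey_bound[where P=Q])
qed

lemma equilateral_subset:
  assumes "equilateral X e" "Y \<subseteq> X"
  shows "equilateral Y e"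
proof -
  have "Metric_space Y e"
    using assms Metric_space.subspace unfolding equilateral_def by blast
  then show ?thesis
    using assms unfolding equilateral_def by (metis subsetD)
qed

lemma equilateral_empty: "equilateral {} (\<lambda>_ _. 0)"
  unfolding equilateral_def Metric_space_def by simp

lemma E_ok_subset: "E_ok k \<alpha> d N \<Longrightarrow> N' \<subseteq> N \<Longrightarrow> E_ok k \<alpha> d N'"
  unfolding E_ok_def by (metis embeds_subset)

lemma E_ok_empty: "E_ok k \<alpha> d {}"
proof -
  have "embeds \<alpha> {} d {} (\<lambda>_ _ :: nat. 0)"
    unfolding embeds_def by simp
  then show ?thesis
    unfolding E_ok_def using equilateral_empty by blast
qed

lemma F_ok_empty: "F_ok k \<alpha> d {}"
proof -
  have "equivalent_spaces \<alpha> {} d {} (\<lambda>_ _ :: nat. 0)"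
    unfolding equivalent_spaces_def by (simp add: bij_betw_def)
  moreover have "Metric_space {} (\<lambda>_ _ :: nat. 0)"
    using equilateral_empty unfolding equilateral_def by blast
  ultimately show ?thesis
    unfolding F_ok_def using equilateral_empty by blast
qed

text \<open>\<open>F_ok\<close> asks for a bijection, so Z is the image of N. No tree is built for
  the image: the condition on triples, unlike a tree presentation, restricts to subsets at
  once.\<close>

lemma E_ok_imp_F_ok:
  assumes "E_ok k \<alpha> d N" "1 \<le> k"
  shows "F_ok k \<alpha> d N"
proof -
  obtain X :: "nat set" and e f where X: "binary_HST k X e \<or> equilateral X e"
    and f: "f ` N \<subseteq> X" "inj_on f N" "distortion N d e f \<le> ennreal \<alpha>"
    using assms(1) unfolding E_ok_def embeds_def by blast
  have "Metric_space X e"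
    using X unfolding binary_HST_def HST_tree_def equilateral_def by blast
  then have "Metric_space (f ` N) e"
    using f(1) by (rule Metric_space.subspace)
  moreover have "equilateral (f ` N) e \<or>
      (\<forall>S\<subseteq>f ` N. finite S \<and> 3 \<le> card S \<longrightarrow> ennreal k \<le> c_eq S e)"
    using X
  proof
    assume "binary_HST k X e"
    then have "ennreal k \<le> c_eq S e" if "S \<subseteq> f ` N" "3 \<le> card S" for S
      using binary_HST_c_eq[OF _ assms(2)] f(1) that by (meson order_trans)
    then show ?thesis by blast
  next
    assume "equilateral X e"
    then show ?thesis using f(1) equilateral_subset by blast
  qed
  moreover have "equivalent_spaces \<alpha> N d (f ` N) e"
    unfolding equivalent_spaces_def using f inj_on_imp_bij_betw by blast
  ultimately show ?thesis
    unfolding F_ok_def by blast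
qed

lemma E_num_le_F_num: "1 \<le> k \<Longrightarrow> E_num k \<alpha> n \<le> F_num k \<alpha> n"
  unfolding E_num_eq F_num_eq
  by (rule ramsey_num_mono) (auto intro: E_ok_empty E_ok_imp_F_ok)

section \<open>Subspaces close to HSTs\<close>

text \<open>The metric e dominates d, so that \<open>embeds_if_dominated\<close> applies, and the
  root label D is kept visible for further joins.\<close>

definition near_hst :: "real \<Rightarrow> real \<Rightarrow> (nat \<Rightarrow> nat \<Rightarrow> real) \<Rightarrow> nat set \<Rightarrow> real \<Rightarrow> bool" where
  "near_hst k \<alpha> d N D \<longleftrightarrow> (\<exists>e. hst k N e D \<and>
     (\<forall>x\<in>N. \<forall>y\<in>N. x \<noteq> y \<longrightarrow> d x y \<le> e x y \<and> e x y \<le> \<alpha> * d x y))"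

lemma near_hst_singleton: "near_hst k \<alpha> d {x} 0"
  unfolding near_hst_def using hst.leaf by blast

text \<open>The root label is itself a distance of the HST, hence at most \<alpha> times a distance
  in d. Small diameter thus gives the label decrease required in a join.\<close>

lemma near_hst_diameter:
  assumes "near_hst k \<alpha> d N D" "1 \<le> k" "0 \<le> \<alpha>" "0 \<le> b" "\<And>x y. x \<in> N \<Longrightarrow> y \<in> N \<Longrightarrow> d x y \<le> b"
  shows "D \<le> \<alpha> * b"
proof -
  obtain e where e: "hst k N e D" "\<forall>x\<in>N. \<forall>y\<in>N. x \<noteq> y \<longrightarrow> d x y \<le> e x y \<and> e x y \<le> \<alpha> * d x y"
    using assms(1) unfolding near_hst_def by blast
  obtain x y where xy: "x \<in> N" "y \<in> N" "e x y = D"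
    using hst_diameter_attained[OF e(1)] by blast
  show ?thesis
  proof (cases "x = y")
    case True
    then have "D = 0"
      using hst_bounds[OF e(1) assms(2)] xy Metric_space.zero by fastforce
    then show ?thesis using assms by simp
  next
    case False
    then have "D \<le> \<alpha> * d x y" using e(2) xy by blast
    also have "\<dots> \<le> \<alpha> * b" using assms xy by (intro mult_left_mono) auto
    finally show ?thesis .
  qed
qed

lemma near_hst_join:
  assumes N: "near_hst k \<alpha> d N D" and N': "near_hst k \<alpha> d N' D'" and disj: "N \<inter> N' = {}"
    and L: "0 < L" "D \<le> L / k" "D' \<le> L / k"
    and cross: "\<And>x y. x \<in> N \<Longrightarrow> y \<in> N' \<Longrightarrow> d x y \<le> L \<and> L \<le> \<alpha> * d x y" and sym: "\<And>x y. d x y = d y x"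
  shows "near_hst k \<alpha> d (N \<union> N') L"
proof -
  obtain a where a: "hst k N a D" "\<forall>x\<in>N. \<forall>y\<in>N. x \<noteq> y \<longrightarrow> d x y \<le> a x y \<and> a x y \<le> \<alpha> * d x y"
    using N unfolding near_hst_def by blast
  obtain b where b: "hst k N' b D'" "\<forall>x\<in>N'. \<forall>y\<in>N'. x \<noteq> y \<longrightarrow> d x y \<le> b x y \<and> b x y \<le> \<alpha> * d x y"
    using N' unfolding near_hst_def by blast
  let ?e = "\<lambda>x y. if x \<in> N \<and> y \<in> N then a x y else if x \<in> N' \<and> y \<in> N' then b x y else L"
  have h: "hst k (N \<union> N') ?e L"
    by (rule hst.node[OF a(1) b(1) disj L])
  have dom: "d x y \<le> ?e x y \<and> ?e x y \<le> \<alpha> * d x y" if "x \<in> N \<union> N'" "y \<in> N \<union> N'" "x \<noteq> y" for x y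
  proof -
    consider "x \<in> N" "y \<in> N" | "x \<in> N'" "y \<in> N'" | "x \<in> N" "y \<in> N'" | "x \<in> N'" "y \<in> N"
      using \<open>x \<in> N \<union> N'\<close> \<open>y \<in> N \<union> N'\<close> by blast
    then show ?thesis
    proof cases
      case 1
      then show ?thesis using a(2) \<open>x \<noteq> y\<close> by simp
    next
      case 2
      then have "\<not> (x \<in> N \<and> y \<in> N)" using disj by blast
      then show ?thesis using 2 b(2) \<open>x \<noteq> y\<close> by auto
    next
      case 3
      then have "\<not> (x \<in> N \<and> y \<in> N)" "\<not> (x \<in> N' \<and> y \<in> N')" using disj by blast+
      then show ?thesis using cross[OF 3] by auto
    next
      case 4
      then have "\<not> (x \<in> N \<and> y \<in> N)" "\<not> (x \<in> N' \<and> y \<in> N')" using disj by blast+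
      then show ?thesis using cross[OF 4(2,1)] sym[of x y] by auto
    qed
  qed
  show ?thesis
    unfolding near_hst_def by (intro exI[of _ ?e] conjI[OF h] ballI impI dom)
qed

lemma E_ok_near_hst:
  assumes "near_hst k \<alpha> d N D" "Metric_space N d" "1 \<le> k" "0 \<le> \<alpha>"
  shows "E_ok k \<alpha> d N"
proof -
  obtain e where e: "hst k N e D" "\<forall>x\<in>N. \<forall>y\<in>N. x \<noteq> y \<longrightarrow> d x y \<le> e x y \<and> e x y \<le> \<alpha> * d x y"
    using assms(1) unfolding near_hst_def by blast
  have "embeds \<alpha> N d N e"
    by (rule embeds_if_dominated[OF assms(2) subset_refl assms(4)]) (use e(2) in blast)
  then show ?thesis
    unfolding E_ok_def using hst_binary_HST[OF e(1) assms(3)] by blast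
qed

definition near_equilateral :: "real \<Rightarrow> (nat \<Rightarrow> nat \<Rightarrow> real) \<Rightarrow> nat set \<Rightarrow> bool" where
  "near_equilateral \<alpha> d N \<longleftrightarrow> (\<exists>s>0. \<forall>x\<in>N. \<forall>y\<in>N. x \<noteq> y \<longrightarrow> s \<le> d x y \<and> d x y \<le> \<alpha> * s)"

lemma E_ok_near_equilateral:
  assumes "near_equilateral \<alpha> d N" "Metric_space N d" "0 < \<alpha>"
  shows "E_ok k \<alpha> d N"
proof -
  obtain s where s: "0 < s" "\<forall>x\<in>N. \<forall>y\<in>N. x \<noteq> y \<longrightarrow> s \<le> d x y \<and> d x y \<le> \<alpha> * s"
    using assms(1) unfolding near_equilateral_def by blast
  let ?e = "\<lambda>x y. if x = y then 0 else \<alpha> * s"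
  have "embeds \<alpha> N d N ?e"
    by (rule embeds_if_dominated[OF assms(2) subset_refl]) (use s assms(3) in auto)
  moreover have "equilateral N ?e"
    unfolding equilateral_def using discrete_Metric_space[of "\<alpha> * s" N] s assms(3) by auto
  ultimately show ?thesis
    unfolding E_ok_def by blast
qed

section \<open>Nets and dense clusters\<close>

text \<open>A maximal t-separated subset of Q comes within t of every point of Q.\<close>

lemma net_exists:
  assumes "Metric_space M d" "finite Q" "Q \<subseteq> M" "0 < t"
  shows "\<exists>Y\<subseteq>Q. (\<forall>x\<in>Y. \<forall>y\<in>Y. x \<noteq> y \<longrightarrow> t \<le> d x y) \<and> (\<forall>z\<in>Q. \<exists>y\<in>Y. d y z < t)"
proof -
  interpret Metric_space M d by fact
  let ?F = "{Y. Y \<subseteq> Q \<and> (\<forall>x\<in>Y. \<forall>y\<in>Y. x \<noteq> y \<longrightarrow> t \<le> d x y)}"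
  have "finite ?F" using assms(2) by simp
  moreover have "{} \<in> ?F" by simp
  ultimately have "\<exists>Y\<in>?F. \<forall>Z\<in>?F. Y \<subseteq> Z \<longrightarrow> Y = Z"
    by (intro finite_has_maximal) auto
  then obtain Y where Y: "Y \<in> ?F" and max: "\<forall>Z\<in>?F. Y \<subseteq> Z \<longrightarrow> Y = Z"
    by (elim bexE)
  have "\<exists>y\<in>Y. d y z < t" if "z \<in> Q" for z
  proof (rule ccontr)
    assume "\<not> ?thesis"
    then have far: "\<forall>y\<in>Y. t \<le> d y z \<and> t \<le> d z y" by (auto simp: commute)
    then have "insert z Y \<in> ?F" using Y that by auto
    then have "Y = insert z Y" by (rule max[rule_format]) blast
    then have "t \<le> d z z" using far by (metis insertI1)
    then show False using assms(3,4) that mdist_zero[of z] by auto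
  qed
  moreover have "Y \<subseteq> Q" "\<forall>x\<in>Y. \<forall>y\<in>Y. x \<noteq> y \<longrightarrow> t \<le> d x y"
    using Y by simp_all
  ultimately show ?thesis by (intro exI[of _ Y] conjI ballI impI) auto
qed

text \<open>Pigeonhole over a net: the balls of radius t around its at most l points cover
  Q.\<close>

lemma dense_cluster_exists:
  assumes "Metric_space M d" "finite Q" "Q \<subseteq> M" "Q \<noteq> {}" "0 < t"
    and sep: "\<And>S. S \<subseteq> Q \<Longrightarrow> (\<forall>x\<in>S. \<forall>y\<in>S. x \<noteq> y \<longrightarrow> t \<le> d x y) \<Longrightarrow> real (card S) \<le> l"
  shows "\<exists>c\<in>Q. real (card Q) \<le> l * real (card {z \<in> Q. d c z < t})"
proof (rule ccontr)
  assume "\<not> ?thesis"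
  then have less: "\<And>c. c \<in> Q \<Longrightarrow> l * real (card {z \<in> Q. d c z < t}) < real (card Q)" by force
  obtain Y where Y: "Y \<subseteq> Q" "\<forall>x\<in>Y. \<forall>y\<in>Y. x \<noteq> y \<longrightarrow> t \<le> d x y" "\<forall>z\<in>Q. \<exists>y\<in>Y. d y z < t"
    using net_exists[OF assms(1-3,5)] by blast
  have fY: "finite Y" "Y \<noteq> {}" using finite_subset[OF Y(1) assms(2)] Y(3) assms(4) by auto
  have l: "real (card Y) \<le> l" using sep Y by blast
  then have "0 < l" using fY by (metis card_gt_0_iff of_nat_0_less_iff order_less_le_trans)
  have "Q = (\<Union>y\<in>Y. {z \<in> Q. d y z < t})" using Y(3) by auto
  then have "card Q = card (\<Union>y\<in>Y. {z \<in> Q. d y z < t})" by (rule arg_cong)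
  also have "\<dots> \<le> (\<Sum>y\<in>Y. card {z \<in> Q. d y z < t})"
    by (rule card_UN_le[OF fY(1)])
  finally have "real (card Q) \<le> (\<Sum>y\<in>Y. real (card {z \<in> Q. d y z < t}))"
    unfolding of_nat_sum[symmetric] of_nat_le_iff .
  then have "l * real (card Q) \<le> (\<Sum>y\<in>Y. l * real (card {z \<in> Q. d y z < t}))"
    using \<open>0 < l\<close> by (simp flip: sum_distrib_left)
  also have "\<dots> < (\<Sum>y\<in>Y. real (card Q))"
    using fY less Y(1) by (intro sum_strict_mono) auto
  also have "\<dots> \<le> l * real (card Q)" using l by (simp add: mult_right_mono)
  finally show False by simp
qed

section \<open>Caterpillars of clusters at geometric scales\<close>

text \<open>With R = d y c, each point of N is within R / J of y and each point of N' within R / J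
  of c, so cross distances lie between R * (1 - 2 / J) and R * (1 + 2 / J). The upper end serves as
  label, and J + 2 \<le> \<alpha> * (J - 2) bounds the loss. The parts have diameter at most 2 *
  \<rho> / J, so 2 * \<alpha> * k \<le> J makes their labels at most \<rho> / k \<le> L / k.\<close>

lemma near_hst_attach:
  assumes M: "Metric_space M d" and k: "1 \<le> k" and \<alpha>: "1 < \<alpha>"
    and J: "4 \<le> J" "2 * \<alpha> * k \<le> J" "J + 2 \<le> \<alpha> * (J - 2)" and \<rho>: "0 < \<rho>" and y: "y \<in> M"
    and N: "N \<subseteq> M" "near_hst k \<alpha> d N D" "\<And>x. x \<in> N \<Longrightarrow> d y x \<le> \<rho> / J"
    and N': "N' \<subseteq> M" "near_hst k \<alpha> d N' D'" "\<And>z. z \<in> N' \<Longrightarrow> \<rho> < d y z"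
    and c: "c \<in> M" "\<rho> < d y c" "\<And>z. z \<in> N' \<Longrightarrow> d c z < \<rho> / J"
  shows "\<exists>L. near_hst k \<alpha> d (N \<union> N') L \<and> N \<inter> N' = {}"
proof (intro exI conjI)
  interpret Metric_space M d by fact
  define R where "R = d y c"
  have R: "\<rho> < R" "0 < R" using c \<rho> by (auto simp: R_def)
  define L where "L = R * (1 + 2 / J)"
  have J0: "0 < J" using J by simp
  have "\<rho> / J \<le> \<rho>" using \<rho> J by (simp add: divide_le_eq)
  then show disj: "N \<inter> N' = {}" using N(3) N'(3) by fastforce
  have near: "D'' \<le> L / k" if "near_hst k \<alpha> d N'' D''" "\<And>x. x \<in> N'' \<Longrightarrow> d o' x \<le> \<rho> / J" "N'' \<subseteq> M" "o' \<in> M"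
    for N'' D'' o'
  proof -
    have "d x x' \<le> 2 * (\<rho> / J)" if "x \<in> N''" "x' \<in> N''" for x x'
    proof -
      have "d x x' \<le> d x o' + d o' x'"
        using that \<open>N'' \<subseteq> M\<close> \<open>o' \<in> M\<close> by (intro triangle) auto
      moreover have "d x o' \<le> \<rho> / J" "d o' x' \<le> \<rho> / J"
        using that \<open>\<And>x. x \<in> N'' \<Longrightarrow> d o' x \<le> \<rho> / J\<close> commute by metis+
      ultimately show ?thesis by simp
    qed
    then have "D'' \<le> \<alpha> * (2 * (\<rho> / J))"
      using \<alpha> \<rho> J0 by (intro near_hst_diameter[OF that(1) k]) auto
    also have "\<dots> = (2 * \<alpha> * k) * (\<rho> / (J * k))" using k by simp
    also have "\<dots> \<le> J * (\<rho> / (J * k))" using J \<rho> k by (intro mult_right_mono) auto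
    also have "\<dots> = \<rho> / k" using J0 by simp
    also have "\<dots> \<le> L / k"
    proof (rule divide_right_mono)
      have "R * 1 \<le> R * (1 + 2 / J)" using R J0 by (intro mult_left_mono) auto
      then show "\<rho> \<le> L" unfolding L_def using R by linarith
    qed (use k in simp)
    finally show ?thesis .
  qed
  show "near_hst k \<alpha> d (N \<union> N') L"
  proof (rule near_hst_join[OF N(2) N'(2) disj])
    show "0 < L" unfolding L_def using R J0 by (intro mult_pos_pos add_pos_pos) auto
    show "D \<le> L / k" using near[OF N(2) N(3) N(1) y] .
    show "D' \<le> L / k" using near[OF N'(2) _ N'(1) c(1)] c(3) by (simp add: less_imp_le)
    show "d x y = d y x" for x y by (rule commute)
    fix x z assume x: "x \<in> N" and z: "z \<in> N'"
    have in_M: "x \<in> M" "z \<in> M" using x z N N' by auto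
    have "d x z \<le> d x y + d y c + d c z"
      using triangle[of x y z] triangle[of y c z] in_M y c by linarith
    moreover have "R \<le> d y x + d x z + d z c"
      unfolding R_def using triangle[of y x c] triangle[of x z c] in_M y c by linarith
    moreover have "d y x \<le> \<rho> / J" "d c z \<le> \<rho> / J" using N(3)[OF x] c(3)[OF z] by auto
    moreover have "\<rho> / J \<le> R / J" using R J0 by (simp add: divide_right_mono)
    ultimately have up: "d x z \<le> R + 2 * (R / J)" and lo: "R - 2 * (R / J) \<le> d x z"
      unfolding R_def by (auto simp: commute)
    have "L = R / J * (J + 2)" unfolding L_def using J0 by (simp add: field_simps)
    also have "\<dots> \<le> R / J * (\<alpha> * (J - 2))" using J R by (intro mult_left_mono) auto
    also have "\<dots> = \<alpha> * (R - 2 * (R / J))" using J0 by (simp add: field_simps)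
    also have "\<dots> \<le> \<alpha> * d x z" using lo \<alpha> by (intro mult_left_mono) auto
    finally have "L \<le> \<alpha> * d x z" .
    moreover have "d x z \<le> L" unfolding L_def using up by (simp add: algebra_simps)
    ultimately show "d x z \<le> L \<and> L \<le> \<alpha> * d x z" by simp
  qed
qed

text \<open>Shell i ends at \<rho> * J^(2 * i + 1) and the next shell begins a factor J further out.
  The bound \<rho> * J^(2 * m) / J on the radius of T is the invariant that lets the next cluster be
  attached by \<open>near_hst_attach\<close>.\<close>

lemma caterpillar:
  assumes M: "Metric_space M d" and fM: "finite M" and k: "1 \<le> k" and \<alpha>: "1 < \<alpha>"
    and J: "4 \<le> J" "2 * \<alpha> * k \<le> J" "J + 2 \<le> \<alpha> * (J - 2)" and \<rho>: "0 < \<rho>" and y: "y \<in> M"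
    and N0: "N0 \<subseteq> M" "near_hst k \<alpha> d N0 D0" "\<And>x. x \<in> N0 \<Longrightarrow> d y x \<le> \<rho> / J"
    and N: "\<And>i. N i = {} \<or> (N i \<subseteq> M \<and> (\<exists>D. near_hst k \<alpha> d (N i) D) \<and>
        (\<forall>z\<in>N i. \<rho> * J ^ (2 * i) < d y z \<and> d y z \<le> \<rho> * J ^ (2 * i) * J) \<and>
        (\<exists>c\<in>M. \<rho> * J ^ (2 * i) < d y c \<and> (\<forall>z\<in>N i. d c z < \<rho> * J ^ (2 * i) / J)))"
  shows "\<exists>T D. T \<subseteq> N0 \<union> (\<Union>i<m. N i) \<and> near_hst k \<alpha> d T D \<and>
    (\<forall>x\<in>T. d y x \<le> \<rho> * J ^ (2 * m) / J) \<and> card T = card N0 + (\<Sum>i<m. card (N i))"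
proof (induction m)
  case 0
  then show ?case using N0 by auto
next
  case (Suc m)
  then obtain T D where T: "T \<subseteq> N0 \<union> (\<Union>i<m. N i)" "near_hst k \<alpha> d T D"
    "\<forall>x\<in>T. d y x \<le> \<rho> * J ^ (2 * m) / J" "card T = card N0 + (\<Sum>i<m. card (N i))" by blast
  have grow: "\<rho> * J ^ (2 * Suc m) / J = \<rho> * J ^ (2 * m) * J"
    using J by (simp add: power2_eq_square)
  have "\<rho> * J ^ (2 * m) * 1 \<le> \<rho> * J ^ (2 * m) * (J * J)"
    using \<rho> J mult_mono[of 1 J 1 J] by (intro mult_left_mono) auto
  then have "\<rho> * J ^ (2 * m) / J \<le> \<rho> * J ^ (2 * m) * J"
    using J by (simp add: divide_le_eq mult.assoc)
  then have T': "\<forall>x\<in>T. d y x \<le> \<rho> * J ^ (2 * Suc m) / J"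
    unfolding grow using T(3) by fastforce
  show ?case
  proof (cases "N m = {}")
    case True
    then show ?thesis using T(1,2,4) T' by (intro exI[of _ T] exI[of _ D]) (auto simp: lessThan_Suc)
  next
    case False
    then obtain D' c where Nm: "N m \<subseteq> M" "near_hst k \<alpha> d (N m) D'"
        "\<forall>z\<in>N m. \<rho> * J ^ (2 * m) < d y z \<and> d y z \<le> \<rho> * J ^ (2 * m) * J"
      and c: "c \<in> M" "\<rho> * J ^ (2 * m) < d y c" "\<forall>z\<in>N m. d c z < \<rho> * J ^ (2 * m) / J"
      using N[of m] by blast
    have TM: "T \<subseteq> M"
    proof -
      have "N i \<subseteq> M" for i using N[of i] by auto
      then show ?thesis using T(1) N0(1) by blast
    qed
    have "0 < \<rho> * J ^ (2 * m)" using \<rho> J by simp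
    then obtain L where L: "near_hst k \<alpha> d (T \<union> N m) L" "T \<inter> N m = {}"
      using near_hst_attach[OF M k \<alpha> J _ y TM T(2) _ Nm(1,2) _ c(1,2)] T(3) Nm(3) c(3) by blast
    have "card (T \<union> N m) = card N0 + (\<Sum>i<Suc m. card (N i))"
      using T(4) L(2) TM Nm(1) fM finite_subset by (subst card_Un_disjoint) auto
    moreover have "\<forall>x\<in>T \<union> N m. d y x \<le> \<rho> * J ^ (2 * Suc m) / J"
      using T' Nm(3) unfolding grow by blast
    moreover have "T \<union> N m \<subseteq> N0 \<union> (\<Union>i<Suc m. N i)"
      using T(1) by (auto simp: lessThan_Suc)
    ultimately show ?thesis using L(1) by blast
  qed
qed

text \<open>After division by the sum S every summand is at most 1, so raising it to a power p \<le>
  1 does not decrease it.\<close>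

lemma powr_sum_subadditive:
  fixes q :: "'a \<Rightarrow> real"
  assumes "finite I" "\<And>i. i \<in> I \<Longrightarrow> 0 \<le> q i" "0 < p" "p \<le> 1"
  shows "(\<Sum>i\<in>I. q i) powr p \<le> (\<Sum>i\<in>I. q i powr p)"
proof (cases "(\<Sum>i\<in>I. q i) = 0")
  case True
  then show ?thesis by (simp add: sum_nonneg)
next
  case False
  define S where "S = (\<Sum>i\<in>I. q i)"
  have S: "0 < S" using False assms(2) by (simp add: S_def order_less_le sum_nonneg)
  have summand: "q i / S * S powr p \<le> q i powr p" if "i \<in> I" for i
  proof -
    have "q i \<le> S" unfolding S_def using assms that by (intro member_le_sum) auto
    then have "(q i / S) powr 1 \<le> (q i / S) powr p"
      using assms S that by (intro powr_mono') auto
    then have "q i / S * S powr p \<le> (q i / S) powr p * S powr p"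
      using assms S that by (intro mult_right_mono) auto
    also have "\<dots> = q i powr p"
      using assms S that by (subst powr_mult[symmetric]) auto
    finally show ?thesis .
  qed
  have "S powr p = (\<Sum>i\<in>I. q i / S * S powr p)"
    using S by (simp add: S_def flip: sum_distrib_right sum_divide_distrib)
  also have "\<dots> \<le> (\<Sum>i\<in>I. q i powr p)" by (intro sum_mono summand)
  finally show ?thesis unfolding S_def .
qed

text \<open>The radius r is the least distance within A at which some ball holds a majority; only
  finitely many distances compete. It is positive because a ball of radius 0 is a single point,
  which is no majority of two or more points.\<close>

lemma critical_radius:
  assumes M: "Metric_space M d" and fA: "finite A" and AM: "A \<subseteq> M" and card: "2 \<le> card A"
  shows "\<exists>x\<in>A. \<exists>r>0. card A < 2 * card {z \<in> A. d x z \<le> r} \<and>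
    (\<forall>y\<in>A. \<forall>s<r. 2 * card {z \<in> A. d y z \<le> s} \<le> card A)"
proof -
  interpret Metric_space M d by fact
  define P where "P x r \<longleftrightarrow> card A < 2 * card {z \<in> A. d x z \<le> r}" for x r
  define T where "T = {r \<in> (\<lambda>(x, w). d x w) ` (A \<times> A). \<exists>x\<in>A. P x r}"
  have fT: "finite T" unfolding T_def using fA by simp
  \<comment> \<open>A majority ball of any radius can be shrunk to the distance of its farthest
    point without losing points, so minimality over T suffices for all real radii.\<close>
  have reach: "\<exists>r\<in>T. r \<le> s" if y: "y \<in> A" and P: "P y s" for y s
  proof -
    let ?B = "{z \<in> A. d y z \<le> s}"
    have fB: "finite ?B" using fA by simp
    have "?B \<noteq> {}" using P unfolding P_def by (metis card.empty mult_0_right not_less_zero)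
    then have "Max (d y ` ?B) \<in> d y ` ?B" using fB by (intro Max_in) auto
    then obtain w where w: "w \<in> ?B" "Max (d y ` ?B) = d y w" by (rule imageE)
    then have le: "z \<in> ?B \<Longrightarrow> d y z \<le> d y w" for z
      using Max_ge[of "d y ` ?B" "d y z"] fB by auto
    then have "?B \<subseteq> {z \<in> A. d y z \<le> d y w}" by blast
    then have "card ?B \<le> card {z \<in> A. d y z \<le> d y w}" using fA by (intro card_mono) auto
    then have "P y (d y w)" using P unfolding P_def by linarith
    then have "d y w \<in> T" unfolding T_def using y w(1) by auto
    then show ?thesis using w(1) by auto
  qed
  obtain a where a: "a \<in> A" using card by fastforce
  define b where "b = Max (d a ` A)"
  have "{z \<in> A. d a z \<le> b} = A" unfolding b_def using fA by auto
  then have "P a b" unfolding P_def using card by simp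
  then have "T \<noteq> {}" using reach[OF a] by blast
  define r where "r = Min T"
  have "r \<in> T" unfolding r_def using fT \<open>T \<noteq> {}\<close> by simp
  then obtain x where x: "x \<in> A" "P x r" and "0 \<le> r" unfolding T_def by auto
  have "r \<noteq> 0"
  proof
    assume "r = 0"
    have "z = x" if "z \<in> A" "d x z \<le> 0" for z
    proof (rule ccontr)
      assume "z \<noteq> x"
      then have "0 < d x z" using x(1) AM that(1) by (subst mdist_pos_eq) auto
      then show False using that(2) by simp
    qed
    then have "{z \<in> A. d x z \<le> 0} \<subseteq> {x}" by blast
    then have "card {z \<in> A. d x z \<le> 0} \<le> 1" using card_mono[of "{x}"] by fastforce
    then show False using x(2) card \<open>r = 0\<close> unfolding P_def by simp
  qed
  moreover have "2 * card {z \<in> A. d y z \<le> s} \<le> card A" if ys: "y \<in> A" "s < r" for y s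
  proof (rule ccontr)
    assume "\<not> ?thesis"
    then have "P y s" unfolding P_def by simp
    then obtain r' where "r' \<in> T" "r' \<le> s" using reach[OF ys(1)] by blast
    then have "r \<le> s" unfolding r_def using fT Min_le order_trans by blast
    then show False using ys(2) by simp
  qed
  ultimately show ?thesis
    using x \<open>0 \<le> r\<close> unfolding P_def by (intro bexI[of _ x] exI[of _ r]) auto
qed

text \<open>The part outside radius \<rho> is cut into consecutive shells of ratio J, and the shells
  of the better parity are kept. Discarding the others leaves the gaps that a caterpillar needs; j
  records the parity.\<close>

lemma shell_selection:
  fixes g :: "'a \<Rightarrow> real"
  assumes fA: "finite A" and J: "1 < J" and \<rho>: "0 < \<rho>"
  shows "\<exists>j m :: nat. card {z \<in> A. \<rho> < g z} \<le>
    2 * (\<Sum>i<m. card {z \<in> A. \<rho> * J ^ j * J ^ (2 * i) < g z \<and> g z \<le> \<rho> * J ^ j * J ^ (2 * i) * J})"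
proof -
  define sh where "sh i = {z \<in> A. \<rho> * J ^ i < g z \<and> g z \<le> \<rho> * J ^ i * J}" for i :: nat
  have cover: "{z \<in> A. \<rho> < g z \<and> g z \<le> \<rho> * J ^ m} \<subseteq> (\<Union>i<m. sh i)" for m
  proof (induction m)
    case (Suc m)
    have "{z \<in> A. \<rho> < g z \<and> g z \<le> \<rho> * J ^ Suc m} \<subseteq> {z \<in> A. \<rho> < g z \<and> g z \<le> \<rho> * J ^ m} \<union> sh m"
      unfolding sh_def by (auto simp: mult_ac)
    then show ?case using Suc.IH unfolding lessThan_Suc by blast
  qed auto
  \<comment> \<open>Inserting 0 keeps the maximum defined for empty A. Below, 2 * m shells are used
    so that they split evenly by parity.\<close>
  obtain m where m: "Max (insert 0 (g ` A)) / \<rho> < J ^ m" using real_arch_pow[OF J] by blast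
  have "g z \<le> \<rho> * J ^ (2 * m)" if "z \<in> A" for z
  proof -
    have "g z \<le> Max (insert 0 (g ` A))" using fA that by simp
    also have "\<dots> \<le> \<rho> * J ^ m" using m \<rho> by (simp add: divide_less_eq mult.commute)
    also have "\<dots> \<le> \<rho> * J ^ (2 * m)" using \<rho> J by (intro mult_left_mono power_increasing) auto
    finally show ?thesis .
  qed
  then have "{z \<in> A. \<rho> < g z} = {z \<in> A. \<rho> < g z \<and> g z \<le> \<rho> * J ^ (2 * m)}" by auto
  then have "card {z \<in> A. \<rho> < g z} \<le> card (\<Union>i<2 * m. sh i)"
    using cover[of "2 * m"] fA by (intro card_mono) (auto simp: sh_def)
  also have "\<dots> \<le> (\<Sum>i<2 * m. card (sh i))" by (intro card_UN_le) simp
  also have "\<dots> = (\<Sum>i<m. card (sh (2 * i))) + (\<Sum>i<m. card (sh (1 + 2 * i)))"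
    by (induction m) auto
  finally have "card {z \<in> A. \<rho> < g z} \<le>
    (\<Sum>i<m. card (sh (0 + 2 * i))) + (\<Sum>i<m. card (sh (1 + 2 * i)))" by simp
  then have "card {z \<in> A. \<rho> < g z} \<le> 2 * (\<Sum>i<m. card (sh (0 + 2 * i))) \<or>
      card {z \<in> A. \<rho> < g z} \<le> 2 * (\<Sum>i<m. card (sh (1 + 2 * i)))" by linarith
  then obtain j where "card {z \<in> A. \<rho> < g z} \<le> 2 * (\<Sum>i<m. card (sh (j + 2 * i)))" by blast
  then show ?thesis
    by (intro exI[of _ j] exI[of _ m]) (simp add: sh_def power_add mult.assoc)
qed

text \<open>The exponent satisfies 2 * (n / (4 * l)) powr p = n powr p: the central cluster and the
  selected shells together contribute at least (n / (4 * l)) powr p twice.\<close>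

lemma near_hst_subset_exists:
  fixes l :: real
  assumes M: "Metric_space M d" and fM: "finite M" and k: "1 \<le> k" and \<alpha>: "1 < \<alpha>"
    and J: "4 \<le> J" "2 * \<alpha> * k \<le> J" "J + 2 \<le> \<alpha> * (J - 2)" and l: "1 \<le> l"
    and sep: "\<And>x s S. x \<in> M \<Longrightarrow> 0 < s \<Longrightarrow> S \<subseteq> M \<Longrightarrow> (\<forall>z\<in>S. d x z \<le> s) \<Longrightarrow>
      (\<forall>z\<in>S. \<forall>w\<in>S. z \<noteq> w \<longrightarrow> s / J\<^sup>2 \<le> d z w) \<Longrightarrow> real (card S) \<le> l"
    and p: "p = ln 2 / ln (4 * l)"
  shows "A \<subseteq> M \<Longrightarrow> A \<noteq> {} \<Longrightarrow>
    \<exists>N\<subseteq>A. (\<exists>D. near_hst k \<alpha> d N D) \<and> real (card A) powr p \<le> real (card N)"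
proof (induction "card A" arbitrary: A rule: less_induct)
  case less
  interpret Metric_space M d by fact
  have fA: "finite A" using less.prems(1) fM finite_subset by blast
  have "ln 2 \<le> ln (4 * l)" using l by (subst ln_le_cancel_iff) auto
  moreover have "0 < ln (2 :: real)" by simp
  ultimately have lnl: "0 < ln (4 * l)" by linarith
  with \<open>ln 2 \<le> ln (4 * l)\<close> have p01: "0 < p" "p \<le> 1"
    unfolding p by (simp_all add: divide_le_eq)
  have half: "(x / (4 * l)) powr p = x powr p / 2" if "0 \<le> x" for x
  proof -
    have "(4 * l) powr p = 2" unfolding powr_def p using l lnl by simp
    then show ?thesis using that l by (simp add: powr_divide)
  qed
  show ?case
  proof (cases "card A = 1")
    case True
    then obtain x where "A = {x}" by (auto simp: card_1_singleton_iff)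
    then show ?thesis
      using near_hst_singleton[of k \<alpha> d x] by (intro exI[of _ A]) auto
  next
    case False
    then have "2 \<le> card A"
      using less.prems(2) fA by (metis Suc_1 Suc_leI card_gt_0_iff le_neq_implies_less One_nat_def)
    then obtain x r where x: "x \<in> A" and r: "0 < r" and big: "card A < 2 * card {z \<in> A. d x z \<le> r}"
      and small: "\<forall>y\<in>A. \<forall>s<r. 2 * card {z \<in> A. d y z \<le> s} \<le> card A"
      using critical_radius[OF M fA less.prems(1)] by blast
    define n where "n = real (card A)"
    define Q0 where "Q0 = {z \<in> A. d x z \<le> r}"
    have "x \<in> M" using x less.prems(1) by blast
    then have "x \<in> Q0" unfolding Q0_def using x r by simp
    then have Q0: "finite Q0" "Q0 \<subseteq> M" "Q0 \<noteq> {}"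
      unfolding Q0_def using fA less.prems(1) by auto
    have J0: "0 < J" "1 < J" using J by auto
    obtain y where y: "y \<in> Q0" and A0: "real (card Q0) \<le> l * real (card {z \<in> Q0. d y z < r / J\<^sup>2})"
    proof -
      have "\<exists>y\<in>Q0. real (card Q0) \<le> l * real (card {z \<in> Q0. d y z < r / J\<^sup>2})"
      proof (rule dense_cluster_exists[OF M Q0])
        show "real (card S) \<le> l" if "S \<subseteq> Q0" "\<forall>x\<in>S. \<forall>y\<in>S. x \<noteq> y \<longrightarrow> r / J\<^sup>2 \<le> d x y" for S
          by (rule sep[of x r S]) (use that r x less.prems(1) Q0_def in auto)
      qed (use r J0 in simp)
      then show ?thesis using that by blast
    qed
    \<comment> \<open>Any radius below r leaves at least half of A outside the ball around y, even
      though y differs from x. Half of r is still large enough for the central cluster: r /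
      \<open>J\<^sup>2\<close> \<le> \<rho> / J because J \<ge> 2.\<close>
    define \<rho> where "\<rho> = r / 2"
    have \<rho>: "0 < \<rho>" "\<rho> < r" using r by (auto simp: \<rho>_def)
    have yA: "y \<in> A" "y \<in> M" using y less.prems(1) by (auto simp: Q0_def)
    define A0 where "A0 = {z \<in> Q0. d y z < r / J\<^sup>2}"
    obtain j m where jm: "card {z \<in> A. \<rho> < d y z} \<le> 2 * (\<Sum>i<m.
        card {z \<in> A. \<rho> * J ^ j * J ^ (2 * i) < d y z \<and> d y z \<le> \<rho> * J ^ j * J ^ (2 * i) * J})"
      using shell_selection[OF fA J0(2) \<rho>(1)] by blast
    \<comment> \<open>The parity j of the chosen shells is absorbed into the starting
      radius.\<close>
    define \<rho>' where "\<rho>' = \<rho> * J ^ j"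
    have "1 \<le> J ^ j" using J by simp
    then have \<rho>': "\<rho> \<le> \<rho>'" "0 < \<rho>'" unfolding \<rho>'_def using \<rho> by auto
    define Q where "Q i = {z \<in> A. \<rho>' * J ^ (2 * i) < d y z \<and> d y z \<le> \<rho>' * J ^ (2 * i) * J}" for i
    \<comment> \<open>At least half of A lies beyond \<rho>, and the parity selection keeps at least
      half of that.\<close>
    have outside: "n \<le> 4 * (\<Sum>i<m. real (card (Q i)))" "{z \<in> A. \<rho> < d y z} \<noteq> {}"
    proof -
      have "A = {z \<in> A. d y z \<le> \<rho>} \<union> {z \<in> A. \<rho> < d y z}" by auto
      then have split: "card A \<le> card {z \<in> A. d y z \<le> \<rho>} + card {z \<in> A. \<rho> < d y z}"
        by (metis card_Un_le)
      moreover have sm: "2 * card {z \<in> A. d y z \<le> \<rho>} \<le> card A"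
        using small yA \<rho> by blast
      ultimately have "card A \<le> 4 * (\<Sum>i<m. card (Q i))"
        using jm unfolding Q_def \<rho>'_def by linarith
      then show "n \<le> 4 * (\<Sum>i<m. real (card (Q i)))"
        unfolding n_def by (simp flip: of_nat_sum)
      show "{z \<in> A. \<rho> < d y z} \<noteq> {}"
      proof
        assume "{z \<in> A. \<rho> < d y z} = {}"
        then have "card {z \<in> A. \<rho> < d y z} = 0" by (simp only: card.empty)
        then show False using split sm \<open>2 \<le> card A\<close> by linarith
      qed
    qed
    have "\<exists>N. N \<subseteq> Q i \<and> (N = {} \<or> (N \<subseteq> M \<and> (\<exists>D. near_hst k \<alpha> d N D) \<and>
        (\<forall>z\<in>N. \<rho>' * J ^ (2 * i) < d y z \<and> d y z \<le> \<rho>' * J ^ (2 * i) * J) \<and>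
        (\<exists>c\<in>M. \<rho>' * J ^ (2 * i) < d y c \<and> (\<forall>z\<in>N. d c z < \<rho>' * J ^ (2 * i) / J)))) \<and>
        (real (card (Q i)) / l) powr p \<le> real (card N)" for i
    proof (cases "Q i = {}")
      case True
      then show ?thesis using p01 by auto
    next
      case False
      define u where "u = \<rho>' * J ^ (2 * i)"
      have u: "0 < u" unfolding u_def using \<rho>' J0 by simp
      have Qu: "Q i = {z \<in> A. u < d y z \<and> d y z \<le> u * J}" unfolding Q_def u_def ..
      have QM: "finite (Q i)" "Q i \<subseteq> M" unfolding Qu using fA less.prems(1) by auto
      \<comment> \<open>A shell lies in the ball of radius u * J around y and its cluster has radius
        u / J. This ratio is the reason for \<open>J\<^sup>2\<close> in the hypothesis
        \<open>sep\<close>.\<close>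
      have "\<exists>c\<in>Q i. real (card (Q i)) \<le> l * real (card {z \<in> Q i. d c z < u / J})"
      proof (rule dense_cluster_exists[OF M QM False])
        show "real (card S) \<le> l" if "S \<subseteq> Q i" "\<forall>x\<in>S. \<forall>y\<in>S. x \<noteq> y \<longrightarrow> u / J \<le> d x y" for S
          by (rule sep[of y "u * J" S]) (use that u J0 yA QM Qu in \<open>auto simp: power2_eq_square\<close>)
      qed (use u J0 in simp)
      then obtain c where c: "c \<in> Q i" "real (card (Q i)) \<le> l * real (card {z \<in> Q i. d c z < u / J})" by blast
      define B where "B = {z \<in> Q i. d c z < u / J}"
      have B: "B \<subseteq> A" "B \<subseteq> M" "B \<subseteq> Q i" unfolding B_def Qu using less.prems(1) by auto
      have "c \<in> B" unfolding B_def using c(1) u J0 QM by auto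
      \<comment> \<open>Missing y makes B a proper subset of A, as the induction on cardinality
        requires.\<close>
      have "y \<notin> B" unfolding B_def Qu using u yA by auto
      then have "B \<subset> A" using B(1) yA by blast
      then have "card B < card A" using fA by (rule psubset_card_mono[rotated])
      then obtain N D where N: "N \<subseteq> B" "near_hst k \<alpha> d N D" "real (card B) powr p \<le> real (card N)"
        using less.hyps[of B] B(2) \<open>c \<in> B\<close> by blast
      have "real (card (Q i)) / l \<le> real (card B)"
        using c(2) l unfolding B_def by (simp add: divide_le_eq mult.commute)
      then have "(real (card (Q i)) / l) powr p \<le> real (card B) powr p"
        using p01 l by (intro powr_mono2) auto
      moreover have "\<forall>z\<in>N. u < d y z \<and> d y z \<le> u * J" using N(1) B(3) unfolding Qu by blast
      moreover have "c \<in> M" "u < d y c" "\<forall>z\<in>N. d c z < u / J"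
        using c(1) QM N(1) unfolding B_def Qu by auto
      ultimately show ?thesis
        unfolding u_def[symmetric] using N B(2,3) by (intro exI[of _ N]) auto
    qed
    then obtain N where NQ: "\<And>i. N i \<subseteq> Q i" and N: "\<And>i. N i = {} \<or> (N i \<subseteq> M \<and> (\<exists>D. near_hst k \<alpha> d (N i) D) \<and>
        (\<forall>z\<in>N i. \<rho>' * J ^ (2 * i) < d y z \<and> d y z \<le> \<rho>' * J ^ (2 * i) * J) \<and>
        (\<exists>c\<in>M. \<rho>' * J ^ (2 * i) < d y c \<and> (\<forall>z\<in>N i. d c z < \<rho>' * J ^ (2 * i) / J)))"
      and Np: "\<And>i. (real (card (Q i)) / l) powr p \<le> real (card (N i))"
      by metis
    have inner: "r / J\<^sup>2 \<le> \<rho> / J"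
      using r J unfolding \<rho>_def by (simp add: field_simps power2_eq_square)
    have "A0 \<subseteq> A" "A0 \<subseteq> M" "y \<in> A0"
      unfolding A0_def using y r J0 yA less.prems(1) by (auto simp: Q0_def)
    moreover have "\<rho> / J \<le> \<rho>" using \<rho> J0 by (simp add: divide_le_eq)
    then have "{z \<in> A. \<rho> < d y z} \<inter> A0 = {}" using inner unfolding A0_def by auto
    \<comment> \<open>The central cluster misses the points beyond \<rho>, and there are
      some.\<close>
    ultimately have "card A0 < card A"
      using fA outside(2) by (intro psubset_card_mono) auto
    then obtain N0 D0 where N0: "N0 \<subseteq> A0" "near_hst k \<alpha> d N0 D0" "real (card A0) powr p \<le> real (card N0)"
      using less.hyps[of A0] \<open>A0 \<subseteq> M\<close> \<open>y \<in> A0\<close> by blast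
    have N0': "N0 \<subseteq> M" "\<And>z. z \<in> N0 \<Longrightarrow> d y z \<le> \<rho>' / J"
    proof -
      show "N0 \<subseteq> M" using N0(1) \<open>A0 \<subseteq> M\<close> by blast
      fix z assume "z \<in> N0"
      then have "d y z \<le> \<rho> / J" using N0(1) inner unfolding A0_def by fastforce
      also have "\<dots> \<le> \<rho>' / J" using \<rho>' J0 by (simp add: divide_right_mono)
      finally show "d y z \<le> \<rho>' / J" .
    qed
    obtain T D where T: "T \<subseteq> N0 \<union> (\<Union>i<m. N i)" "near_hst k \<alpha> d T D"
      "card T = card N0 + (\<Sum>i<m. card (N i))"
      using caterpillar[OF M fM k \<alpha> J \<rho>'(2) yA(2) N0'(1) N0(2) N0'(2) N, of m] by blast
    have "N i \<subseteq> A" for i using NQ[of i] unfolding Q_def by blast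
    then have "T \<subseteq> A" using T(1) N0(1) \<open>A0 \<subseteq> A\<close> by blast
    moreover have "n powr p \<le> real (card T)"
    proof -
      have n0: "0 \<le> n" by (simp add: n_def)
      have "n / (4 * l) \<le> real (card A0)"
      proof -
        have "n \<le> 2 * real (card Q0)" using big unfolding n_def Q0_def by linarith
        also have "\<dots> \<le> 2 * (l * real (card A0))" using A0 unfolding A0_def by simp
        also have "\<dots> \<le> 4 * (l * real (card A0))" using l by (intro mult_right_mono) auto
        finally show ?thesis using l by (simp add: divide_le_eq mult_ac)
      qed
      then have "(n / (4 * l)) powr p \<le> real (card A0) powr p"
        using p01 l n0 by (intro powr_mono2) auto
      then have 1: "n powr p / 2 \<le> real (card N0)"
        using N0(3) half[OF n0] by simp
      have "n / (4 * l) \<le> (\<Sum>i<m. real (card (Q i)) / l)"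
        using outside(1) l by (simp add: divide_le_eq flip: sum_divide_distrib)
      then have "(n / (4 * l)) powr p \<le> (\<Sum>i<m. real (card (Q i)) / l) powr p"
        using p01 l n0 by (intro powr_mono2) auto
      also have "\<dots> \<le> (\<Sum>i<m. (real (card (Q i)) / l) powr p)"
        using p01 l by (intro powr_sum_subadditive) auto
      also have "\<dots> \<le> (\<Sum>i<m. real (card (N i)))" by (intro sum_mono Np)
      finally have "n powr p / 2 \<le> (\<Sum>i<m. real (card (N i)))" using half[OF n0] by simp
      then show ?thesis using 1 unfolding T(3) by simp
    qed
    ultimately show ?thesis using T(2) unfolding n_def by blast
  qed
qed

section \<open>Dichotomies between equilateral subspaces and bounded nets\<close>

text \<open>Induction on the sum of the targets. A point x has at least c^m neighbours in one colour
  i; in that class the target for i is lowered by one, and x is put back if the set found there has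
  colour i.\<close>

lemma multicolor_ramsey:
  fixes f :: "'a \<Rightarrow> 'a \<Rightarrow> nat" and t :: "nat \<Rightarrow> nat"
  assumes c: "2 \<le> c" and sym: "\<And>z w. f z w = f w z"
  shows "finite S \<Longrightarrow> (\<And>z w. z \<in> S \<Longrightarrow> w \<in> S \<Longrightarrow> z \<noteq> w \<Longrightarrow> f z w < c) \<Longrightarrow>
    c ^ (\<Sum>i<c. t i) \<le> card S \<Longrightarrow>
    \<exists>i<c. \<exists>T\<subseteq>S. t i \<le> card T \<and> (\<forall>z\<in>T. \<forall>w\<in>T. z \<noteq> w \<longrightarrow> f z w = i)"
proof (induction "\<Sum>i<c. t i" arbitrary: S t)
  case 0
  then have "t 0 = 0" using c by simp
  then show ?case using c by (intro exI[of _ 0] conjI exI[of _ "{}"]) auto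
next
  case (Suc m)
  show ?case
  proof (cases "\<exists>i<c. t i = 0")
    case True
    then obtain i where "i < c" "t i = 0" by blast
    then show ?thesis by (intro exI[of _ i] conjI exI[of _ "{}"]) auto
  next
    case False
    have "0 < c ^ (\<Sum>i<c. t i)" using c by simp
    then have "card S \<noteq> 0" using Suc.prems(3) by linarith
    then obtain x where x: "x \<in> S" by fastforce
    define K where "K i = {w \<in> S - {x}. f x w = i}" for i
    have K: "K i \<subseteq> S" "x \<notin> K i" "finite (K i)" for i
      unfolding K_def using Suc.prems(1) by auto
    have "S - {x} \<subseteq> (\<Union>i<c. K i)" unfolding K_def using Suc.prems(2) x by auto
    then have "card (S - {x}) \<le> card (\<Union>i<c. K i)" using K(3) by (intro card_mono) auto
    also have "\<dots> \<le> (\<Sum>i<c. card (K i))" by (intro card_UN_le) simp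
    finally have S: "card S \<le> (\<Sum>i<c. card (K i)) + 1"
      using x Suc.prems(1) by (simp add: card_Diff_singleton)
    \<comment> \<open>Otherwise each class has at most c^m - 1 points, so S has at most c * c^m - c
      + 1 points, which is too few as c \<ge> 2.\<close>
    have "\<exists>i<c. c ^ m \<le> card (K i)"
    proof (rule ccontr)
      assume "\<not> ?thesis"
      then have "(\<Sum>i<c. card (K i) + 1) \<le> (\<Sum>i<c. c ^ m)"
        by (intro sum_mono) (auto simp: not_le Suc_le_eq)
      then have "(\<Sum>i<c. card (K i)) + c \<le> c * c ^ m"
        unfolding sum.distrib by simp
      moreover have "c * c ^ m \<le> card S" using Suc.prems(3) Suc.hyps(2) by (metis power_Suc)
      ultimately show False using S c by linarith
    qed
    then obtain i where i: "i < c" "c ^ m \<le> card (K i)" by blast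
    define t' where "t' = t(i := t i - 1)"
    have "(\<Sum>j<c. t j) = t i + (\<Sum>j\<in>{..<c} - {i}. t j)"
      "(\<Sum>j<c. t' j) = t' i + (\<Sum>j\<in>{..<c} - {i}. t' j)"
      using i(1) by (intro sum.remove; simp)+
    moreover have "(\<Sum>j\<in>{..<c} - {i}. t' j) = (\<Sum>j\<in>{..<c} - {i}. t j)"
      by (intro sum.cong) (auto simp: t'_def)
    moreover have "t i \<noteq> 0" "t' i = t i - 1" using False i(1) by (auto simp: t'_def)
    ultimately have m: "m = (\<Sum>j<c. t' j)" using Suc.hyps(2) by linarith
    have "\<exists>j<c. \<exists>T\<subseteq>K i. t' j \<le> card T \<and> (\<forall>z\<in>T. \<forall>w\<in>T. z \<noteq> w \<longrightarrow> f z w = j)"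
    proof (rule Suc.hyps(1)[OF m K(3)])
      show "f z w < c" if "z \<in> K i" "w \<in> K i" "z \<noteq> w" for z w
        using that K(1)[of i] by (intro Suc.prems(2)) auto
    qed (use i(2) m in simp)
    then obtain j T where j: "j < c" and T: "T \<subseteq> K i" "t' j \<le> card T"
      "\<forall>z\<in>T. \<forall>w\<in>T. z \<noteq> w \<longrightarrow> f z w = j" by blast
    show ?thesis
    proof (cases "j = i")
      case True
      have "finite T" "x \<notin> T" using finite_subset[OF T(1) K(3)] T(1) K(2) by auto
      then have "t i \<le> card (insert x T)" using T(2) True by (simp add: t'_def)
      moreover have "f x w = i" "f w x = i" if "w \<in> T" for w
        using T(1) that sym unfolding K_def by auto
      then have "\<forall>z\<in>insert x T. \<forall>w\<in>insert x T. z \<noteq> w \<longrightarrow> f z w = i"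
        using T(3) True by auto
      moreover have "insert x T \<subseteq> S" using T(1) K(1) x by blast
      ultimately show ?thesis using i(1) by blast
    next
      case False
      then have "t j \<le> card T" using T(2) by (simp add: t'_def)
      then show ?thesis using j T K(1) by blast
    qed
  qed
qed

lemma monochromatic_subset:
  fixes f :: "'a \<Rightarrow> 'a \<Rightarrow> nat"
  assumes "2 \<le> c" "\<And>z w. f z w = f w z" "finite S"
    "\<And>z w. z \<in> S \<Longrightarrow> w \<in> S \<Longrightarrow> z \<noteq> w \<Longrightarrow> f z w < c" "c ^ (c * t) \<le> card S"
  obtains i T where "T \<subseteq> S" "card T = t" "\<forall>z\<in>T. \<forall>w\<in>T. z \<noteq> w \<longrightarrow> f z w = i"
proof -
  have big: "c ^ (\<Sum>i<c. t) \<le> card S" using assms(5) by simp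
  have "\<exists>i<c. \<exists>T\<subseteq>S. t \<le> card T \<and> (\<forall>z\<in>T. \<forall>w\<in>T. z \<noteq> w \<longrightarrow> f z w = i)"
    by (rule multicolor_ramsey[where t="\<lambda>_. t"]; fact)
  then show thesis
  proof (elim exE conjE)
    fix i T assume T: "T \<subseteq> S" "t \<le> card T" "\<forall>z\<in>T. \<forall>w\<in>T. z \<noteq> w \<longrightarrow> f z w = i"
    obtain T' where T': "T' \<subseteq> T" "card T' = t" using obtain_subset_with_card_n[OF T(2)] by metis
    show thesis
    proof (rule that)
      show "T' \<subseteq> S" "card T' = t" using T(1) T' by auto
      show "\<forall>z\<in>T'. \<forall>w\<in>T'. z \<noteq> w \<longrightarrow> f z w = i" using T(3) T'(1) by blast
    qed
  qed
qed

text \<open>Values of one colour i share the interval from a^i to a^(i + 1), so a set of one colour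
  has distances within a factor a. This is used with a = \<alpha> for equilateral subspaces and with
  a slightly below k for triples.\<close>

lemma geometric_colour:
  fixes a v :: real
  assumes "1 < a" "1 \<le> v"
  shows "a ^ nat \<lfloor>log a v\<rfloor> \<le> v" "v \<le> a * a ^ nat \<lfloor>log a v\<rfloor>" "v < a ^ c \<Longrightarrow> nat \<lfloor>log a v\<rfloor> < c"
proof -
  define i where "i = nat \<lfloor>log a v\<rfloor>"
  have "0 \<le> log a v" using assms by simp
  then have i: "real i \<le> log a v" "log a v < real i + 1" unfolding i_def by linarith+
  have pow: "a powr real i = a ^ i" using assms by (simp add: powr_realpow)
  have "a powr real i \<le> v" using i(1) assms by (simp add: le_log_iff)
  then have "a ^ i \<le> v" unfolding pow .
  then show "a ^ nat \<lfloor>log a v\<rfloor> \<le> v" unfolding i_def .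
  have "v < a powr (real i + 1)" using i(2) assms by (simp add: log_less_iff)
  also have "\<dots> = a * a ^ i" using assms by (simp add: powr_add pow)
  finally show "v \<le> a * a ^ nat \<lfloor>log a v\<rfloor>" unfolding i_def by simp
  assume "v < a ^ c"
  then have "log a v < real c" using assms by (simp add: log_less_iff powr_realpow)
  then have "real i < real c" using i(1) by linarith
  then show "nat \<lfloor>log a v\<rfloor> < c" by (simp add: i_def)
qed

text \<open>Within a ball of radius u, a net of separation 2 * u / \<alpha> has diameter at most
  \<alpha> times its separation, hence at most t points. Each of the m rounds replaces every ball by
  t balls whose radius is multiplied by 2 / \<alpha>.\<close>

lemma ball_cover_of_no_equilateral:
  assumes M: "Metric_space M d" and fM: "finite M" and \<alpha>: "0 < \<alpha>" and s: "0 < s" and x: "x \<in> M"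
    and no: "\<And>T. T \<subseteq> M \<Longrightarrow> near_equilateral \<alpha> d T \<Longrightarrow> card T \<le> t"
  shows "\<exists>Y\<subseteq>M. card Y \<le> t ^ m \<and> (\<forall>z\<in>M. d x z \<le> s \<longrightarrow> (\<exists>y\<in>Y. d y z \<le> s * (2 / \<alpha>) ^ m))"
proof (induction m)
  case 0
  then show ?case using x by (intro exI[of _ "{x}"]) auto
next
  case (Suc m)
  interpret Metric_space M d by fact
  obtain Y where Y: "Y \<subseteq> M" "card Y \<le> t ^ m"
    "\<forall>z\<in>M. d x z \<le> s \<longrightarrow> (\<exists>y\<in>Y. d y z \<le> s * (2 / \<alpha>) ^ m)" using Suc.IH by blast
  define u where "u = s * (2 / \<alpha>) ^ m"
  have u: "0 < u" "0 < u * (2 / \<alpha>)" unfolding u_def using s \<alpha> by auto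
  have "\<exists>Z. Z \<subseteq> M \<and> card Z \<le> t \<and> (\<forall>z\<in>M. d y z \<le> u \<longrightarrow> (\<exists>w\<in>Z. d w z \<le> u * (2 / \<alpha>)))"
    if "y \<in> Y" for y
  proof -
    let ?Q = "{z \<in> M. d y z \<le> u}"
    obtain Z where Z: "Z \<subseteq> ?Q" "\<forall>z\<in>Z. \<forall>w\<in>Z. z \<noteq> w \<longrightarrow> u * (2 / \<alpha>) \<le> d z w"
      "\<forall>z\<in>?Q. \<exists>w\<in>Z. d w z < u * (2 / \<alpha>)"
      using net_exists[OF M _ _ u(2), of ?Q] fM by auto
    have "d z w \<le> \<alpha> * (u * (2 / \<alpha>))" if "z \<in> Z" "w \<in> Z" for z w
    proof -
      have "d z w \<le> d z y + d y w"
        using that Z(1) \<open>y \<in> Y\<close> Y(1) by (intro triangle) auto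
      moreover have "d z y \<le> u" "d y w \<le> u" using that Z(1) commute[of z y] by auto
      ultimately show ?thesis using \<alpha> by simp
    qed
    then have "near_equilateral \<alpha> d Z"
      unfolding near_equilateral_def using Z(2) u(2) by (intro exI[of _ "u * (2 / \<alpha>)"]) blast
    then have "card Z \<le> t" using no[of Z] Z(1) by blast
    moreover have "\<exists>w\<in>Z. d w z \<le> u * (2 / \<alpha>)" if "z \<in> M" "d y z \<le> u" for z
    proof -
      have "z \<in> ?Q" using that by simp
      from bspec[OF Z(3) this] obtain w where "w \<in> Z" "d w z < u * (2 / \<alpha>)" by (elim bexE)
      then show ?thesis by (intro bexI[of _ w]) auto
    qed
    moreover have "Z \<subseteq> M" using Z(1) by blast
    ultimately show ?thesis by blast
  qed
  then obtain Z where Z: "\<And>y. y \<in> Y \<Longrightarrow> Z y \<subseteq> M" "\<And>y. y \<in> Y \<Longrightarrow> card (Z y) \<le> t"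
    "\<And>y z. y \<in> Y \<Longrightarrow> z \<in> M \<Longrightarrow> d y z \<le> u \<Longrightarrow> \<exists>w\<in>Z y. d w z \<le> u * (2 / \<alpha>)"
    by metis
  have "finite Y" using Y(1) fM finite_subset by blast
  then have "card (\<Union>y\<in>Y. Z y) \<le> (\<Sum>y\<in>Y. card (Z y))" by (rule card_UN_le)
  also have "\<dots> \<le> card Y * t" using Z(2) by (intro sum_bounded_above[of Y _ t, simplified]) auto
  also have "\<dots> \<le> t ^ m * t" using Y(2) by (rule mult_le_mono1)
  finally have "card (\<Union>y\<in>Y. Z y) \<le> t ^ Suc m" by (simp add: mult.commute)
  moreover have "\<exists>w\<in>(\<Union>y\<in>Y. Z y). d w z \<le> s * (2 / \<alpha>) ^ Suc m" if "z \<in> M" "d x z \<le> s" for z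
  proof -
    obtain y where "y \<in> Y" "d y z \<le> u" using Y(3) \<open>z \<in> M\<close> \<open>d x z \<le> s\<close> unfolding u_def by blast
    then obtain w where "w \<in> Z y" "d w z \<le> u * (2 / \<alpha>)" using Z(3) \<open>z \<in> M\<close> by blast
    moreover have "u * (2 / \<alpha>) = s * (2 / \<alpha>) ^ Suc m" by (simp add: u_def)
    ultimately have "d w z \<le> s * (2 / \<alpha>) ^ Suc m" by (simp only:)
    then show ?thesis using \<open>y \<in> Y\<close> \<open>w \<in> Z y\<close> by blast
  qed
  ultimately show ?case using Z(1) by (intro exI[of _ "\<Union>y\<in>Y. Z y"]) blast
qed

text \<open>After m rounds the covering balls are too small to hold two points of S, so sending a
  point to its ball is injective.\<close>

lemma separated_card_doubling:
  fixes J :: real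
  assumes M: "Metric_space M d" and fM: "finite M" and \<alpha>: "0 < \<alpha>" and s: "0 < s" and x: "x \<in> M"
    and no: "\<And>T. T \<subseteq> M \<Longrightarrow> near_equilateral \<alpha> d T \<Longrightarrow> card T \<le> t"
    and m: "2 * (2 / \<alpha>) ^ m < 1 / J\<^sup>2"
    and S: "S \<subseteq> M" "\<forall>z\<in>S. d x z \<le> s" "\<forall>z\<in>S. \<forall>w\<in>S. z \<noteq> w \<longrightarrow> s / J\<^sup>2 \<le> d z w"
  shows "card S \<le> t ^ m"
proof -
  interpret Metric_space M d by fact
  obtain Y where Y: "Y \<subseteq> M" "card Y \<le> t ^ m"
    "\<forall>z\<in>M. d x z \<le> s \<longrightarrow> (\<exists>y\<in>Y. d y z \<le> s * (2 / \<alpha>) ^ m)"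
    using ball_cover_of_no_equilateral[OF M fM \<alpha> s x no, of m] by blast
  have "\<forall>z\<in>S. \<exists>y\<in>Y. d y z \<le> s * (2 / \<alpha>) ^ m" using Y(3) S(1,2) by blast
  then obtain h where h: "\<And>z. z \<in> S \<Longrightarrow> h z \<in> Y" "\<And>z. z \<in> S \<Longrightarrow> d (h z) z \<le> s * (2 / \<alpha>) ^ m"
    by metis
  have "inj_on h S"
  proof (rule inj_onI, rule ccontr)
    fix z w assume zw: "z \<in> S" "w \<in> S" "h z = h w" "z \<noteq> w"
    have "d z w \<le> d z (h z) + d (h z) w"
      using zw h(1) Y(1) S(1) by (intro triangle) auto
    also have "\<dots> \<le> s * (2 / \<alpha>) ^ m + s * (2 / \<alpha>) ^ m"
      using h(2)[OF zw(1)] h(2)[OF zw(2)] zw(3) commute[of z "h z"] by simp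
    also have "\<dots> = s * (2 * (2 / \<alpha>) ^ m)" by simp
    also have "\<dots> < s * (1 / J\<^sup>2)" using m s by (rule mult_strict_left_mono)
    finally show False using S(3) zw by force
  qed
  then have "card S \<le> card Y"
    using h(1) Y(1) fM finite_subset by (intro card_inj_on_le[of h]) auto
  then show ?thesis using Y(2) by simp
qed

text \<open>Distances in S range over a factor of at most 2 * \<open>J\<^sup>2\<close>, so c
  logarithmic colours suffice, and t + 1 points of one colour would be nearly equilateral.\<close>

lemma separated_card_ramsey:
  fixes J :: real
  assumes M: "Metric_space M d" and fM: "finite M" and \<alpha>: "1 < \<alpha>" and s: "0 < s" and x: "x \<in> M"
    and no: "\<And>T. T \<subseteq> M \<Longrightarrow> near_equilateral \<alpha> d T \<Longrightarrow> card T \<le> t"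
    and c: "2 \<le> c" "2 * J\<^sup>2 < \<alpha> ^ c" and J: "0 < J"
    and S: "S \<subseteq> M" "\<forall>z\<in>S. d x z \<le> s" "\<forall>z\<in>S. \<forall>w\<in>S. z \<noteq> w \<longrightarrow> s / J\<^sup>2 \<le> d z w"
  shows "card S \<le> c ^ (c * (t + 1))"
proof (rule ccontr)
  interpret Metric_space M d by fact
  assume "\<not> ?thesis"
  then have big: "c ^ (c * (t + 1)) \<le> card S" by simp
  define v where "v z w = d z w * J\<^sup>2 / s" for z w
  define f where "f z w = nat \<lfloor>log \<alpha> (v z w)\<rfloor>" for z w
  have v1: "1 \<le> v z w" if "z \<in> S" "w \<in> S" "z \<noteq> w" for z w
    unfolding v_def using S(3) that s J by (simp add: field_simps)
  have col: "f z w < c" if zw: "z \<in> S" "w \<in> S" "z \<noteq> w" for z w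
  proof -
    have "d z w \<le> d z x + d x w" using zw S(1) x by (intro triangle) auto
    moreover have "d x z \<le> s" "d x w \<le> s" using S(2) zw by auto
    ultimately have "d z w \<le> 2 * s" using commute[of z x] by linarith
    then have "v z w \<le> 2 * J\<^sup>2" unfolding v_def using s J by (simp add: divide_le_eq mult_mono)
    then show ?thesis unfolding f_def using geometric_colour(3)[OF \<alpha> v1[OF zw]] c(2) by simp
  qed
  have sym: "f z w = f w z" for z w unfolding f_def v_def by (simp add: commute)
  have "finite S" using S(1) fM finite_subset by blast
  obtain i T where T: "T \<subseteq> S" "card T = t + 1" "\<forall>z\<in>T. \<forall>w\<in>T. z \<noteq> w \<longrightarrow> f z w = i"
    by (rule monochromatic_subset[OF c(1) sym \<open>finite S\<close> col big])
  have "s / J\<^sup>2 * \<alpha> ^ i \<le> d z w \<and> d z w \<le> \<alpha> * (s / J\<^sup>2 * \<alpha> ^ i)" if "z \<in> T" "w \<in> T" "z \<noteq> w" for z w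
  proof -
    have "\<alpha> ^ i \<le> v z w" "v z w \<le> \<alpha> * \<alpha> ^ i"
      using geometric_colour(1,2)[OF \<alpha> v1[of z w]] T(1,3) that unfolding f_def by blast+
    moreover have "d z w = s / J\<^sup>2 * v z w" unfolding v_def using s J by simp
    ultimately show ?thesis
      using s J mult_left_mono[of "\<alpha> ^ i" "v z w" "s / J\<^sup>2"] mult_left_mono[of "v z w" "\<alpha> * \<alpha> ^ i" "s / J\<^sup>2"]
      by (simp add: mult_ac)
  qed
  moreover have "0 < s / J\<^sup>2 * \<alpha> ^ i" using s J \<alpha> by simp
  ultimately have "near_equilateral \<alpha> d T"
    unfolding near_equilateral_def by blast
  then show False using no[of T] T(1,2) S(1) by auto
qed

section \<open>Lower bounds\<close>

text \<open>The dichotomy common to both regimes: a nearly equilateral set of more than t points, or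
  nets bounded by l and hence a large HST. How l follows from t is left to the hypothesis
  \<open>sep\<close>.\<close>

lemma E_num_ge:
  fixes J l b :: real
  assumes k: "1 \<le> k" and \<alpha>: "1 < \<alpha>"
    and J: "4 \<le> J" "2 * \<alpha> * k \<le> J" "J + 2 \<le> \<alpha> * (J - 2)" and l: "1 \<le> l" and n: "1 \<le> n"
    and sep: "\<And>(M :: nat set) d x s S. Metric_space M d \<Longrightarrow> finite M \<Longrightarrow>
      (\<And>T. T \<subseteq> M \<Longrightarrow> near_equilateral \<alpha> d T \<Longrightarrow> card T \<le> t) \<Longrightarrow> x \<in> M \<Longrightarrow> 0 < s \<Longrightarrow> S \<subseteq> M \<Longrightarrow>
      (\<forall>z\<in>S. d x z \<le> s) \<Longrightarrow> (\<forall>z\<in>S. \<forall>w\<in>S. z \<noteq> w \<longrightarrow> s / J\<^sup>2 \<le> d z w) \<Longrightarrow> real (card S) \<le> l"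
    and b: "b \<le> real (t + 1)" "b \<le> real n powr (ln 2 / ln (4 * l))"
  shows "b \<le> real (E_num k \<alpha> n)"
  unfolding E_num_eq
proof (rule ramsey_num_ge)
  fix M :: "nat set" and d
  assume M: "Metric_space M d" and fM: "finite M" and card: "card M = n"
  show "\<exists>N\<subseteq>M. b \<le> real (card N) \<and> E_ok k \<alpha> d N"
  proof (cases "\<exists>T\<subseteq>M. near_equilateral \<alpha> d T \<and> t < card T")
    case True
    then obtain T where T: "T \<subseteq> M" "near_equilateral \<alpha> d T" "t < card T" by blast
    have "E_ok k \<alpha> d T"
      by (rule E_ok_near_equilateral[OF T(2) Metric_space.subspace[OF M T(1)]]) (use \<alpha> in simp)
    moreover have "b \<le> real (card T)" using b(1) T(3) by linarith
    ultimately show ?thesis using T(1) by blast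
  next
    case False
    then have no: "card T \<le> t" if "T \<subseteq> M" "near_equilateral \<alpha> d T" for T
      using that by (metis not_le)
    have "M \<noteq> {}" using card n by auto
    have "\<exists>N\<subseteq>M. (\<exists>D. near_hst k \<alpha> d N D) \<and> real (card M) powr (ln 2 / ln (4 * l)) \<le> real (card N)"
    proof (rule near_hst_subset_exists[OF M fM k \<alpha> J l _ refl subset_refl \<open>M \<noteq> {}\<close>])
      fix x s S
      assume *: "x \<in> M" "0 < s" "S \<subseteq> M" "\<forall>z\<in>S. d x z \<le> s" "\<forall>z\<in>S. \<forall>w\<in>S. z \<noteq> w \<longrightarrow> s / J\<^sup>2 \<le> d z w"
      show "real (card S) \<le> l"
        by (rule sep[OF M fM no *])
    qed
    then obtain N D where N: "N \<subseteq> M" "near_hst k \<alpha> d N D"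
      "real n powr (ln 2 / ln (4 * l)) \<le> real (card N)" unfolding card by blast
    have "E_ok k \<alpha> d N"
      by (rule E_ok_near_hst[OF N(2) Metric_space.subspace[OF M N(1)] k]) (use \<alpha> in simp)
    then show ?thesis using N(1,3) b(2) by (intro exI[of _ N]) auto
  qed
qed (rule E_ok_subset)

text \<open>The second condition makes labels decrease by the factor k and the third, equivalent to
  J \<ge> 2 * (\<alpha> + 1) / (\<alpha> - 1), keeps cross distances within the factor
  \<alpha>.\<close>

lemma scale_ratio_exists:
  fixes \<alpha> k :: real
  assumes "1 < \<alpha>"
  obtains J :: real where "4 \<le> J" "2 * \<alpha> * k \<le> J" "J + 2 \<le> \<alpha> * (J - 2)"
proof (rule that)
  define J where "J = max 4 (max (2 * \<alpha> * k) (2 * (\<alpha> + 1) / (\<alpha> - 1)))"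
  show "4 \<le> J" "2 * \<alpha> * k \<le> J" unfolding J_def by auto
  have "2 * (\<alpha> + 1) / (\<alpha> - 1) \<le> J" unfolding J_def by simp
  then have "2 * (\<alpha> + 1) \<le> J * (\<alpha> - 1)" using assms by (simp add: divide_le_eq)
  then show "J + 2 \<le> \<alpha> * (J - 2)" by (simp add: algebra_simps)
qed

lemma E_num_lower_large_distortion:
  fixes \<alpha> k :: real
  assumes k: "1 \<le> k" and \<alpha>: "2 < \<alpha>"
  shows "\<exists>c>0. \<forall>n\<ge>1. exp (c * sqrt (ln (real n))) \<le> real (E_num k \<alpha> n)"
proof -
  have \<alpha>1: "1 < \<alpha>" using \<alpha> by simp
  obtain J where J: "4 \<le> J" "2 * \<alpha> * k \<le> J" "J + 2 \<le> \<alpha> * (J - 2)"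
    using scale_ratio_exists[OF \<alpha>1] by blast
  have J0: "0 < 1 / (2 * J\<^sup>2)" using J by simp
  \<comment> \<open>Here \<alpha> > 2 is essential: only then do the rounds of the covering argument
    shrink the balls.\<close>
  obtain m where m: "(2 / \<alpha>) ^ m < 1 / (2 * J\<^sup>2)"
    using real_arch_pow_inv[OF J0, of "2 / \<alpha>"] \<alpha> by auto
  then have m': "2 * (2 / \<alpha>) ^ m < 1 / J\<^sup>2" by simp
  \<comment> \<open>For n \<ge> 2 the bound ln 2 \<le> L gives ln (4 * l) \<le> (2 * m + 2) * L,
    hence an exponent of at least c / L, while ln n = \<open>L\<^sup>2\<close>.\<close>
  define c where "c = ln 2 / (2 * real m + 2)"
  have c: "0 < c" "c \<le> 1" unfolding c_def using ln_2_less_1 by (auto simp: divide_le_eq)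
  have "exp (c * sqrt (ln (real n))) \<le> real (E_num k \<alpha> n)" if n: "1 \<le> n" for n
  proof -
    define L where "L = sqrt (ln (real n))"
    have L: "0 \<le> L" unfolding L_def using n by simp
    define t where "t = nat \<lceil>exp L\<rceil>"
    have t: "exp L \<le> real t" "real t \<le> exp L + 1" unfolding t_def using exp_gt_zero[of L] by linarith+
    have "1 \<le> exp L" using L by simp
    then have t1: "1 \<le> real t" "real t \<le> 2 * exp L" using t by linarith+
    define l where "l = real t ^ m"
    have l: "1 \<le> l" unfolding l_def using t1 by simp
    have "ln (4 * l) = ln (2 ^ 2) + real m * ln (real t)"
      unfolding l_def using t1 by (simp add: ln_mult ln_realpow)
    also have "\<dots> = 2 * ln 2 + real m * ln (real t)" by (subst ln_realpow) auto
    also have "ln (real t) \<le> ln (2 * exp L)" using t1 by (subst ln_le_cancel_iff) auto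
    also have "\<dots> = ln 2 + L" by (simp add: ln_mult)
    finally have lnl: "ln (4 * l) \<le> 2 * ln 2 + real m * (ln 2 + L)" by (simp add: mult_left_mono)
    have lnl0: "0 < ln (4 * l)" using l by simp
    have "exp (c * L) \<le> real n powr (ln 2 / ln (4 * l))"
    proof (cases "n = 1")
      case True
      then show ?thesis by (simp add: L_def)
    next
      case False
      have "ln 2 \<le> sqrt (ln 2)"
        by (rule real_le_rsqrt) (use ln_2_less_1 in \<open>simp add: power2_eq_square mult_left_le\<close>)
      also have "\<dots> \<le> L" unfolding L_def using False n by (subst real_sqrt_le_iff) (subst ln_le_cancel_iff, auto)
      finally have "ln 2 \<le> L" .
      then have L0: "0 < L" using ln_gt_zero[of "2 :: real"] by linarith
      have "real m * (ln 2 + L) \<le> real m * (2 * L)" using \<open>ln 2 \<le> L\<close> by (intro mult_left_mono) auto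
      then have "ln (4 * l) \<le> (2 * real m + 2) * L" using lnl \<open>ln 2 \<le> L\<close> by (simp add: algebra_simps)
      then have "c * L * ln (4 * l) \<le> c * L * ((2 * real m + 2) * L)"
        using c L by (intro mult_left_mono) auto
      also have "\<dots> = ln 2 * (L * L)" unfolding c_def by (simp add: field_simps)
      also have "L * L = ln (real n)" unfolding L_def using n by simp
      finally have "c * L \<le> ln 2 / ln (4 * l) * ln (real n)" using lnl0 by (simp add: le_divide_eq)
      then show ?thesis unfolding powr_def using n by simp
    qed
    moreover have "exp (c * L) \<le> real (t + 1)"
    proof -
      have "c * L \<le> 1 * L" using c L by (intro mult_right_mono) auto
      then have "exp (c * L) \<le> exp L" by simp
      then show ?thesis using t by linarith
    qed
    ultimately have "exp (c * L) \<le> real (E_num k \<alpha> n)"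
    proof (intro E_num_ge[OF k \<alpha>1 J l n, of t])
      fix M :: "nat set" and d x s S
      assume M: "Metric_space M d" "finite M" and
        no: "\<And>T. T \<subseteq> M \<Longrightarrow> near_equilateral \<alpha> d T \<Longrightarrow> card T \<le> t" and
        S: "x \<in> M" "0 < s" "S \<subseteq> M" "\<forall>z\<in>S. d x z \<le> s" "\<forall>z\<in>S. \<forall>w\<in>S. z \<noteq> w \<longrightarrow> s / J\<^sup>2 \<le> d z w"
      have "card S \<le> t ^ m"
        by (rule separated_card_doubling[OF M _ S(2,1) no m' S(3-5)]) (use \<alpha> in simp)
      then show "real (card S) \<le> l" unfolding l_def by (metis of_nat_le_iff of_nat_power)
    qed
    then show ?thesis unfolding L_def .
  qed
  then show ?thesis using c(1) by blast
qed

lemma E_num_lower_small_distortion: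
  fixes \<alpha> k :: real
  assumes k: "1 \<le> k" and \<alpha>: "1 < \<alpha>"
  shows "\<exists>c>0. \<forall>n\<ge>3. c * (ln (real n) / ln (ln (real n))) \<le> real (E_num k \<alpha> n)"
proof -
  obtain J where J: "4 \<le> J" "2 * \<alpha> * k \<le> J" "J + 2 \<le> \<alpha> * (J - 2)"
    using scale_ratio_exists[OF \<alpha>] by blast
  obtain q0 where q0: "2 * J\<^sup>2 < \<alpha> ^ q0" using real_arch_pow[OF \<alpha>] by blast
  define q where "q = max 2 q0"
  have "\<alpha> ^ q0 \<le> \<alpha> ^ q" unfolding q_def using \<alpha> by (intro power_increasing) auto
  then have q: "2 \<le> q" "2 * J\<^sup>2 < \<alpha> ^ q" using q0 by (auto simp: q_def)
  \<comment> \<open>Chosen so that ln (4 * l) \<le> t * B for l = q^(q * (t + 1)) and t \<ge> 1,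
    using t + 1 \<le> 2 * t.\<close>
  define B where "B = ln 4 + 2 * (real q * ln (real q))"
  have B: "0 < B" unfolding B_def using q(1) by (intro add_pos_nonneg) auto
  define a where "a = ln 2 / B"
  have a: "0 < a" unfolding a_def using B by simp
  have "ln (exp 1) < ln (3 :: real)"
    using e_less_272 by (subst ln_less_cancel_iff) auto
  then have ln3: "1 < ln (3 :: real)" by simp
  \<comment> \<open>The bound by a keeps the target below x. The bound by ln (ln 3) \<le> Y keeps it
    below X = ln n, the size guaranteed for the HST.\<close>
  define c where "c = min a (ln (ln 3))"
  have c: "0 < c" "c \<le> a" "c \<le> ln (ln 3)" unfolding c_def using a ln3 by auto
  have "c * (ln (real n) / ln (ln (real n))) \<le> real (E_num k \<alpha> n)" if n: "3 \<le> n" for n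
  proof -
    define X where "X = ln (real n)"
    define Y where "Y = ln X"
    have X: "ln 3 \<le> X" unfolding X_def using n by (subst ln_le_cancel_iff) auto
    then have Y: "ln (ln 3) \<le> Y" unfolding Y_def using ln3 by (subst ln_le_cancel_iff) auto
    have X1: "1 < X" using X ln3 by linarith
    have Y0: "0 < Y" unfolding Y_def using X1 by simp
    define x where "x = a * (X / Y)"
    have x0: "0 < x" unfolding x_def using a X1 Y0 by simp
    \<comment> \<open>With x = a * X / Y and a = ln 2 / B, the exponent at t \<le> x gives n powr
      (ln 2 / ln (4 * l)) \<ge> exp Y = ln n. The maximum with 1 matters only for small x, where the
      target is at most 1.\<close>
    define t where "t = max 1 (nat \<lfloor>x\<rfloor>)"
    have t: "1 \<le> t" "real t \<le> max 1 x" "x \<le> real t + 1" unfolding t_def using x0 by (auto simp: max_def) linarith+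
    define l where "l = real (q ^ (q * (t + 1)))"
    have l: "1 \<le> l" unfolding l_def using q(1) by simp
    have "ln (4 * l) = ln 4 + real (q * (t + 1)) * ln (real q)"
      unfolding l_def using q(1) by (simp add: ln_mult ln_realpow del: power_Suc)
    also have "\<dots> \<le> real t * ln 4 + 2 * real t * (real q * ln (real q))"
    proof (rule add_mono)
      show "ln 4 \<le> real t * ln 4" using t(1) by simp
      have "real (t + 1) \<le> 2 * real t" using t(1) by simp
      then have "real (t + 1) * (real q * ln (real q)) \<le> 2 * real t * (real q * ln (real q))"
        using q(1) by (intro mult_right_mono) auto
      moreover have "real (q * (t + 1)) * ln (real q) = real (t + 1) * (real q * ln (real q))"
        by (simp add: algebra_simps)
      ultimately show "real (q * (t + 1)) * ln (real q) \<le> 2 * real t * (real q * ln (real q))"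
        by (simp only:)
    qed
    also have "\<dots> = real t * B" unfolding B_def by (simp add: algebra_simps)
    finally have lnl: "ln (4 * l) \<le> real t * B" .
    have lnl0: "0 < ln (4 * l)" using l by simp
    have cx: "c * (X / Y) \<le> x" unfolding x_def using c X1 Y0 by (intro mult_right_mono) auto
    show ?thesis
      unfolding X_def[symmetric] Y_def[symmetric]
    proof (rule E_num_ge[OF k \<alpha> J l, of n t])
      show "c * (X / Y) \<le> real (t + 1)" using cx t(3) by simp
      show "c * (X / Y) \<le> real n powr (ln 2 / ln (4 * l))"
      proof (cases "x \<le> 1")
        case True
        have "1 \<le> real n powr (ln 2 / ln (4 * l))" using n lnl0 by (intro ge_one_powr_ge_zero) auto
        then show ?thesis using cx True by linarith
      next
        case False
        then have "real t \<le> x" using t(2) by simp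
        then have "ln (4 * l) \<le> x * B" using lnl B by (meson mult_right_mono less_imp_le order_trans)
        then have "Y * ln (4 * l) \<le> Y * (x * B)" using Y0 by simp
        also have "\<dots> = ln 2 * X" unfolding x_def a_def using Y0 B by simp
        finally have "Y \<le> ln 2 / ln (4 * l) * X" using lnl0 by (simp add: le_divide_eq)
        then have "exp Y \<le> real n powr (ln 2 / ln (4 * l))"
          unfolding powr_def X_def using n by simp
        moreover have "exp Y = X" unfolding Y_def using X1 by simp
        moreover have "c * (X / Y) \<le> X"
        proof -
          have "c * X \<le> Y * X" using c(3) Y X1 by (intro mult_right_mono) auto
          then show ?thesis using Y0 by (simp add: divide_le_eq mult.commute)
        qed
        ultimately show ?thesis by simp
      qed
      fix M :: "nat set" and d x s S
      assume M: "Metric_space M d" "finite M" and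
        no: "\<And>T. T \<subseteq> M \<Longrightarrow> near_equilateral \<alpha> d T \<Longrightarrow> card T \<le> t" and
        S: "x \<in> M" "0 < s" "S \<subseteq> M" "\<forall>z\<in>S. d x z \<le> s" "\<forall>z\<in>S. \<forall>w\<in>S. z \<noteq> w \<longrightarrow> s / J\<^sup>2 \<le> d z w"
      have "card S \<le> q ^ (q * (t + 1))"
        by (rule separated_card_ramsey[OF M \<alpha> S(2,1) no q _ S(3-5)]) (use J(1) in auto)
      then show "real (card S) \<le> l" unfolding l_def by simp
    qed (use n in simp)
  qed
  then show ?thesis using c(1) by blast
qed

section \<open>Spaces without nearly equilateral triples\<close>

text \<open>An equilateral Z gives the first alternative. Otherwise, if T has distances within a
  factor 2, its image has distances within 2 * \<alpha>, hence q colours to base k0. Ramsey's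
  theorem for sets of size 3 would give a triple of one colour, with \<open>c_eq\<close> at most k0
  < k.\<close>

lemma F_ok_cases:
  fixes k0 :: real
  assumes ok: "F_ok k \<alpha> d N" and N: "Metric_space N d" and \<alpha>: "0 < \<alpha>"
    and k0: "1 < k0" "k0 < k" and q: "2 \<le> q" "2 * \<alpha> < k0 ^ q"
  shows "(\<forall>x\<in>N. \<forall>y\<in>N. \<forall>z\<in>N. \<forall>w\<in>N. x \<noteq> y \<longrightarrow> z \<noteq> w \<longrightarrow> d z w \<le> \<alpha> * d x y) \<or>
    (\<forall>T. finite T \<longrightarrow> T \<subseteq> N \<longrightarrow>
      (\<forall>x\<in>T. \<forall>y\<in>T. \<forall>z\<in>T. \<forall>w\<in>T. x \<noteq> y \<longrightarrow> z \<noteq> w \<longrightarrow> d z w \<le> 2 * d x y) \<longrightarrow> card T \<le> q ^ (q * 3))"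
proof -
  obtain Z :: "nat set" and e f where Z: "Metric_space Z e"
    and cases: "equilateral Z e \<or> (\<forall>S\<subseteq>Z. finite S \<and> 3 \<le> card S \<longrightarrow> ennreal k \<le> c_eq S e)"
    and f: "bij_betw f N Z" "distortion N d e f \<le> ennreal \<alpha>"
    using ok unfolding F_ok_def equivalent_spaces_def by blast
  interpret N: Metric_space N d by fact
  interpret Z: Metric_space Z e by fact
  have fN: "inj_on f N" "f ` N \<subseteq> Z" using f(1) by (auto simp: bij_betw_def)
  have cross: "e (f x) (f y) * d z w \<le> \<alpha> * d x y * e (f z) (f w)"
    if "x \<in> N" "y \<in> N" "x \<noteq> y" "z \<in> N" "w \<in> N" "z \<noteq> w" for x y z w
    by (rule distortion_cross[OF N Z fN(2,1) f(2) _ that]) (use \<alpha> in simp)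
  have epos: "0 < e (f x) (f y)" if "x \<in> N" "y \<in> N" "x \<noteq> y" for x y
    using that fN by (subst Z.mdist_pos_eq) (auto simp: inj_on_def)
  from cases show ?thesis
  proof
    assume "equilateral Z e"
    then obtain c where c: "\<forall>x\<in>Z. \<forall>y\<in>Z. x \<noteq> y \<longrightarrow> e x y = c"
      unfolding equilateral_def by blast
    have "d z w \<le> \<alpha> * d x y" if xy: "x \<in> N" "y \<in> N" "x \<noteq> y" and zw: "z \<in> N" "w \<in> N" "z \<noteq> w" for x y z w
    proof -
      have "f x \<in> Z" "f y \<in> Z" "f x \<noteq> f y" "f z \<in> Z" "f w \<in> Z" "f z \<noteq> f w"
        using xy zw fN by (auto simp: inj_on_def)
      then have "e (f x) (f y) = c" "e (f z) (f w) = c" using c by blast+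
      then show ?thesis
        using cross[OF xy zw] epos[OF xy] by (simp add: mult.commute)
    qed
    then show ?thesis by blast
  next
    assume tri: "\<forall>S\<subseteq>Z. finite S \<and> 3 \<le> card S \<longrightarrow> ennreal k \<le> c_eq S e"
    have "card T \<le> q ^ (q * 3)" if fT: "finite T" and TN: "T \<subseteq> N"
      and asp: "\<forall>x\<in>T. \<forall>y\<in>T. \<forall>z\<in>T. \<forall>w\<in>T. x \<noteq> y \<longrightarrow> z \<noteq> w \<longrightarrow> d z w \<le> 2 * d x y" for T
    proof (rule ccontr)
      assume "\<not> ?thesis"
      then have big: "q ^ (q * 3) \<le> card T" and big': "1 < card T"
        using q(1) one_le_power[of q "q * 3"] by linarith+
      define P where "P = {(x, y). x \<in> T \<and> y \<in> T \<and> x \<noteq> y}"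
      have "P \<subseteq> T \<times> T" unfolding P_def by auto
      then have fP: "finite P" using fT by (meson finite_SigmaI finite_subset)
      obtain x0 y0 where "x0 \<in> T" "y0 \<in> T" "x0 \<noteq> y0"
        using big' fT by (metis One_nat_def card_le_Suc0_iff_eq not_le)
      then have "P \<noteq> {}" unfolding P_def by blast
      \<comment> \<open>Dividing by the least image distance makes all ratios at least 1, as the
        logarithmic colours require.\<close>
      define e0 where "e0 = Min ((\<lambda>(x, y). e (f x) (f y)) ` P)"
      have "e0 \<in> (\<lambda>(x, y). e (f x) (f y)) ` P"
        unfolding e0_def using fP \<open>P \<noteq> {}\<close> by (intro Min_in) auto
      then obtain a b where ab: "a \<in> T" "b \<in> T" "a \<noteq> b" "e0 = e (f a) (f b)"
        unfolding P_def by auto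
      have e0: "0 < e0" using ab epos TN by auto
      have min: "e0 \<le> e (f x) (f y)" if "x \<in> T" "y \<in> T" "x \<noteq> y" for x y
        unfolding e0_def using fP that by (intro Min_le) (auto simp: P_def)
      have max: "e (f x) (f y) \<le> 2 * \<alpha> * e0" if xy: "x \<in> T" "y \<in> T" "x \<noteq> y" for x y
      proof -
        have xyN: "x \<in> N" "y \<in> N" "a \<in> N" "b \<in> N" using xy ab TN by auto
        have dab: "0 < d a b" using xyN ab by (subst N.mdist_pos_eq) auto
        have "e (f x) (f y) * d a b \<le> \<alpha> * d x y * e0"
          using cross[OF xyN(1,2) xy(3) xyN(3,4) ab(3)] ab(4) by simp
        also have "\<dots> \<le> \<alpha> * (2 * d a b) * e0"
          using asp ab xy \<alpha> e0 by (intro mult_right_mono mult_left_mono) auto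
        also have "\<dots> = (2 * \<alpha> * e0) * d a b" by simp
        finally show ?thesis using dab by simp
      qed
      define v where "v x y = e (f x) (f y) / e0" for x y
      define col where "col x y = nat \<lfloor>log k0 (v x y)\<rfloor>" for x y
      have v1: "1 \<le> v x y" if "x \<in> T" "y \<in> T" "x \<noteq> y" for x y
        unfolding v_def using min[OF that] e0 by simp
      have colq: "col x y < q" if "x \<in> T" "y \<in> T" "x \<noteq> y" for x y
      proof -
        have "v x y \<le> 2 * \<alpha>" unfolding v_def using max[OF that] e0 by (simp add: divide_le_eq)
        then show ?thesis unfolding col_def using geometric_colour(3)[OF k0(1) v1[OF that]] q(2) by simp
      qed
      have sym: "col x y = col y x" for x y unfolding col_def v_def by (simp add: Z.commute)
      obtain i U where U: "U \<subseteq> T" "card U = 3" "\<forall>x\<in>U. \<forall>y\<in>U. x \<noteq> y \<longrightarrow> col x y = i"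
        by (rule monochromatic_subset[OF q(1) sym fT colq big])
      have UN: "U \<subseteq> N" using U(1) TN by blast
      then have "card (f ` U) = 3" using U(2) fN(1) card_image inj_on_subset by metis
      moreover have fUZ: "f ` U \<subseteq> Z" using UN fN(2) by blast
      moreover have "finite (f ` U)" using U(1) fT finite_subset by blast
      ultimately have ge: "ennreal k \<le> c_eq (f ` U) e" using tri by simp
      have "c_eq (f ` U) e \<le> ennreal (k0 * (e0 * k0 ^ i) / (e0 * k0 ^ i))"
      proof (rule c_eq_le[OF Metric_space.subspace[OF Z fUZ]])
        fix x' y' assume "x' \<in> f ` U" "y' \<in> f ` U" "x' \<noteq> y'"
        then obtain x y where xy: "x' = f x" "y' = f y" "x \<in> U" "y \<in> U" "x \<noteq> y" by blast
        have "k0 ^ i \<le> v x y" "v x y \<le> k0 * k0 ^ i"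
          using geometric_colour(1,2)[OF k0(1) v1[of x y]] U(1,3) xy unfolding col_def by blast+
        then show "e0 * k0 ^ i \<le> e x' y' \<and> e x' y' \<le> k0 * (e0 * k0 ^ i)"
          unfolding v_def xy(1,2) using e0 by (simp add: le_divide_eq divide_le_eq mult_ac)
      qed (use e0 k0 in auto)
      also have "k0 * (e0 * k0 ^ i) / (e0 * k0 ^ i) = k0" using e0 k0 by simp
      finally have "ennreal k \<le> ennreal k0" using ge by (rule order_trans[rotated])
      then show False using k0 by (simp add: ennreal_le_iff)
    qed
    then show ?thesis by blast
  qed
qed

section \<open>Spaces of words\<close>

text \<open>Only words of equal length matter; \<open>min\<close> makes the function symmetric for
  all words. The exponent is the number of letters after the first difference.\<close>

fun word_dist :: "real \<Rightarrow> (nat \<Rightarrow> nat \<Rightarrow> real) \<Rightarrow> nat list \<Rightarrow> nat list \<Rightarrow> real" where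
  "word_dist K g [] ys = 0"
| "word_dist K g (a # xs) [] = 0"
| "word_dist K g (a # xs) (b # ys) =
    (if a = b then word_dist K g xs ys else K ^ min (length xs) (length ys) * g a b)"

definition words :: "nat \<Rightarrow> nat \<Rightarrow> nat list set" where
  "words D h = {xs. set xs \<subseteq> {..<D} \<and> length xs = h}"

lemma finite_words: "finite (words D h)"
  unfolding words_def by (rule finite_lists_length_eq) simp

lemma card_words: "card (words D h) = D ^ h"
  unfolding words_def by (subst card_lists_length_eq) auto

text \<open>The values 1 and 2 satisfy the triangle inequality in any pattern, so g may encode an
  arbitrary graph.\<close>

locale word_space =
  fixes K :: real and g :: "nat \<Rightarrow> nat \<Rightarrow> real"
  assumes K: "1 \<le> K" and g_range: "g a b = 1 \<or> g a b = 2" and g_sym: "g a b = g b a"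
begin

lemma g_bounds: "1 \<le> g a b" "g a b \<le> 2"
  using g_range[of a b] by auto

lemma word_dist_nonneg: "0 \<le> word_dist K g xs ys"
  using K g_bounds(1) by (induction K g xs ys rule: word_dist.induct) (auto intro!: mult_nonneg_nonneg intro: order_trans[OF zero_le_one])

lemma word_dist_commute: "word_dist K g xs ys = word_dist K g ys xs"
proof (induction xs arbitrary: ys)
  case Nil
  then show ?case by (cases ys) auto
next
  case (Cons a xs)
  then show ?case using g_sym by (cases ys) (auto simp: min.commute)
qed

lemma word_dist_self: "word_dist K g xs xs = 0"
  by (induction xs) auto

lemma word_dist_zero: "length xs = length ys \<Longrightarrow> word_dist K g xs ys = 0 \<Longrightarrow> xs = ys"
proof (induction xs ys rule: list_induct2)
  case (Cons a xs b ys)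
  have "K ^ min (length xs) (length ys) * g a b \<noteq> 0"
    using K g_bounds(1)[of a b] by auto
  then show ?case using Cons by (auto split: if_splits)
qed simp

lemma word_dist_le: "length xs = h \<Longrightarrow> length ys = h \<Longrightarrow> word_dist K g xs ys \<le> 2 * K ^ (h - 1)"
proof (induction h arbitrary: xs ys)
  case (Suc h)
  obtain a xs' b ys' where eq: "xs = a # xs'" "ys = b # ys'" "length xs' = h" "length ys' = h"
    using Suc.prems by (metis length_Suc_conv)
  have "K ^ (h - 1) \<le> K ^ h" using K by (intro power_increasing) auto
  moreover have "word_dist K g xs' ys' \<le> 2 * K ^ (h - 1)" by (rule Suc.IH[OF eq(3,4)])
  moreover have "K ^ h * g a b \<le> K ^ h * 2" using K g_bounds(2)[of a b] by (intro mult_left_mono) auto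
  ultimately show ?case using eq by simp
qed simp

lemma word_dist_triangle:
  "length xs = h \<Longrightarrow> length ys = h \<Longrightarrow> length zs = h \<Longrightarrow>
    word_dist K g xs zs \<le> word_dist K g xs ys + word_dist K g ys zs"
proof (induction h arbitrary: xs ys zs)
  case (Suc h)
  obtain a xs' where x: "xs = a # xs'" "length xs' = h" using Suc.prems(1) by (metis length_Suc_conv)
  obtain b ys' where y: "ys = b # ys'" "length ys' = h" using Suc.prems(2) by (metis length_Suc_conv)
  obtain c zs' where z: "zs = c # zs'" "length zs' = h" using Suc.prems(3) by (metis length_Suc_conv)
  have Kh: "0 \<le> K ^ h" using K by simp
  have up: "word_dist K g xs zs \<le> 2 * K ^ h" using word_dist_le[of xs "Suc h" zs] Suc.prems by simp
  show ?case
  proof (cases "a = b \<or> b = c")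
    case True
    show ?thesis
    proof (cases "a = c")
      case True
      with \<open>a = b \<or> b = c\<close> show ?thesis using Suc.IH[OF x(2) y(2) z(2)] x y z by auto
    next
      case False
      with \<open>a = b \<or> b = c\<close> show ?thesis using x y z word_dist_nonneg by auto
    qed
  next
    case False
    \<comment> \<open>When b differs from both a and c, each summand is at least K^h, and no
      distance exceeds 2 * K^h.\<close>
    have "K ^ h * 1 \<le> K ^ h * g a b" "K ^ h * 1 \<le> K ^ h * g b c"
      using Kh g_bounds(1) by (intro mult_left_mono; simp)+
    then have "K ^ h \<le> word_dist K g xs ys" "K ^ h \<le> word_dist K g ys zs" using False x y z by auto
    then show ?thesis using up by linarith
  qed
qed simp

lemma word_metric:
  assumes "W \<subseteq> words D h"
  shows "Metric_space W (word_dist K g)"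
proof
  have len: "length x = h" if "x \<in> W" for x using that assms by (auto simp: words_def)
  show "0 \<le> word_dist K g x y" "word_dist K g x y = word_dist K g y x" for x y
    by (rule word_dist_nonneg, rule word_dist_commute)
  show "word_dist K g x y = 0 \<longleftrightarrow> x = y" if "x \<in> W" "y \<in> W" for x y
    using word_dist_zero[of x y] word_dist_self len that by auto
  show "word_dist K g x z \<le> word_dist K g x y + word_dist K g y z"
    if "x \<in> W" "y \<in> W" "z \<in> W" for x y z
    by (rule word_dist_triangle[of _ h]) (use len that in auto)
qed

lemma word_dist_hd:
  assumes "x \<in> words D (Suc h)" "y \<in> words D (Suc h)"
  shows "hd x = hd y \<Longrightarrow> word_dist K g x y = word_dist K g (tl x) (tl y)"
    and "hd x \<noteq> hd y \<Longrightarrow> word_dist K g x y = K ^ h * g (hd x) (hd y)"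
  using assms unfolding words_def by (cases x; cases y; simp)+

lemma words_tl: "x \<in> words D (Suc h) \<Longrightarrow> tl x \<in> words D h \<and> hd x < D \<and> x = hd x # tl x"
  unfolding words_def by (cases x) auto

text \<open>Two words that differ at once are at distance at least K^h, two with the same first
  letter at most 2 * K^(h - 1). As 2 * \<alpha> < K, both cannot occur in T: either the first
  letters are pairwise distinct and \<open>g\<close> applies to them, or they all agree and can be
  removed.\<close>

lemma card_near_equilateral_words:
  assumes \<alpha>: "0 \<le> \<alpha>" "2 * \<alpha> < K" and L: "1 \<le> L"
    and g: "\<And>A. A \<subseteq> {..<D} \<Longrightarrow>
      (\<forall>a\<in>A. \<forall>b\<in>A. \<forall>c\<in>A. \<forall>e\<in>A. a \<noteq> b \<longrightarrow> c \<noteq> e \<longrightarrow> g c e \<le> \<alpha> * g a b) \<Longrightarrow> card A \<le> L"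
  shows "T \<subseteq> words D h \<Longrightarrow>
    (\<forall>x\<in>T. \<forall>y\<in>T. \<forall>z\<in>T. \<forall>w\<in>T. x \<noteq> y \<longrightarrow> z \<noteq> w \<longrightarrow> word_dist K g z w \<le> \<alpha> * word_dist K g x y) \<Longrightarrow>
    card T \<le> L"
proof (induction h arbitrary: T)
  case 0
  then have "T \<subseteq> {[]}" by (auto simp: words_def)
  then have "card T \<le> 1" using card_mono[of "{[] :: nat list}" T] by simp
  then show ?case using L by simp
next
  case (Suc h)
  have W: "x \<in> words D (Suc h)" if "x \<in> T" for x using that Suc.prems(1) by blast
  have Kh: "0 < K ^ h" using K by simp
  show ?case
  proof (cases "\<exists>x\<in>T. \<exists>y\<in>T. hd x \<noteq> hd y")
    case True
    then obtain x y where xy: "x \<in> T" "y \<in> T" "hd x \<noteq> hd y" by blast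
    have inj: "inj_on hd T"
    proof (rule inj_onI, rule ccontr)
      fix z w assume zw: "z \<in> T" "w \<in> T" "hd z = hd w" "z \<noteq> w"
      then have tl: "tl z \<noteq> tl w"
        using words_tl[OF W[OF zw(1)]] words_tl[OF W[OF zw(2)]] by metis
      moreover have len: "length (tl z) = h" "length (tl w) = h"
        using words_tl[OF W[OF zw(1)]] words_tl[OF W[OF zw(2)]] by (auto simp: words_def)
      \<comment> \<open>Distinct tails are nonempty, so h - 1 is not truncated.\<close>
      ultimately have "h \<noteq> 0" by (metis length_0_conv)
      then have Kh1: "K ^ h = K * K ^ (h - 1)" by (simp add: power_eq_if)
      have "K ^ h * 1 \<le> word_dist K g x y"
        unfolding word_dist_hd(2)[OF W[OF xy(1)] W[OF xy(2)] xy(3)]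
        using Kh g_bounds(1) by (intro mult_left_mono) auto
      also have "\<dots> \<le> \<alpha> * word_dist K g z w"
        by (rule Suc.prems(2)[rule_format, OF zw(1,2) xy(1,2) zw(4)]) (use xy(3) in auto)
      also have "\<dots> \<le> \<alpha> * (2 * K ^ (h - 1))"
        unfolding word_dist_hd(1)[OF W[OF zw(1)] W[OF zw(2)] zw(3)]
        using \<alpha> word_dist_le[OF len] by (intro mult_left_mono) auto
      also have "\<dots> = 2 * \<alpha> * K ^ (h - 1)" by simp
      also have "\<dots> < K * K ^ (h - 1)" using \<alpha>(2) K by (intro mult_strict_right_mono) auto
      finally show False using Kh1 by simp
    qed
    have "card (hd ` T) \<le> L"
    proof (rule g)
      show "hd ` T \<subseteq> {..<D}" using words_tl W by blast
      show "\<forall>a\<in>hd ` T. \<forall>b\<in>hd ` T. \<forall>c\<in>hd ` T. \<forall>e\<in>hd ` T. a \<noteq> b \<longrightarrow> c \<noteq> e \<longrightarrow> g c e \<le> \<alpha> * g a b"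
      proof (intro ballI impI, elim imageE)
        fix a b c e x y z w
        assume *: "a \<noteq> b" "c \<noteq> e" "a = hd x" "b = hd y" "c = hd z" "e = hd w" "x \<in> T" "y \<in> T" "z \<in> T" "w \<in> T"
        then have "x \<noteq> y" "z \<noteq> w" by auto
        then have "word_dist K g z w \<le> \<alpha> * word_dist K g x y"
          by (rule Suc.prems(2)[rule_format, OF *(7-10)])
        then have "K ^ h * g c e \<le> \<alpha> * (K ^ h * g a b)"
          using word_dist_hd(2)[OF W W, of x y] word_dist_hd(2)[OF W W, of z w] * by simp
        then have "K ^ h * g c e \<le> K ^ h * (\<alpha> * g a b)" by (simp add: mult_ac)
        then show "g c e \<le> \<alpha> * g a b" using Kh by simp
      qed
    qed
    then show ?thesis using inj by (simp add: card_image)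
  next
    case False
    then have same: "hd x = hd y" if "x \<in> T" "y \<in> T" for x y using that by blast
    have "inj_on tl T"
      by (rule inj_onI) (metis same W words_tl)
    then have "card T = card (tl ` T)" by (simp add: card_image)
    also have "\<dots> \<le> L"
    proof (rule Suc.IH)
      show "tl ` T \<subseteq> words D h" using words_tl W by blast
      show "\<forall>x\<in>tl ` T. \<forall>y\<in>tl ` T. \<forall>z\<in>tl ` T. \<forall>w\<in>tl ` T. x \<noteq> y \<longrightarrow> z \<noteq> w \<longrightarrow>
          word_dist K g z w \<le> \<alpha> * word_dist K g x y"
      proof (intro ballI impI, elim imageE)
        fix a b c e x y z w
        assume *: "a \<noteq> b" "c \<noteq> e" "a = tl x" "b = tl y" "c = tl z" "e = tl w" "x \<in> T" "y \<in> T" "z \<in> T" "w \<in> T"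
        then have "x \<noteq> y" "z \<noteq> w" by auto
        then have "word_dist K g z w \<le> \<alpha> * word_dist K g x y"
          by (rule Suc.prems(2)[rule_format, OF *(7-10)])
        then show "word_dist K g c e \<le> \<alpha> * word_dist K g a b"
          using word_dist_hd(1)[OF W W same, of x y] word_dist_hd(1)[OF W W same, of z w] * by simp
      qed
    qed
    finally show ?thesis .
  qed
qed

text \<open>One representative for each first letter gives distances between K^h and 2 * K^h, so at
  most R letters occur. The words with a fixed first letter are counted by induction on their
  tails.\<close>

lemma card_words_bounded_branching:
  assumes R: "1 \<le> R"
  shows "T \<subseteq> words D h \<Longrightarrow>
    (\<And>U. U \<subseteq> T \<Longrightarrow> (\<forall>x\<in>U. \<forall>y\<in>U. \<forall>z\<in>U. \<forall>w\<in>U. x \<noteq> y \<longrightarrow> z \<noteq> w \<longrightarrow>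
      word_dist K g z w \<le> 2 * word_dist K g x y) \<Longrightarrow> card U \<le> R) \<Longrightarrow> card T \<le> R ^ h"
proof (induction h arbitrary: T)
  case 0
  then have "T \<subseteq> {[]}" by (auto simp: words_def)
  then show ?case using card_mono[of "{[] :: nat list}" T] by simp
next
  case (Suc h)
  have W: "x \<in> words D (Suc h)" if "x \<in> T" for x using that Suc.prems(1) by blast
  have fT: "finite T" using Suc.prems(1) finite_words finite_subset by blast
  have Kh: "0 \<le> K ^ h" using K by simp
  define rep where "rep = inv_into T hd"
  have rep: "rep a \<in> T" "hd (rep a) = a" if "a \<in> hd ` T" for a
    unfolding rep_def using that by (rule inv_into_into, rule f_inv_into_f)
  have "card (rep ` hd ` T) \<le> R"
  proof (rule Suc.prems(2))
    show "rep ` hd ` T \<subseteq> T" using rep(1) by blast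
    have bounds: "K ^ h \<le> word_dist K g (rep a) (rep b) \<and> word_dist K g (rep a) (rep b) \<le> 2 * K ^ h"
      if "a \<in> hd ` T" "b \<in> hd ` T" "rep a \<noteq> rep b" for a b
    proof -
      have "a \<noteq> b" using that(3) by auto
      then have "word_dist K g (rep a) (rep b) = K ^ h * g a b"
        using word_dist_hd(2)[OF W W, of "rep a" "rep b"] rep that(1,2) by simp
      moreover have "K ^ h * 1 \<le> K ^ h * g a b" "K ^ h * g a b \<le> K ^ h * 2"
        using Kh g_bounds by (intro mult_left_mono; simp)+
      ultimately show ?thesis by simp
    qed
    show "\<forall>x\<in>rep ` hd ` T. \<forall>y\<in>rep ` hd ` T. \<forall>z\<in>rep ` hd ` T. \<forall>w\<in>rep ` hd ` T.
        x \<noteq> y \<longrightarrow> z \<noteq> w \<longrightarrow> word_dist K g z w \<le> 2 * word_dist K g x y"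
    proof (intro ballI impI)
      fix x y z w assume "x \<in> rep ` hd ` T" "y \<in> rep ` hd ` T" "z \<in> rep ` hd ` T" "w \<in> rep ` hd ` T"
        "x \<noteq> y" "z \<noteq> w"
      then have "K ^ h \<le> word_dist K g x y" "word_dist K g z w \<le> 2 * K ^ h" using bounds by blast+
      then show "word_dist K g z w \<le> 2 * word_dist K g x y" by linarith
    qed
  qed
  moreover have "inj_on rep (hd ` T)" by (rule inj_onI) (metis rep(2))
  ultimately have hds: "card (hd ` T) \<le> R" by (simp add: card_image)
  have fibre: "card {x \<in> T. hd x = a} \<le> R ^ h" for a
  proof -
    let ?F = "{x \<in> T. hd x = a}"
    have cons: "x = a # tl x" if "x \<in> ?F" for x using that words_tl W by blast
    have "inj_on tl ?F" by (rule inj_onI) (metis cons)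
    then have "card ?F = card (tl ` ?F)" by (simp add: card_image)
    also have "\<dots> \<le> R ^ h"
    proof (rule Suc.IH)
      show "tl ` ?F \<subseteq> words D h" using words_tl W by blast
      fix U assume U: "U \<subseteq> tl ` ?F" and asp: "\<forall>x\<in>U. \<forall>y\<in>U. \<forall>z\<in>U. \<forall>w\<in>U. x \<noteq> y \<longrightarrow> z \<noteq> w \<longrightarrow>
        word_dist K g z w \<le> 2 * word_dist K g x y"
      have "(#) a ` U \<subseteq> T"
      proof
        fix x assume "x \<in> (#) a ` U"
        then obtain y where "y \<in> ?F" "x = a # tl y" using U by auto
        then show "x \<in> T" using cons[of y] by simp
      qed
      then have "card ((#) a ` U) \<le> R"
        by (rule Suc.prems(2)) (use asp in auto)
      then show "card U \<le> R" by (simp add: card_image)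
    qed
    finally show ?thesis .
  qed
  have "T = (\<Union>a\<in>hd ` T. {x \<in> T. hd x = a})" by auto
  then have "card T = card (\<Union>a\<in>hd ` T. {x \<in> T. hd x = a})" by (rule arg_cong)
  also have "\<dots> \<le> (\<Sum>a\<in>hd ` T. card {x \<in> T. hd x = a})" using fT by (intro card_UN_le) simp
  also have "\<dots> \<le> (\<Sum>a\<in>hd ` T. R ^ h)" by (intro sum_mono fibre)
  also have "\<dots> = card (hd ` T) * R ^ h" by simp
  also have "\<dots> \<le> R * R ^ h" using hds by (rule mult_le_mono1)
  finally show ?case by simp
qed

end

text \<open>Any n of the words, copied to the natural numbers, form a test space; the two
  alternatives of \<open>F_ok_cases\<close> meet the two counting lemmas for words.\<close>

lemma F_num_le_words:
  fixes k0 :: real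
  assumes W: "word_space K g" and n: "n \<le> D ^ h" and \<alpha>: "0 < \<alpha>" "2 * \<alpha> < K"
    and k0: "1 < k0" "k0 < k" and q: "2 \<le> q" "2 * \<alpha> < k0 ^ q" and L: "1 \<le> L"
    and g: "\<And>A. A \<subseteq> {..<D} \<Longrightarrow>
      (\<forall>a\<in>A. \<forall>b\<in>A. \<forall>c\<in>A. \<forall>e\<in>A. a \<noteq> b \<longrightarrow> c \<noteq> e \<longrightarrow> g c e \<le> \<alpha> * g a b) \<Longrightarrow> card A \<le> L"
  shows "F_num k \<alpha> n \<le> max L ((q ^ (q * 3)) ^ h)"
proof -
  interpret word_space K g by fact
  obtain W where W: "W \<subseteq> words D h" "card W = n"
    using obtain_subset_with_card_n[of n "words D h"] n card_words by metis
  have fW: "finite W" using W(1) finite_words finite_subset by blast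
  obtain N0 :: "nat set" and e f where N0: "Metric_space N0 e" and f: "bij_betw f W N0"
    and iso: "\<forall>x\<in>W. \<forall>y\<in>W. e (f x) (f y) = word_dist K g x y"
    using finite_metric_space_on_nat[OF word_metric[OF W(1)] fW] by blast
  have "finite N0" "card N0 = n"
    using f fW W(2) bij_betw_finite bij_betw_same_card by metis+
  then obtain N where N: "N \<subseteq> N0" "card N = F_num k \<alpha> n" "F_ok k \<alpha> e N"
    unfolding F_num_eq using ramsey_num_witness[where P="F_ok k \<alpha>", OF F_ok_empty N0] by blast
  define T where "T = {x \<in> W. f x \<in> N}"
  have TW: "T \<subseteq> W" unfolding T_def by blast
  have inj: "inj_on f W" using f by (simp add: bij_betw_def)
  have fT: "f ` T = N" using f N(1) unfolding T_def bij_betw_def by auto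
  have card: "card T = F_num k \<alpha> n"
    using card_image[OF inj_on_subset[OF inj TW]] fT N(2) by simp
  have dist: "word_dist K g x y = e (f x) (f y)" if "x \<in> T" "y \<in> T" for x y
    using iso TW that by (metis subsetD)
  have ne: "f x \<noteq> f y" if "x \<in> T" "y \<in> T" "x \<noteq> y" for x y
    using inj TW that by (metis inj_onD subsetD)
  from F_ok_cases[OF N(3) Metric_space.subspace[OF N0 N(1)] \<alpha>(1) k0 q] show ?thesis
  proof
    assume eq: "\<forall>x\<in>N. \<forall>y\<in>N. \<forall>z\<in>N. \<forall>w\<in>N. x \<noteq> y \<longrightarrow> z \<noteq> w \<longrightarrow> e z w \<le> \<alpha> * e x y"
    have "card T \<le> L"
    proof (rule card_near_equilateral_words[OF _ \<alpha>(2) L g])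
      show "T \<subseteq> words D h" using TW W(1) by blast
      show "\<forall>x\<in>T. \<forall>y\<in>T. \<forall>z\<in>T. \<forall>w\<in>T. x \<noteq> y \<longrightarrow> z \<noteq> w \<longrightarrow>
          word_dist K g z w \<le> \<alpha> * word_dist K g x y"
      proof (intro ballI impI)
        fix x y z w assume "x \<in> T" "y \<in> T" "z \<in> T" "w \<in> T" "x \<noteq> y" "z \<noteq> w"
        then show "word_dist K g z w \<le> \<alpha> * word_dist K g x y"
          using eq fT ne dist by (metis imageI)
      qed
    qed (use \<alpha> in auto)
    then show ?thesis using card by simp
  next
    assume sm: "\<forall>T. finite T \<longrightarrow> T \<subseteq> N \<longrightarrow>
      (\<forall>x\<in>T. \<forall>y\<in>T. \<forall>z\<in>T. \<forall>w\<in>T. x \<noteq> y \<longrightarrow> z \<noteq> w \<longrightarrow> e z w \<le> 2 * e x y) \<longrightarrow> card T \<le> q ^ (q * 3)"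
    have "card T \<le> (q ^ (q * 3)) ^ h"
    proof (rule card_words_bounded_branching)
      show "1 \<le> q ^ (q * 3)" using q(1) by (intro one_le_power) simp
      show "T \<subseteq> words D h" using TW W(1) by blast
      fix U assume U: "U \<subseteq> T" and asp: "\<forall>x\<in>U. \<forall>y\<in>U. \<forall>z\<in>U. \<forall>w\<in>U. x \<noteq> y \<longrightarrow> z \<noteq> w \<longrightarrow>
        word_dist K g z w \<le> 2 * word_dist K g x y"
      have "card (f ` U) \<le> q ^ (q * 3)"
      proof (rule sm[rule_format])
        show "finite (f ` U)" using U TW fW by (meson finite_imageI finite_subset)
        show "f ` U \<subseteq> N" using U fT by blast
        fix x y z w assume "x \<in> f ` U" "y \<in> f ` U" "z \<in> f ` U" "w \<in> f ` U" "x \<noteq> y" "z \<noteq> w"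
        then obtain x' y' z' w' where *: "x' \<in> U" "y' \<in> U" "z' \<in> U" "w' \<in> U" "x' \<noteq> y'" "z' \<noteq> w'"
          "x = f x'" "y = f y'" "z = f z'" "w = f w'" by blast
        then have "word_dist K g z' w' \<le> 2 * word_dist K g x' y'" using asp by blast
        moreover have "x' \<in> T" "y' \<in> T" "z' \<in> T" "w' \<in> T" using * U by auto
        ultimately show "e z w \<le> 2 * e x y" using dist * by metis
      qed
      moreover have "inj_on f U" using inj U TW by (meson inj_on_subset order_trans)
      ultimately show "card U \<le> q ^ (q * 3)" by (simp add: card_image)
    qed
    then show ?thesis using card by simp
  qed
qed

section \<open>Graphs without large homogeneous sets\<close>

text \<open>Prescribing membership on P leaves only the elements of E - P free.\<close>

lemma card_supersets_le:
  assumes "finite E" "P \<subseteq> E"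
  shows "card {G \<in> Pow E. P \<subseteq> G} \<le> 2 ^ (card E - card P)"
    and "card {G \<in> Pow E. P \<inter> G = {}} \<le> 2 ^ (card E - card P)"
proof -
  have fin: "finite (Pow (E - P))" using assms(1) by simp
  have c: "card (Pow (E - P)) = 2 ^ (card E - card P)"
    using assms(1) by (simp add: card_Pow card_Diff_subset[OF finite_subset[OF assms(2,1)] assms(2)])
  have "{G \<in> Pow E. P \<subseteq> G} \<subseteq> (\<lambda>H. H \<union> P) ` Pow (E - P)"
  proof
    fix G assume "G \<in> {G \<in> Pow E. P \<subseteq> G}"
    then have "G = (G - P) \<union> P" "G - P \<in> Pow (E - P)" by auto
    then show "G \<in> (\<lambda>H. H \<union> P) ` Pow (E - P)" by (rule image_eqI)
  qed
  then show "card {G \<in> Pow E. P \<subseteq> G} \<le> 2 ^ (card E - card P)"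
    using surj_card_le[OF fin] c by metis
  have "{G \<in> Pow E. P \<inter> G = {}} \<subseteq> Pow (E - P)" by auto
  then show "card {G \<in> Pow E. P \<inter> G = {}} \<le> 2 ^ (card E - card P)"
    using card_mono[OF fin] c by metis
qed

text \<open>Erdos' union bound: with s = 2 * q + 2 there are at most 2 ^ (q * s + 1) pairs of a vertex set of
  size s and a colour, and each pair is bad for a fraction 1 / 2 ^ (s choose 2) of the graphs.\<close>

lemma ramsey_graph_exists:
  assumes q: "1 \<le> q"
  shows "\<exists>G :: nat set set. \<forall>S\<subseteq>{..<2 ^ q}. card S = 2 * q + 2 \<longrightarrow>
    \<not> {p. p \<subseteq> S \<and> card p = 2} \<subseteq> G \<and> {p. p \<subseteq> S \<and> card p = 2} \<inter> G \<noteq> {}"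
proof -
  define V where "V = {..<(2 :: nat) ^ q}"
  have fV: "finite V" "card V = 2 ^ q" unfolding V_def by auto
  define s where "s = 2 * q + 2"
  define pairs where "pairs S = {p :: nat set. p \<subseteq> S \<and> card p = 2}" for S
  define c where "c = s choose 2"
  have pairs: "finite (pairs S)" "card (pairs S) = card S choose 2" if "finite S" for S
    unfolding pairs_def using n_subsets[OF that, of 2] that by auto
  define E where "E = pairs V"
  have fE: "finite E" unfolding E_def using pairs fV by simp
  define SS where "SS = {S. S \<subseteq> V \<and> card S = s}"
  have fSS: "finite SS" "card SS = 2 ^ q choose s"
    unfolding SS_def using n_subsets[OF fV(1), of s] fV by auto
  have SS: "finite S" "card (pairs S) = c" "pairs S \<subseteq> E" if "S \<in> SS" for S
  proof -
    show "finite S" using that fV(1) finite_subset unfolding SS_def by blast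
    then show "card (pairs S) = c" using that pairs unfolding SS_def c_def by simp
    show "pairs S \<subseteq> E" using that unfolding SS_def E_def pairs_def by blast
  qed
  define bad where "bad S = {G \<in> Pow E. pairs S \<subseteq> G} \<union> {G \<in> Pow E. pairs S \<inter> G = {}}" for S
  have bad: "card (bad S) \<le> 2 * 2 ^ (card E - c)" if "S \<in> SS" for S
  proof -
    have "card (bad S) \<le> card {G \<in> Pow E. pairs S \<subseteq> G} + card {G \<in> Pow E. pairs S \<inter> G = {}}"
      unfolding bad_def by (rule card_Un_le)
    also have "\<dots> \<le> 2 ^ (card E - c) + 2 ^ (card E - c)"
      using card_supersets_le[OF fE SS(3)[OF that]] SS(2)[OF that] by (intro add_mono) auto
    finally show ?thesis by simp
  qed
  have "card (\<Union>S\<in>SS. bad S) < 2 ^ card E"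
  proof (cases "SS = {}")
    case True
    then show ?thesis by simp
  next
    case False
    then obtain S where S: "S \<in> SS" by blast
    \<comment> \<open>A set of size s exists in this case, so the subtraction
      \<open>card E - c\<close> is not truncated.\<close>
    have cE: "c \<le> card E" using card_mono[OF fE SS(3)[OF S]] SS(2)[OF S] by simp
    have "s \<le> 2 ^ q" using S card_mono[OF fV(1), of S] fV(2) unfolding SS_def by auto
    then have "card SS \<le> (2 ^ q) ^ s" unfolding fSS(2) by (rule binomial_le_pow)
    then have SSle: "card SS \<le> 2 ^ (q * s)" by (simp add: power_mult)
    \<comment> \<open>The comparison is 2 * q^2 + 2 * q + 1 < 2 * q^2 + 3 * q + 1; s = 2 * q + 2 is
      the least size for which it succeeds.\<close>
    have "c = (q + 1) * (2 * q + 1)" unfolding c_def s_def choose_two by (simp add: algebra_simps)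
    then have expo: "q * s + 1 < c" using q unfolding s_def by (simp add: algebra_simps)
    have "card (\<Union>S\<in>SS. bad S) \<le> (\<Sum>S\<in>SS. card (bad S))" by (rule card_UN_le[OF fSS(1)])
    also have "\<dots> \<le> (\<Sum>S\<in>SS. 2 * 2 ^ (card E - c))" by (intro sum_mono bad)
    also have "\<dots> = card SS * (2 * 2 ^ (card E - c))" by simp
    also have "\<dots> \<le> 2 ^ (q * s) * (2 * 2 ^ (card E - c))" using SSle by (rule mult_le_mono1)
    also have "\<dots> = 2 ^ (q * s + 1 + (card E - c))" by (simp add: power_add)
    also have "\<dots> < 2 ^ card E" using expo cE by (intro power_strict_increasing) auto
    finally show ?thesis .
  qed
  then have "card (\<Union>S\<in>SS. bad S) < card (Pow E)" using fE by (simp add: card_Pow)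
  moreover have "finite (\<Union>S\<in>SS. bad S)" using fSS(1) fE unfolding bad_def by auto
  ultimately have "\<not> Pow E \<subseteq> (\<Union>S\<in>SS. bad S)" using card_mono not_le by blast
  then obtain G where G: "G \<in> Pow E" "G \<notin> (\<Union>S\<in>SS. bad S)" by blast
  then have "\<not> pairs S \<subseteq> G \<and> pairs S \<inter> G \<noteq> {}" if "S \<subseteq> V" "card S = s" for S
    using that unfolding SS_def bad_def by blast
  then show ?thesis
    unfolding pairs_def V_def s_def by blast
qed

lemma ramsey_metric_exists:
  assumes q: "1 \<le> q"
  shows "\<exists>g :: nat \<Rightarrow> nat \<Rightarrow> real. (\<forall>a b. g a b = 1 \<or> g a b = 2) \<and> (\<forall>a b. g a b = g b a) \<and>
    (\<forall>A c. A \<subseteq> {..<2 ^ q} \<longrightarrow> (\<forall>a\<in>A. \<forall>b\<in>A. a \<noteq> b \<longrightarrow> g a b = c) \<longrightarrow> card A \<le> 2 * q + 1)"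
proof -
  obtain G :: "nat set set" where G: "\<forall>S\<subseteq>{..<2 ^ q}. card S = 2 * q + 2 \<longrightarrow>
    \<not> {p. p \<subseteq> S \<and> card p = 2} \<subseteq> G \<and> {p. p \<subseteq> S \<and> card p = 2} \<inter> G \<noteq> {}"
    using ramsey_graph_exists[OF q] by blast
  define g where "g a b = (if {a, b} \<in> G then 1 else 2 :: real)" for a b
  show ?thesis
  proof (intro exI[of _ g] conjI allI impI)
    show "g a b = 1 \<or> g a b = 2" for a b by (simp add: g_def)
    show "g a b = g b a" for a b by (simp add: g_def insert_commute)
    fix A c assume A: "A \<subseteq> {..<2 ^ q}" and hom: "\<forall>a\<in>A. \<forall>b\<in>A. a \<noteq> b \<longrightarrow> g a b = c"
    show "card A \<le> 2 * q + 1"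
    proof (rule ccontr)
      assume "\<not> ?thesis"
      then have "2 * q + 2 \<le> card A" by simp
      then obtain S where S: "S \<subseteq> A" "card S = 2 * q + 2"
        using obtain_subset_with_card_n by metis
      have G': "\<not> {p. p \<subseteq> S \<and> card p = 2} \<subseteq> G" "{p. p \<subseteq> S \<and> card p = 2} \<inter> G \<noteq> {}"
        using G S A by (meson order_trans)+
      obtain p where "p \<subseteq> S" "card p = 2" "p \<notin> G" using G'(1) by blast
      then obtain a b where "a \<in> A" "b \<in> A" "a \<noteq> b" "{a, b} \<notin> G"
        using S(1) by (auto simp: card_2_iff)
      then have "c = 2" using hom[rule_format, of a b] by (simp add: g_def)
      obtain p where "p \<subseteq> S" "card p = 2" "p \<in> G" using G'(2) by blast
      then obtain a b where "a \<in> A" "b \<in> A" "a \<noteq> b" "{a, b} \<in> G"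
        using S(1) by (auto simp: card_2_iff)
      then have "c = 1" using hom[rule_format, of a b] by (simp add: g_def)
      with \<open>c = 2\<close> show False by simp
    qed
  qed
qed

section \<open>Upper bounds\<close>

text \<open>A gap below k is needed since a triple of one colour to base k0 only has
  \<open>c_eq\<close> at most k0, which must contradict a lower bound k.\<close>

lemma triple_ratio_exists:
  fixes k \<alpha> :: real
  assumes "1 < k"
  obtains k0 :: real and q :: nat where "1 < k0" "k0 < k" "2 \<le> q" "2 * \<alpha> < k0 ^ q"
proof -
  obtain k0 where k0: "1 < k0" "k0 < k" using dense[OF assms] by blast
  obtain q0 where "2 * \<alpha> < k0 ^ q0" using real_arch_pow[OF k0(1)] by blast
  also have "k0 ^ q0 \<le> k0 ^ max 2 q0" using k0 by (intro power_increasing) auto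
  finally show thesis using that[OF k0, of "max 2 q0"] by simp
qed

lemma F_num_le_n: "F_num k \<alpha> n \<le> n"
  unfolding F_num_eq by (rule ramsey_num_le) (rule F_ok_empty)

lemma F_num_upper_large_distortion:
  fixes \<alpha> k :: real
  assumes k: "1 < k" and \<alpha>: "0 < \<alpha>"
  shows "\<exists>C>0. \<forall>n\<ge>1. real (F_num k \<alpha> n) \<le> exp (C * sqrt (ln (real n)))"
proof -
  obtain k0 :: real and q :: nat where k0: "1 < k0" "k0 < k" and q: "2 \<le> q" "2 * \<alpha> < k0 ^ q"
    using triple_ratio_exists[OF k] by blast
  define R where "R = q ^ (q * 3)"
  have "q ^ 1 \<le> q ^ (q * 3)" using q(1) by (intro power_increasing) auto
  then have R: "2 \<le> R" unfolding R_def using q(1) by simp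
  \<comment> \<open>The 2 comes from rounding y up to h \<le> 2 * y, and sqrt (ln 2) from passing
    between binary and natural logarithms.\<close>
  define C where "C = 2 * ln (real R) / sqrt (ln 2)"
  have C: "0 < C" unfolding C_def using R by simp
  have "real (F_num k \<alpha> n) \<le> exp (C * sqrt (ln (real n)))" if n: "1 \<le> n" for n
  proof (cases "n = 1")
    case True
    then show ?thesis using F_num_le_n[of k \<alpha> n] by simp
  next
    case False
    define y where "y = sqrt (log 2 (real n))"
    have y: "1 \<le> y" "y * y = log 2 (real n)"
      unfolding y_def using False n by (auto simp: le_log_iff)
    define h where "h = nat \<lceil>y\<rceil>"
    have h: "y \<le> real h" "real h \<le> 2 * y" unfolding h_def using y(1) by linarith+
    have "log 2 (real n) \<le> real h * real h" unfolding y(2)[symmetric] using h(1) y(1) by (intro mult_mono) auto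
    then have "real n \<le> 2 powr (real h * real h)" using n by (simp add: log_le_iff)
    also have "\<dots> = 2 powr real (h * h)" by simp
    also have "\<dots> = real ((2 ^ h) ^ h)" by (simp add: powr_realpow power_mult flip: of_nat_mult)
    finally have nle: "n \<le> (2 ^ h) ^ h" unfolding of_nat_le_iff .
    have "F_num k \<alpha> n \<le> max (2 ^ h) ((q ^ (q * 3)) ^ h)"
    proof (rule F_num_le_words[OF _ nle \<alpha> _ k0 q])
      \<comment> \<open>With constant g the whole alphabet is equilateral, so L is its size 2^h,
        which is at most R^h since R \<ge> 2.\<close>
      show "word_space (2 * \<alpha> + 1) (\<lambda>_ _. 1)" by unfold_locales (use \<alpha> in auto)
      show "card A \<le> 2 ^ h" if "A \<subseteq> {..<2 ^ h}" for A :: "nat set"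
        using card_mono[OF _ that] by simp
    qed auto
    also have "\<dots> \<le> R ^ h" unfolding R_def[symmetric] using R by (auto intro: power_mono)
    finally have "real (F_num k \<alpha> n) \<le> real R ^ h" by (metis of_nat_le_iff of_nat_power)
    also have "\<dots> = exp (real h * ln (real R))" using R by (simp add: exp_of_nat_mult)
    also have "\<dots> \<le> exp (2 * y * ln (real R))"
      unfolding exp_le_cancel_iff using h(2) R by (intro mult_right_mono) auto
    also have "2 * y * ln (real R) = C * sqrt (ln (real n))"
      unfolding y_def C_def log_def by (simp add: real_sqrt_divide)
    finally show ?thesis .
  qed
  then show ?thesis using C by blast
qed

lemma F_num_upper_small_distortion:
  fixes \<alpha> k :: real
  assumes k: "1 < k" and \<alpha>: "0 < \<alpha>" "\<alpha> < 2"
  shows "\<exists>C>0. \<forall>n\<ge>3. real (F_num k \<alpha> n) \<le> C * (ln (real n) / ln (ln (real n)))"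
proof -
  obtain k0 :: real and q :: nat where k0: "1 < k0" "k0 < k" and q: "2 \<le> q" "2 * \<alpha> < k0 ^ q"
    using triple_ratio_exists[OF k] by blast
  define R where "R = q ^ (q * 3)"
  have "q ^ 1 \<le> q ^ (q * 3)" using q(1) by (intro power_increasing) auto
  then have R: "2 \<le> R" unfolding R_def using q(1) by simp
  define r where "r = ln (real R)"
  have r: "0 < r" unfolding r_def using R by simp
  \<comment> \<open>The first two terms bound 2 * m + 1 \<le> 2 * z + 3, where h \<ge> y / 2 gives z
    \<le> (4 * r / ln 2) * (X / Y). The term R covers R^h, including the case h = 1.\<close>
  define C where "C = 8 * r / ln 2 + 3 + real R"
  have C: "0 < C" unfolding C_def using r by (intro add_nonneg_pos) (use R in auto)
  have "ln (exp 1) < ln (3 :: real)"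
    using e_less_272 by (subst ln_less_cancel_iff) auto
  then have ln3: "1 < ln (3 :: real)" by simp
  have "real (F_num k \<alpha> n) \<le> C * (ln (real n) / ln (ln (real n)))" if n: "3 \<le> n" for n
  proof -
    define X where "X = ln (real n)"
    define Y where "Y = ln X"
    have "ln 3 \<le> X" unfolding X_def using n by (subst ln_le_cancel_iff) auto
    then have X1: "1 < X" using ln3 by linarith
    then have Y0: "0 < Y" unfolding Y_def by simp
    have "Y \<le> X" unfolding Y_def using X1 ln_le_minus_one[of X] by linarith
    then have XY: "1 \<le> X / Y" using Y0 by simp
    \<comment> \<open>This word length makes R^h at most exp (Y / 2), the square root of ln n, which
      is below X / Y.\<close>
    define y where "y = Y / (2 * r)"
    have y0: "0 < y" unfolding y_def using Y0 r by simp
    define h where "h = max 1 (nat \<lfloor>y\<rfloor>)"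
    have h: "1 \<le> h" "y \<le> 2 * real h" "real h \<le> max 1 y"
      unfolding h_def using y0 by (auto simp: max_def) linarith+
    \<comment> \<open>With 2^z letters there would be exactly n words of length h; z is rounded up
      to m.\<close>
    define z where "z = X / (real h * ln 2)"
    have z0: "0 < z" unfolding z_def using X1 h(1) by simp
    define m where "m = nat \<lceil>z\<rceil>"
    have m: "1 \<le> m" "z \<le> real m" "real m \<le> z + 1" unfolding m_def using z0 by linarith+
    have "X = z * (real h * ln 2)" unfolding z_def using h(1) by simp
    also have "\<dots> \<le> real m * (real h * ln 2)" using m(2) by (intro mult_right_mono) auto
    also have "\<dots> = ln (2 ^ (m * h))" by (subst ln_realpow) auto
    finally have "real n \<le> 2 ^ (m * h)" unfolding X_def using n by (subst (asm) ln_le_cancel_iff) auto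
    then have "real n \<le> real ((2 ^ m) ^ h)" by (simp add: power_mult)
    then have nle: "n \<le> (2 ^ m) ^ h" unfolding of_nat_le_iff .
    obtain g :: "nat \<Rightarrow> nat \<Rightarrow> real" where g12: "\<forall>a b. g a b = 1 \<or> g a b = 2" "\<forall>a b. g a b = g b a"
      and hom: "\<forall>A c. A \<subseteq> {..<2 ^ m} \<longrightarrow> (\<forall>a\<in>A. \<forall>b\<in>A. a \<noteq> b \<longrightarrow> g a b = c) \<longrightarrow> card A \<le> 2 * m + 1"
      using ramsey_metric_exists[OF m(1)] by (elim exE conjE)
    have "F_num k \<alpha> n \<le> max (2 * m + 1) ((q ^ (q * 3)) ^ h)"
    proof (rule F_num_le_words[OF _ nle \<alpha>(1) _ k0 q])
      show "word_space (2 * \<alpha> + 1) g" by unfold_locales (use \<alpha> g12 in auto)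
      fix A assume A: "A \<subseteq> {..<2 ^ m}"
        and asp: "\<forall>a\<in>A. \<forall>b\<in>A. \<forall>c\<in>A. \<forall>e\<in>A. a \<noteq> b \<longrightarrow> c \<noteq> e \<longrightarrow> g c e \<le> \<alpha> * g a b"
      \<comment> \<open>As \<alpha> < 2, the values 1 and 2 cannot both occur in A, so A is
        homogeneous in the graph.\<close>
      have const: "g c e = 1" if "a \<in> A" "b \<in> A" "a \<noteq> b" "g a b = 1" "c \<in> A" "e \<in> A" "c \<noteq> e" for a b c e
      proof -
        have "g c e \<le> \<alpha> * 1" using asp that by metis
        then show ?thesis using g12(1)[rule_format, of c e] \<alpha>(2) by auto
      qed
      show "card A \<le> 2 * m + 1"
      proof (cases "\<exists>a\<in>A. \<exists>b\<in>A. a \<noteq> b \<and> g a b = 1")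
        case True
        then have "\<forall>a\<in>A. \<forall>b\<in>A. a \<noteq> b \<longrightarrow> g a b = 1" using const by blast
        then show ?thesis by (rule hom[THEN spec, THEN spec, THEN mp, THEN mp, OF A])
      next
        case False
        then have "\<forall>a\<in>A. \<forall>b\<in>A. a \<noteq> b \<longrightarrow> g a b = 2" using g12(1) by blast
        then show ?thesis by (rule hom[THEN spec, THEN spec, THEN mp, THEN mp, OF A])
      qed
    qed auto
    then have "real (F_num k \<alpha> n) \<le> real (max (2 * m + 1) (R ^ h))"
      unfolding R_def of_nat_le_iff .
    then have F: "real (F_num k \<alpha> n) \<le> max (2 * real m + 1) (real R ^ h)"
      by (simp add: of_nat_max)
    have 1: "2 * real m + 1 \<le> (8 * r / ln 2 + 3) * (X / Y)"
    proof -
      have "z \<le> X / (y / 2 * ln 2)"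
        unfolding z_def using X1 y0 h(2) by (intro divide_left_mono mult_right_mono) auto
      also have "\<dots> = 4 * r / ln 2 * (X / Y)" unfolding y_def using r Y0 by (simp add: field_simps)
      finally have "2 * real m + 1 \<le> 2 * (4 * r / ln 2 * (X / Y)) + 3" using m(3) by linarith
      also have "\<dots> \<le> 2 * (4 * r / ln 2 * (X / Y)) + 3 * (X / Y)" using XY by linarith
      also have "\<dots> = (8 * r / ln 2 + 3) * (X / Y)" by (simp add: algebra_simps)
      finally show ?thesis .
    qed
    have 2: "real R ^ h \<le> real R * (X / Y)"
    proof (cases "y \<le> 1")
      case True
      then have "h = 1" using h(1,3) by simp
      then show ?thesis using mult_left_mono[OF XY, of "real R"] by simp
    next
      case False
      then have "real h \<le> y" using h(3) by simp
      have "real R ^ h = exp (real h * r)" unfolding r_def using R by (simp add: exp_of_nat_mult)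
      also have "\<dots> \<le> exp (y * r)" unfolding exp_le_cancel_iff using \<open>real h \<le> y\<close> r by (intro mult_right_mono) auto
      also have "y * r = Y / 2" unfolding y_def using r by simp
      \<comment> \<open>Since X is the square of exp (Y / 2), this amounts to Y \<le> exp (Y / 2),
        which the quadratic Taylor bound yields.\<close>
      also have "exp (Y / 2) \<le> X / Y"
      proof -
        have "1 + Y / 2 + (Y / 2)\<^sup>2 / 2 \<le> exp (Y / 2)" using Y0 by (intro exp_lower_Taylor_quadratic) simp
        moreover have "0 \<le> (Y / 2 - 1)\<^sup>2" by simp
        then have "Y \<le> 1 + Y / 2 + (Y / 2)\<^sup>2 / 2" by (simp add: power2_eq_square algebra_simps)
        ultimately have "Y \<le> exp (Y / 2)" by linarith
        then have "exp (Y / 2) * Y \<le> exp (Y / 2) * exp (Y / 2)" by (intro mult_left_mono) auto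
        also have "\<dots> = exp Y" by (simp flip: exp_add)
        also have "\<dots> = X" unfolding Y_def using X1 by simp
        finally show ?thesis using Y0 by (simp add: le_divide_eq)
      qed
      also have "1 * (X / Y) \<le> real R * (X / Y)" using R XY by (intro mult_right_mono) auto
      finally show ?thesis by simp
    qed
    have "(8 * r / ln 2 + 3) * (X / Y) \<le> C * (X / Y)" "real R * (X / Y) \<le> C * (X / Y)"
      using XY r unfolding C_def by (intro mult_right_mono; simp)+
    then have "real (F_num k \<alpha> n) \<le> C * (X / Y)" using F 1 2 by linarith
    then show ?thesis unfolding X_def Y_def X_def .
  qed
  then show ?thesis using C by blast
qed

theorem theorem1p7:
  shows "(\<forall>\<alpha> k :: real. \<alpha> > 2 \<and> k > 2 \<longrightarrow>
            (\<exists>c C :: real. c > 0 \<and> C > 0 \<and> (\<forall>n :: nat. n \<ge> 1 \<longrightarrow>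
               exp (c * sqrt (ln (real n))) \<le> real (E_num k \<alpha> n) \<and>
               E_num k \<alpha> n \<le> F_num k \<alpha> n \<and>
               real (F_num k \<alpha> n) \<le> exp (C * sqrt (ln (real n)))))) \<and>
         (\<forall>\<alpha> k :: real. 1 < \<alpha> \<and> \<alpha> < 2 \<and> k > 2 \<longrightarrow>
            (\<exists>c C :: real. c > 0 \<and> C > 0 \<and> (\<forall>n :: nat. n \<ge> 3 \<longrightarrow>
               c * (ln (real n) / ln (ln (real n))) \<le> real (E_num k \<alpha> n) \<and>
               E_num k \<alpha> n \<le> F_num k \<alpha> n \<and>
               real (F_num k \<alpha> n) \<le> C * (ln (real n) / ln (ln (real n)))))) \<and>
         (\<forall>\<alpha> k :: real. \<alpha> > 2 \<and> 1 < k \<and> k < 2 \<longrightarrow>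
            (\<exists>c C :: real. c > 0 \<and> C > 0 \<and> (\<forall>n :: nat. n \<ge> 1 \<longrightarrow>
               exp (c * sqrt (ln (real n))) \<le> real (E_num k \<alpha> n) \<and>
               real (E_num k \<alpha> n) \<le> exp (C * sqrt (ln (real n)))))) \<and>
         (\<forall>\<alpha> k :: real. 1 < \<alpha> \<and> \<alpha> < 2 \<and> 1 < k \<and> k < 2 \<longrightarrow>
            (\<exists>c C :: real. c > 0 \<and> C > 0 \<and> (\<forall>n :: nat. n \<ge> 3 \<longrightarrow>
               c * (ln (real n) / ln (ln (real n))) \<le> real (E_num k \<alpha> n) \<and>
               real (E_num k \<alpha> n) \<le> C * (ln (real n) / ln (ln (real n))))))"
proof -
  have mono: "E_num k \<alpha> n \<le> F_num k \<alpha> n" if "1 < k" for k \<alpha> n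
    using that by (intro E_num_le_F_num) simp
  \<comment> \<open>Stated for all k > 1, so that it serves both ranges of k; for 1 < k < 2 the
    bound on \<open>F_num\<close> is passed down to \<open>E_num\<close>.\<close>
  have large: "\<exists>c C :: real. c > 0 \<and> C > 0 \<and> (\<forall>n :: nat. n \<ge> 1 \<longrightarrow>
      exp (c * sqrt (ln (real n))) \<le> real (E_num k \<alpha> n) \<and> E_num k \<alpha> n \<le> F_num k \<alpha> n \<and>
      real (F_num k \<alpha> n) \<le> exp (C * sqrt (ln (real n))))" if \<alpha>k: "2 < \<alpha>" "1 < k" for \<alpha> k
  proof -
    obtain c where "0 < c" "\<forall>n\<ge>1. exp (c * sqrt (ln (real n))) \<le> real (E_num k \<alpha> n)"
      using E_num_lower_large_distortion[of k \<alpha>] \<alpha>k by auto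
    moreover obtain C where "0 < C" "\<forall>n\<ge>1. real (F_num k \<alpha> n) \<le> exp (C * sqrt (ln (real n)))"
      using F_num_upper_large_distortion[of k \<alpha>] \<alpha>k by auto
    ultimately show ?thesis
      using mono[OF \<alpha>k(2)] by (intro exI[of _ c] exI[of _ C]) simp
  qed
  have small: "\<exists>c C :: real. c > 0 \<and> C > 0 \<and> (\<forall>n :: nat. n \<ge> 3 \<longrightarrow>
      c * (ln (real n) / ln (ln (real n))) \<le> real (E_num k \<alpha> n) \<and> E_num k \<alpha> n \<le> F_num k \<alpha> n \<and>
      real (F_num k \<alpha> n) \<le> C * (ln (real n) / ln (ln (real n))))" if \<alpha>k: "1 < \<alpha>" "\<alpha> < 2" "1 < k" for \<alpha> k
  proof -
    obtain c where "0 < c" "\<forall>n\<ge>3. c * (ln (real n) / ln (ln (real n))) \<le> real (E_num k \<alpha> n)"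
      using E_num_lower_small_distortion[of k \<alpha>] \<alpha>k by auto
    moreover obtain C where "0 < C" "\<forall>n\<ge>3. real (F_num k \<alpha> n) \<le> C * (ln (real n) / ln (ln (real n)))"
      using F_num_upper_small_distortion[of k \<alpha>] \<alpha>k by auto
    ultimately show ?thesis
      using mono[OF \<alpha>k(3)] by (intro exI[of _ c] exI[of _ C]) simp
  qed
  have E: "real (E_num k \<alpha> n) \<le> b" if "E_num k \<alpha> n \<le> F_num k \<alpha> n" "real (F_num k \<alpha> n) \<le> b" for k \<alpha> n b
    using that by linarith
  show ?thesis
  proof (intro conjI allI impI)
    fix \<alpha> k :: real
    assume "2 < \<alpha> \<and> 2 < k"
    then show "\<exists>c C :: real. c > 0 \<and> C > 0 \<and> (\<forall>n :: nat. n \<ge> 1 \<longrightarrow>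
        exp (c * sqrt (ln (real n))) \<le> real (E_num k \<alpha> n) \<and> E_num k \<alpha> n \<le> F_num k \<alpha> n \<and>
        real (F_num k \<alpha> n) \<le> exp (C * sqrt (ln (real n))))"
      by (intro large) auto
  next
    fix \<alpha> k :: real
    assume "1 < \<alpha> \<and> \<alpha> < 2 \<and> 2 < k"
    then show "\<exists>c C :: real. c > 0 \<and> C > 0 \<and> (\<forall>n :: nat. n \<ge> 3 \<longrightarrow>
        c * (ln (real n) / ln (ln (real n))) \<le> real (E_num k \<alpha> n) \<and> E_num k \<alpha> n \<le> F_num k \<alpha> n \<and>
        real (F_num k \<alpha> n) \<le> C * (ln (real n) / ln (ln (real n))))"
      by (intro small) auto
  next
    fix \<alpha> k :: real
    assume "2 < \<alpha> \<and> 1 < k \<and> k < 2"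
    then show "\<exists>c C :: real. c > 0 \<and> C > 0 \<and> (\<forall>n :: nat. n \<ge> 1 \<longrightarrow>
        exp (c * sqrt (ln (real n))) \<le> real (E_num k \<alpha> n) \<and>
        real (E_num k \<alpha> n) \<le> exp (C * sqrt (ln (real n))))"
      using large[of \<alpha> k] E[of k \<alpha>] by meson
  next
    fix \<alpha> k :: real
    assume "1 < \<alpha> \<and> \<alpha> < 2 \<and> 1 < k \<and> k < 2"
    then show "\<exists>c C :: real. c > 0 \<and> C > 0 \<and> (\<forall>n :: nat. n \<ge> 3 \<longrightarrow>
        c * (ln (real n) / ln (ln (real n))) \<le> real (E_num k \<alpha> n) \<and>
        real (E_num k \<alpha> n) \<le> C * (ln (real n) / ln (ln (real n))))"
      using small[of \<alpha> k] E[of k \<alpha>] by meson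
  qed
qed

end
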